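(* Let $s>0$, $T>0$, let $\Omega\subset\mathbb{R}^d$ be an open bounded set with Lipschitz boundary, and let $u_0\in\tilde H^s(\Omega)$, $v_0\in L^2(\Omega)$. Then there exists a weak solution of the fractional wave equation $$ \begin{cases} u_{tt}+(-\Delta)^s u=0 & \text{in }(0,T)\times\Omega,\\ u(t,x)=0 & \text{in }[0,T]\times(\mathbb{R}^d\setminus\Omega),\\ u(0,x)=u_0(x) & \text{in }\Omega,\\ u_t(0,x)=v_0(x) & \text{in }\Omega, \end{cases} $$ that is, there exists a function $$u\in L^\infty(0,T;\tilde H^s(\Omega))\cap W^{1,\infty}(0,T;L^2(\Omega)),\qquad u_{tt}\in L^\infty(0,T;H^{-s}(\Omega)),$$ such that $$\int_0^T\int_\Omega u_{tt}(t)\,\varphi(t)\,dx\,dt+\int_0^T[u(t),\varphi(t)]_s\,dt=0\qquad\text{for all }\varphi\in L^1(0,T;\tilde H^s(\Omega)),$$ and the initial conditions are satisfied in the sense $$\lim_{h\to0^+}\frac1h\int_0^h\Big(\|u(t)-u_0\|_{L^2(\Omega)}^2+[u(t)-u_0]_s^2\Big)\,dt=0,\qquad \lim_{h\to0^+}\frac1h\int_0^h\|u_t(t)-v_0\|_{L^2(\Omega)}^2\,dt=0.$$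
   Context: For $s>0$, $(-\Delta)^s$ denotes the fractional Laplacian on $\mathbb{R}^d$, normalized as the Fourier multiplier $|\xi|^{2s}$. For $u,v\in H^s(\mathbb{R}^d)$ set $[u,v]_s=\int_{\mathbb{R}^d}(-\Delta)^{s/2}u\,(-\Delta)^{s/2}v\,dx$, $[u]_s=\sqrt{[u,u]_s}$, and $\|u\|_s=(\|u\|_{L^2(\mathbb{R}^d)}^2+[u]_s^2)^{1/2}$, a norm equivalent to the usual one on $H^s(\mathbb{R}^d)$. $\tilde H^s(\Omega)=\{u\in H^s(\mathbb{R}^d): u=0\text{ a.e. in }\mathbb{R}^d\setminus\Omega\}$ with norm $\|\cdot\|_s$, and $H^{-s}(\Omega)=(\tilde H^s(\Omega))^*$. The integral $\int_\Omega u_{tt}(t)\varphi(t)\,dx$ is understood as the duality pairing between $H^{-s}(\Omega)$ and $\tilde H^s(\Omega)$ (extending the $L^2(\Omega)$ inner product). *)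

theory Defs
  imports "HOL-Analysis.Analysis"
begin

text \<open>
  Elements of function spaces are represented by functions rather than by equivalence classes
  modulo null sets, so the norms below are seminorms on the representatives.
\<close>

section \<open>Square-integrable functions and the fractional Laplacian\<close>

definition L2 :: "(real ^ 'd) set \<Rightarrow> (real ^ 'd \<Rightarrow> real) set" where
  "L2 A = {f. f \<in> borel_measurable (lebesgue_on A) \<and> integrable (lebesgue_on A) (\<lambda>x. (f x)\<^sup>2)}"

definition L2_norm :: "(real ^ 'd) set \<Rightarrow> (real ^ 'd \<Rightarrow> real) \<Rightarrow> real" where
  "L2_norm A f = sqrt (\<integral>x. (f x)\<^sup>2 \<partial>lebesgue_on A)"

definition truncated_fourier :: "(real ^ 'd \<Rightarrow> real) \<Rightarrow> real \<Rightarrow> real ^ 'd \<Rightarrow> complex" where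
  "truncated_fourier f R \<xi> =
     of_real ((2 * pi) powr (- real CARD('d) / 2)) *
       (\<integral>x. of_real (f x) * cis (- (\<xi> \<bullet> x)) \<partial>lebesgue_on (cball 0 R))"

text \<open>
  The Fourier--Plancherel transform on \<open>L\<^sup>2\<close>, as a relation (the transform is unique only up to
  null sets): the truncated integrals converge to \<open>g\<close> in the mean.
\<close>

definition is_L2_fourier :: "(real ^ 'd \<Rightarrow> real) \<Rightarrow> (real ^ 'd \<Rightarrow> complex) \<Rightarrow> bool" where
  "is_L2_fourier f g \<longleftrightarrow>
     f \<in> L2 UNIV \<and>
     g \<in> borel_measurable lebesgue \<and> integrable lebesgue (\<lambda>\<xi>. (cmod (g \<xi>))\<^sup>2) \<and>
     ((\<lambda>R. \<integral>\<^sup>+\<xi>. ennreal ((cmod (truncated_fourier f R \<xi> - g \<xi>))\<^sup>2) \<partial>lebesgue) \<longlongrightarrow> 0) at_top"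

definition Hs :: "real \<Rightarrow> (real ^ 'd \<Rightarrow> real) set" where
  "Hs s = {u \<in> L2 UNIV. \<exists>g. is_L2_fourier u g \<and>
             integrable lebesgue (\<lambda>\<xi>. (1 + (norm \<xi>)\<^sup>2) powr s * (cmod (g \<xi>))\<^sup>2)}"

text \<open>
  \<open>frac_laplacian s\<close> is \<open>(-\<Delta>)\<^sup>s\<close> on functions \<open>u\<close> for which the result is in \<open>L\<^sup>2\<close> (for \<open>u\<close> in \<open>Hs s\<close>
  this is the case for \<open>frac_laplacian (s / 2) u\<close>); the choice is unique up to null sets.
\<close>

definition is_frac_laplacian ::
    "real \<Rightarrow> (real ^ 'd \<Rightarrow> real) \<Rightarrow> (real ^ 'd \<Rightarrow> real) \<Rightarrow> bool" where
  "is_frac_laplacian s u w \<longleftrightarrow>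
     (\<exists>g. is_L2_fourier u g \<and>
          is_L2_fourier w (\<lambda>\<xi>. of_real (norm \<xi> powr (2 * s)) * g \<xi>))"

definition frac_laplacian :: "real \<Rightarrow> (real ^ 'd \<Rightarrow> real) \<Rightarrow> real ^ 'd \<Rightarrow> real" where
  "frac_laplacian s u = (SOME w. is_frac_laplacian s u w)"

definition Hs_form :: "real \<Rightarrow> (real ^ 'd \<Rightarrow> real) \<Rightarrow> (real ^ 'd \<Rightarrow> real) \<Rightarrow> real" where
  "Hs_form s u v = (\<integral>x. frac_laplacian (s / 2) u x * frac_laplacian (s / 2) v x \<partial>lebesgue)"

definition Hs_seminorm :: "real \<Rightarrow> (real ^ 'd \<Rightarrow> real) \<Rightarrow> real" where
  "Hs_seminorm s u = sqrt (Hs_form s u u)"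

definition Hs_norm :: "real \<Rightarrow> (real ^ 'd \<Rightarrow> real) \<Rightarrow> real" where
  "Hs_norm s u = sqrt ((L2_norm UNIV u)\<^sup>2 + (Hs_seminorm s u)\<^sup>2)"

definition Hs_tilde :: "real \<Rightarrow> (real ^ 'd) set \<Rightarrow> (real ^ 'd \<Rightarrow> real) set" where
  "Hs_tilde s \<Omega> = {u \<in> Hs s. AE x in lebesgue. x \<notin> \<Omega> \<longrightarrow> u x = 0}"


section \<open>Dual spaces\<close>

text \<open>
  Functionals are total functions; only their values on the carrier \<open>X\<close> matter.
\<close>

definition dual_space :: "('x \<Rightarrow> real) set \<Rightarrow> (('x \<Rightarrow> real) \<Rightarrow> real) \<Rightarrow> (('x \<Rightarrow> real) \<Rightarrow> real) set" where
  "dual_space X N = {l.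
     (\<forall>v\<in>X. \<forall>w\<in>X. \<forall>a b. l (\<lambda>x. a * v x + b * w x) = a * l v + b * l w) \<and>
     (\<exists>C. \<forall>v\<in>X. \<bar>l v\<bar> \<le> C * N v)}"

definition dual_norm :: "('x \<Rightarrow> real) set \<Rightarrow> (('x \<Rightarrow> real) \<Rightarrow> real) \<Rightarrow> (('x \<Rightarrow> real) \<Rightarrow> real) \<Rightarrow> real" where
  "dual_norm X N l = (SUP v\<in>{v \<in> X. N v \<le> 1}. \<bar>l v\<bar>)"

definition Hs_dual :: "real \<Rightarrow> (real ^ 'd) set \<Rightarrow> ((real ^ 'd \<Rightarrow> real) \<Rightarrow> real) set" where
  "Hs_dual s \<Omega> = dual_space (Hs_tilde s \<Omega>) (Hs_norm s)"

definition Hs_dual_norm :: "real \<Rightarrow> (real ^ 'd) set \<Rightarrow> ((real ^ 'd \<Rightarrow> real) \<Rightarrow> real) \<Rightarrow> real" where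
  "Hs_dual_norm s \<Omega> = dual_norm (Hs_tilde s \<Omega>) (Hs_norm s)"

definition L2_functional :: "(real ^ 'd) set \<Rightarrow> (real ^ 'd \<Rightarrow> real) \<Rightarrow> (real ^ 'd \<Rightarrow> real) \<Rightarrow> real" where
  "L2_functional \<Omega> f v = (\<integral>x. f x * v x \<partial>lebesgue_on \<Omega>)"


section \<open>Vector-valued functions on a time interval\<close>

text \<open>
  A normed space is given by a carrier \<open>X\<close> of real-valued functions and a (semi)norm \<open>N\<close> on it; this
  covers both spaces of functions on \<open>\<real>\<^sup>d\<close> and spaces of functionals on such functions. The library's
  Bochner integral does not apply since the spaces are not types.
\<close>

definition X_simple :: "real \<Rightarrow> ('x \<Rightarrow> real) set \<Rightarrow> (real \<Rightarrow> 'x \<Rightarrow> real) \<Rightarrow> bool" where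
  "X_simple T X S \<longleftrightarrow> simple_function (lebesgue_on {0<..<T}) S \<and> S ` {0<..<T} \<subseteq> X"

definition X_simple_integral :: "real \<Rightarrow> (real \<Rightarrow> 'x \<Rightarrow> real) \<Rightarrow> 'x \<Rightarrow> real" where
  "X_simple_integral T S =
     (\<lambda>x. \<Sum>y\<in>S ` {0<..<T}. measure lebesgue {t \<in> {0<..<T}. S t = y} * y x)"

definition strongly_measurable ::
    "real \<Rightarrow> ('x \<Rightarrow> real) set \<Rightarrow> (('x \<Rightarrow> real) \<Rightarrow> real) \<Rightarrow> (real \<Rightarrow> 'x \<Rightarrow> real) \<Rightarrow> bool" where
  "strongly_measurable T X N f \<longleftrightarrow>
     (AE t in lebesgue_on {0<..<T}. f t \<in> X) \<and>
     (\<exists>S. (\<forall>n. X_simple T X (S n)) \<and>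
        (AE t in lebesgue_on {0<..<T}. (\<lambda>n. N (\<lambda>x. S n t x - f t x)) \<longlonglongrightarrow> 0))"

definition has_X_integral ::
    "real \<Rightarrow> ('x \<Rightarrow> real) set \<Rightarrow> (('x \<Rightarrow> real) \<Rightarrow> real) \<Rightarrow> (real \<Rightarrow> 'x \<Rightarrow> real) \<Rightarrow> ('x \<Rightarrow> real) \<Rightarrow> bool" where
  "has_X_integral T X N f I \<longleftrightarrow>
     strongly_measurable T X N f \<and> I \<in> X \<and>
     (\<exists>S. (\<forall>n. X_simple T X (S n)) \<and>
        (\<lambda>n. \<integral>\<^sup>+t. ennreal (N (\<lambda>x. S n t x - f t x)) \<partial>lebesgue_on {0<..<T}) \<longlonglongrightarrow> 0 \<and>
        (\<lambda>n. N (\<lambda>x. X_simple_integral T (S n) x - I x)) \<longlonglongrightarrow> 0)"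

definition L1_time ::
    "real \<Rightarrow> ('x \<Rightarrow> real) set \<Rightarrow> (('x \<Rightarrow> real) \<Rightarrow> real) \<Rightarrow> (real \<Rightarrow> 'x \<Rightarrow> real) set" where
  "L1_time T X N =
     {f. strongly_measurable T X N f \<and> integrable (lebesgue_on {0<..<T}) (\<lambda>t. N (f t))}"

definition Linfty_time ::
    "real \<Rightarrow> ('x \<Rightarrow> real) set \<Rightarrow> (('x \<Rightarrow> real) \<Rightarrow> real) \<Rightarrow> (real \<Rightarrow> 'x \<Rightarrow> real) set" where
  "Linfty_time T X N =
     {f. strongly_measurable T X N f \<and> (\<exists>C. AE t in lebesgue_on {0<..<T}. N (f t) \<le> C)}"

definition test_function :: "real \<Rightarrow> (real \<Rightarrow> real) \<Rightarrow> bool" where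
  "test_function T \<phi> \<longleftrightarrow>
     (\<forall>k t. (deriv ^^ k) \<phi> field_differentiable at t) \<and>
     compact (closure {t. \<phi> t \<noteq> 0}) \<and> closure {t. \<phi> t \<noteq> 0} \<subseteq> {0<..<T}"

definition has_weak_time_derivative ::
    "real \<Rightarrow> ('x \<Rightarrow> real) set \<Rightarrow> (('x \<Rightarrow> real) \<Rightarrow> real) \<Rightarrow> (real \<Rightarrow> 'x \<Rightarrow> real) \<Rightarrow>
       (real \<Rightarrow> 'x \<Rightarrow> real) \<Rightarrow> bool" where
  "has_weak_time_derivative T X N u u' \<longleftrightarrow>
     (\<forall>\<phi>. test_function T \<phi> \<longrightarrow>
        (\<exists>I. has_X_integral T X N (\<lambda>t x. deriv \<phi> t * u t x) I \<and>
             has_X_integral T X N (\<lambda>t x. \<phi> t * u' t x) (\<lambda>x. - I x)))"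

text \<open>\<open>u\<close> lies in \<open>W\<^sup>1\<^sup>,\<^sup>\<infinity>(0, T; X)\<close> and its weak derivative is \<open>u'\<close>.\<close>

definition W1infty_time ::
    "real \<Rightarrow> ('x \<Rightarrow> real) set \<Rightarrow> (('x \<Rightarrow> real) \<Rightarrow> real) \<Rightarrow> (real \<Rightarrow> 'x \<Rightarrow> real) \<Rightarrow>
       (real \<Rightarrow> 'x \<Rightarrow> real) \<Rightarrow> bool" where
  "W1infty_time T X N u u' \<longleftrightarrow>
     u \<in> Linfty_time T X N \<and> u' \<in> Linfty_time T X N \<and> has_weak_time_derivative T X N u u'"


section \<open>Lipschitz boundary\<close>

text \<open>
  Near each boundary point, in coordinates given by a unit vector \<open>e\<close> and its orthogonal complement,
  the set is the region strictly above the graph of a Lipschitz function.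
\<close>

definition lipschitz_boundary :: "(real ^ 'd) set \<Rightarrow> bool" where
  "lipschitz_boundary \<Omega> \<longleftrightarrow>
     (\<forall>z\<in>frontier \<Omega>. \<exists>r>0. \<exists>e \<gamma> L. norm e = 1 \<and> L-lipschitz_on {y. y \<bullet> e = 0} \<gamma> \<and>
        \<Omega> \<inter> ball z r = {y \<in> ball z r. \<gamma> (y - (y \<bullet> e) *\<^sub>R e) < y \<bullet> e})"

end

theory Submission
  imports Defs "HOL-Probability.Probability"
begin

text \<open>
  Write \<open>L = (-\<Delta>)\<^sup>s\<^sup>/\<^sup>2\<close> on the domain \<open>V\<close> of functions in \<open>H\<^sup>s\<close> that vanish outside \<open>\<Omega>\<close>. The form \<open>[u, v]\<^sub>s\<close>
  is the inner product of \<open>L u\<close> and \<open>L v\<close>, so the equation reads \<open>u'' = - L\<^sup>* L u\<close>, with the adjoint taken from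
  \<open>V\<close>. Two facts about \<open>L\<close> are enough: it is a closed operator between \<open>L\<^sup>2\<close> spaces
  (\<open>closed_operator_half_laplacian\<close>), and \<open>V\<close> is dense in the functions of \<open>L\<^sup>2\<close> vanishing outside \<open>\<Omega>\<close>
  (\<open>Hs_classes_dense\<close>), so that every \<open>v\<^sub>0\<close> is admissible as initial velocity.

  For a closed operator the equation is solved abstractly (\<open>wave_solution\<close>). With \<open>w = L u\<close> and \<open>v = u'\<close> it
  becomes the skew-symmetric first order system \<open>w' = L v\<close>, \<open>v' = - L\<^sup>* w\<close>. One implicit Euler step for it amounts
  to an orthogonal projection onto the graph of a multiple of \<open>L\<close>, and by skew-symmetry it is a contraction
  for the energy \<open>\<parallel>w\<parallel>\<^sup>2 + \<parallel>v\<parallel>\<^sup>2\<close>. Comparing one step of length \<open>2 k\<close> with two steps of length \<open>k\<close> shows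
  that the Euler approximations with dyadic steps converge uniformly in time (\<open>semigroup_limit\<close>). Their limit is
  continuous, \<open>u\<close> is recovered as \<open>u\<^sub>0 + \<integral> v\<close>, and \<open>w = L u\<close> follows from closedness. The solution obtained is
  continuous in time with values in the energy space, which is stronger than the boundedness and the initial
  conditions in the mean that are claimed.

  Closedness and density concern the Fourier transform on \<open>L\<^sup>2\<close>. Plancherel's theorem (\<open>plancherel_L1L2\<close>) is
  proved by Gaussian regularisation for continuous functions with compact support and extended by
  approximation. A multiplication operator is closed, and the fractional Laplacian maps real functions to
  real functions because the weight \<open>|\<xi>|\<^sup>s\<close> preserves the Hermitian symmetry that characterises the transforms
  of real functions. Density is shown by truncating to a compact subset of \<open>\<Omega>\<close> and averaging over small cubes
  several times; every averaging gains a factor \<open>1 / |\<xi>|\<close> on the Fourier side.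

  It remains to express the continuous solution in terms of Bochner spaces whose elements are functions or
  functionals. Each of these spaces is related to a Hilbert space (\<open>vector_representation\<close>): functions to their
  \<open>L\<^sup>2\<close> classes, elements of the energy space to pairs \<open>(u, L u)\<close>, and functionals to pairs acting on such pairs
  by the inner product. Under this relation Bochner integrals of continuous curves are ordinary integrals, and
  weak derivatives are computed by the fundamental theorem of calculus.
\<close>

section \<open>Orthogonal projection\<close>

lemma norm_diff_scaled_square:
  fixes a b :: "'a::real_inner"
  shows "(norm (a - t *\<^sub>R b))\<^sup>2 = (norm a)\<^sup>2 - 2 * t * (a \<bullet> b) + t\<^sup>2 * (norm b)\<^sup>2"
  unfolding power2_norm_eq_inner
  by (simp add: algebra_simps inner_commute power2_eq_square[of t])

lemma norm_diff_add_le: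
  fixes a b c :: "'a::real_normed_vector"
  shows "norm (a - b + c) \<le> norm a + norm b + norm c"
  using norm_triangle_ineq[of "a - b" c] norm_triangle_ineq4[of a b] by linarith

text \<open>A minimising sequence for the distance is Cauchy by the parallelogram law; at the minimiser the
  derivative of the squared distance vanishes in every direction of \<open>S\<close>.\<close>

lemma orthogonal_projection_exists:
  fixes S :: "'a::{real_inner, complete_space} set"
  assumes S: "subspace S" "closed S"
  shows "\<exists>p\<in>S. \<forall>s\<in>S. (x - p) \<bullet> s = 0"
proof -
  define d where "d = Inf ((\<lambda>s. (norm (x - s))\<^sup>2) ` S)"
  have S0: "0 \<in> S" using S(1) by (rule subspace_0)
  have bdd: "bdd_below ((\<lambda>s. (norm (x - s))\<^sup>2) ` S)"
    by (rule bdd_belowI[of _ 0]) auto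
  have d_le: "d \<le> (norm (x - s))\<^sup>2" if "s \<in> S" for s
    unfolding d_def using that bdd by (intro cInf_lower) auto
  have "\<exists>p\<in>S. (norm (x - p))\<^sup>2 < d + inverse (real (Suc n))" for n
  proof -
    have "\<exists>y\<in>(\<lambda>s. (norm (x - s))\<^sup>2) ` S. y < d + inverse (real (Suc n))"
      using S0 bdd unfolding d_def by (subst cInf_less_iff[symmetric]) auto
    then show ?thesis by auto
  qed
  then obtain p where pS: "\<And>n. p n \<in> S"
    and p_lt: "\<And>n. (norm (x - p n))\<^sup>2 < d + inverse (real (Suc n))"
    by metis
  have mid: "(norm (p m - p n))\<^sup>2 \<le> 2 * inverse (real (Suc m)) + 2 * inverse (real (Suc n))" for m n
  proof -
    have "(1/2) *\<^sub>R (p m + p n) \<in> S"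
      using S(1) pS by (intro subspace_mul subspace_add) auto
    then have "d \<le> (norm (x - (1/2) *\<^sub>R (p m + p n)))\<^sup>2" by (rule d_le)
    moreover have "(norm (p m - p n))\<^sup>2 = 2 * (norm (x - p m))\<^sup>2 + 2 * (norm (x - p n))\<^sup>2
        - 4 * (norm (x - (1/2) *\<^sub>R (p m + p n)))\<^sup>2"
      by (simp add: power2_norm_eq_inner algebra_simps inner_commute)
    ultimately show ?thesis using p_lt[of m] p_lt[of n] by linarith
  qed
  have "Cauchy p"
  proof (rule metric_CauchyI)
    fix e :: real assume e: "e > 0"
    obtain N where N: "inverse (real (Suc N)) < e\<^sup>2 / 4"
      using reals_Archimedean[of "e\<^sup>2 / 4"] e by auto
    show "\<exists>M. \<forall>m\<ge>M. \<forall>n\<ge>M. dist (p m) (p n) < e"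
    proof (intro exI allI impI)
      fix m n assume "N \<le> m" "N \<le> n"
      then have "inverse (real (Suc m)) \<le> inverse (real (Suc N))"
        "inverse (real (Suc n)) \<le> inverse (real (Suc N))"
        by (auto intro!: le_imp_inverse_le)
      then have "(norm (p m - p n))\<^sup>2 < e\<^sup>2" using mid[of m n] N by linarith
      then show "dist (p m) (p n) < e"
        using e by (simp add: dist_norm power_less_imp_less_base)
    qed
  qed
  then obtain q where q: "p \<longlonglongrightarrow> q" using Cauchy_convergent convergent_def by blast
  have qS: "q \<in> S" using S(2) pS q closed_sequentially by blast
  have "(\<lambda>n. (norm (x - p n))\<^sup>2) \<longlonglongrightarrow> (norm (x - q))\<^sup>2"
    by (intro tendsto_intros q)
  moreover have "(\<lambda>n. d + inverse (real (Suc n))) \<longlonglongrightarrow> d + 0"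
    by (intro tendsto_intros LIMSEQ_inverse_real_of_nat)
  ultimately have q_le: "(norm (x - q))\<^sup>2 \<le> d"
    using less_imp_le[OF p_lt] by (intro LIMSEQ_le[of _ _ "\<lambda>n. d + inverse (real (Suc n))"]) auto
  have "(x - q) \<bullet> s = 0" if s: "s \<in> S" for s
  proof (cases "s = 0")
    case False
    (* The minimiser of the squared distance along the line q + t s. *)
  define t where "t = ((x - q) \<bullet> s) / (norm s)\<^sup>2"
    have "q + t *\<^sub>R s \<in> S" using S(1) qS s by (intro subspace_mul subspace_add) auto
    then have "(norm (x - q))\<^sup>2 \<le> (norm ((x - q) - t *\<^sub>R s))\<^sup>2"
      unfolding diff_diff_eq by (rule order_trans[OF q_le d_le])
    also have "\<dots> = (norm (x - q))\<^sup>2 - ((x - q) \<bullet> s)\<^sup>2 / (norm s)\<^sup>2"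
      unfolding norm_diff_scaled_square t_def using False
      by (simp add: field_simps power2_eq_square)
    finally have "((x - q) \<bullet> s)\<^sup>2 / (norm s)\<^sup>2 \<le> 0" by simp
    then show ?thesis using False by (simp add: field_simps)
  qed simp
  then show ?thesis using qS by blast
qed


section \<open>Riemann sums\<close>

text \<open>The values \<open>c j\<close> are only required to be close to \<open>f\<close> on the \<open>j\<close>-th cell, so they may be taken from an
  approximation of \<open>f\<close>, such as the iterates of a time-stepping scheme.\<close>

lemma riemann_sum_error:
  fixes f :: "real \<Rightarrow> 'e::banach"
  assumes cont: "continuous_on {0..real n * h} f" and h: "h \<ge> 0"
    and close: "\<And>j t. j < n \<Longrightarrow> real j * h \<le> t \<Longrightarrow> t \<le> real (Suc j) * h \<Longrightarrow> norm (f t - c j) \<le> e"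
  shows "norm (integral {0..real n * h} f - (\<Sum>j<n. h *\<^sub>R c j)) \<le> real n * h * e"
  using cont close
proof (induction n)
  case (Suc n)
  have le: "real n * h \<le> real (Suc n) * h" using h by (simp add: mult_right_mono)
  have nn: "0 \<le> real n * h" using h by simp
  have int: "f integrable_on {0..real (Suc n) * h}"
    using Suc.prems(1) by (rule integrable_continuous_real)
  have cn: "continuous_on {0..real n * h} f"
    using Suc.prems(1) le by (rule_tac continuous_on_subset) auto
  have cl: "continuous_on {real n * h..real (Suc n) * h} f"
    using Suc.prems(1) nn by (rule_tac continuous_on_subset) auto
  have split: "integral {0..real (Suc n) * h} f
      = integral {0..real n * h} f + integral {real n * h..real (Suc n) * h} f"
    using Henstock_Kurzweil_Integration.integral_combine[OF nn le int] by simp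
  have const: "((\<lambda>t. c n) has_integral h *\<^sub>R c n) {real n * h..real (Suc n) * h}"
    using has_integral_const_real[of "c n" "real n * h" "real (Suc n) * h"] h
    by (simp add: algebra_simps)
  have last: "norm (integral {real n * h..real (Suc n) * h} f - h *\<^sub>R c n) \<le> h * e"
  proof -
    have "((\<lambda>t. f t - c n) has_integral (integral {real n * h..real (Suc n) * h} f - h *\<^sub>R c n))
        {real n * h..real (Suc n) * h}"
      using const cl by (intro has_integral_diff integrable_integral integrable_continuous_real)
    moreover have "0 \<le> e" if "h > 0"
      using Suc.prems(2)[of n "real n * h"] le norm_ge_zero order_trans by blast
    ultimately have "norm (integral {real n * h..real (Suc n) * h} f - h *\<^sub>R c n)
        \<le> e * measure lborel {real n * h..real (Suc n) * h}" if "h > 0"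
      using that Suc.prems(2)[of n] le
      by (intro has_integral_bound_real[where S="{}"]) auto
    then show ?thesis using h le const
      by (cases "h = 0") (auto simp: algebra_simps)
  qed
  have "integral {0..real (Suc n) * h} f - (\<Sum>j<Suc n. h *\<^sub>R c j)
      = (integral {0..real n * h} f - (\<Sum>j<n. h *\<^sub>R c j))
        + (integral {real n * h..real (Suc n) * h} f - h *\<^sub>R c n)"
    unfolding split by simp
  also have "norm \<dots> \<le> real n * h * e + h * e"
    using Suc.IH[OF cn] Suc.prems(2) last by (intro norm_triangle_mono) auto
  finally show ?case by (simp add: algebra_simps)
qed simp


section \<open>Contraction pseudo-resolvents generate semigroups\<close>

text \<open>The model is \<open>J h = (1 - h B)\<^sup>-\<^sup>1\<close> for an unbounded operator \<open>B\<close>, but only the bounded operators \<open>J h\<close>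
  occur. The third axiom is the resolvent equation for \<open>(1 / h - B)\<^sup>-\<^sup>1 = h J h\<close>. The aim is the limit of
  \<open>(J h)\<^sup>n x\<close> for \<open>n h \<rightarrow> t\<close>, that is, the solution of \<open>z' = B z\<close> with \<open>z 0 = x\<close>.\<close>

locale contraction_pseudoresolvent =
  fixes J :: "real \<Rightarrow> 'e::banach \<Rightarrow> 'e"
  assumes linear_J: "h > 0 \<Longrightarrow> linear (J h)"
    and contraction: "h > 0 \<Longrightarrow> norm (J h x) \<le> norm x"
    and resolvent_identity:
      "h > 0 \<Longrightarrow> k > 0 \<Longrightarrow> h *\<^sub>R J h x = k *\<^sub>R J k x + (h - k) *\<^sub>R J k (J h x)"
begin

lemma linear_J_power: "h > 0 \<Longrightarrow> linear (J h ^^ n)"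
proof (induction n)
  case 0
  then show ?case by (simp add: linear_id[unfolded id_def] id_def)
next
  case (Suc n)
  then show ?case using linear_compose[OF Suc.IH linear_J] by (simp add: o_def)
qed

lemma J_power_contraction: "h > 0 \<Longrightarrow> norm ((J h ^^ n) x) \<le> norm x"
  by (induction n) (auto intro: order_trans[OF contraction])

lemma J_commute:
  assumes "h > 0" "k > 0"
  shows "J h (J k x) = J k (J h x)"
proof (cases "h = k")
  case False
  have "(h - k) *\<^sub>R (J k (J h x) - J h (J k x)) = 0"
    using resolvent_identity[OF assms, of x] resolvent_identity[OF assms(2,1), of x]
    by (simp add: algebra_simps)
  then show ?thesis using False by simp
qed simp

lemma J_power_commute:
  assumes "h > 0" "k > 0"
  shows "(J h ^^ n) (J k x) = J k ((J h ^^ n) x)"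
  by (induction n) (auto simp: J_commute[OF assms])

text \<open>Writing \<open>J\<^sub>h = (1 - h B)\<^sup>-\<^sup>1\<close> informally, both sides are \<open>h B J\<^sub>h J\<^sub>g\<close>.\<close>

lemma J_minus_id_on_range:
  assumes "h > 0" "g > 0"
  shows "J h (J g y) - J g y = (h / g) *\<^sub>R J h (J g y - y)"
proof -
  have lh: "J h (J g y - y) = J h (J g y) - J h y"
    using linear_J[OF assms(1)] by (simp add: linear_diff)
  have "g *\<^sub>R (J h (J g y) - J g y) = h *\<^sub>R (J h (J g y) - J h y)"
    using resolvent_identity[OF assms, of y] J_commute[OF assms, of y]
    by (simp add: algebra_simps)
  then have "J h (J g y) - J g y = (1 / g) *\<^sub>R h *\<^sub>R (J h (J g y) - J h y)"
    using assms by (metis divide_inverse less_numeral_extra(3) mult_1 real_vector_eq_affinity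
        scaleR_one scaleR_scaleR left_inverse)
  then show ?thesis by (simp add: lh)
qed

lemma J_minus_id_bound:
  assumes "h > 0" "g > 0"
  shows "norm (J h (J g y) - J g y) \<le> 2 * h / g * norm y"
proof -
  have "norm (J h (J g y - y)) \<le> norm (J g y - y)" by (rule contraction[OF assms(1)])
  also have "\<dots> \<le> 2 * norm y"
    using norm_triangle_ineq4[of "J g y" y] contraction[OF assms(2), of y] by simp
  finally have "(h / g) * norm (J h (J g y - y)) \<le> (h / g) * (2 * norm y)"
    using assms by (intro mult_left_mono) auto
  then show ?thesis
    unfolding J_minus_id_on_range[OF assms] using assms by (simp add: mult_ac)
qed

text \<open>One step of length \<open>2 k\<close> differs from two steps of length \<open>k\<close> by \<open>(k B)\<^sup>2 J\<^sub>2\<^sub>k J\<^sub>k\<^sup>2\<close>.\<close>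

lemma step_doubling_defect:
  assumes "k > 0"
  shows "J (2 * k) x - J k (J k x) =
    J k (J k (J (2 * k) x) - J (2 * k) x) - (J k (J (2 * k) x) - J (2 * k) x)"
proof -
  have "2 * k > 0" using assms by simp
  have "(2 * k) *\<^sub>R J (2 * k) x = k *\<^sub>R (J k x + J k (J (2 * k) x))"
    using resolvent_identity[of "2 * k" k x] assms by (simp add: scaleR_right_distrib)
  then have "k *\<^sub>R (2 *\<^sub>R J (2 * k) x) = k *\<^sub>R (J k x + J k (J (2 * k) x))"
    by (simp add: mult.commute)
  then have "2 *\<^sub>R J (2 * k) x = J k x + J k (J (2 * k) x)"
    using assms by (metis less_irrefl scaleR_left_imp_eq)
  then have e: "J k (J (2 * k) x) = 2 *\<^sub>R J (2 * k) x - J k x"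
    by (simp add: algebra_simps)
  have "J k (J k (J (2 * k) x)) = 2 *\<^sub>R J k (J (2 * k) x) - J k (J k x)"
  proof -
    have "J k (J k (J (2 * k) x)) = J k (2 *\<^sub>R J (2 * k) x - J k x)" by (simp only: e)
    then show ?thesis using linear_J[OF assms] by (simp add: linear_diff linear_scale)
  qed
  then show ?thesis using linear_J[OF assms] e by (simp add: linear_diff scaleR_2)
qed

text \<open>On vectors \<open>J g (J g y)\<close> each of the two factors \<open>k B\<close> of the defect combines with one \<open>J g\<close> to a bounded
  operator of size \<open>O (k / g)\<close>, so the defect is of second order in \<open>k\<close>.\<close>

lemma step_doubling_bound:
  assumes "k > 0" "g > 0"
  shows "norm (J (2 * k) (J g (J g y)) - J k (J k (J g (J g y)))) \<le> 4 * (k / g)\<^sup>2 * norm y"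
proof -
  define z where "z = J (2 * k) y"
  have k2: "2 * k > 0" using assms by simp
  have z: "norm z \<le> norm y" unfolding z_def by (rule contraction[OF k2])
  have comm: "J (2 * k) (J g (J g y)) = J g (J g z)"
    by (simp add: z_def J_commute[OF k2 assms(2)])
  have lin: "J k (r *\<^sub>R a) = r *\<^sub>R J k a" "J k (a - b) = J k a - J k b"
    "J g (r *\<^sub>R a) = r *\<^sub>R J g a" "J g (a - b) = J g a - J g b" for r a b
    using linear_J[OF assms(1)] linear_J[OF assms(2)] by (simp_all add: linear_diff linear_scale)
  define w where "w = J g z - z"
  have 1: "J k (J g (J g z)) - J g (J g z) = (k / g) *\<^sub>R J k (J g w)"
    unfolding J_minus_id_on_range[OF assms, of "J g z"] w_def by (simp add: lin)
  have "J (2 * k) (J g (J g y)) - J k (J k (J g (J g y)))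
      = J k ((k / g) *\<^sub>R J k (J g w)) - (k / g) *\<^sub>R J k (J g w)"
    by (subst step_doubling_defect[OF assms(1)]) (simp only: comm 1)
  also have "\<dots> = (k / g) *\<^sub>R J k (J k (J g w) - J g w)"
    by (simp add: lin scaleR_diff_right)
  also have "\<dots> = (k / g)\<^sup>2 *\<^sub>R J k (J k (J g w - w))"
    unfolding J_minus_id_on_range[OF assms, of w] by (simp add: lin power2_eq_square)
  finally have eq: "J (2 * k) (J g (J g y)) - J k (J k (J g (J g y)))
      = (k / g)\<^sup>2 *\<^sub>R J k (J k (J g w - w))" .
  have "norm (J k (J k (J g w - w))) \<le> norm (J g w - w)"
    using contraction[OF assms(1)] order_trans by blast
  also have "\<dots> \<le> 2 * norm w"
    using norm_triangle_ineq4[of "J g w" w] contraction[OF assms(2), of w] by simp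
  also have "norm w \<le> 2 * norm z"
    unfolding w_def using norm_triangle_ineq4[of "J g z" z] contraction[OF assms(2), of z] by simp
  finally have "norm (J k (J k (J g w - w))) \<le> 4 * norm y" using z by simp
  then have "(k / g)\<^sup>2 * norm (J k (J k (J g w - w))) \<le> (k / g)\<^sup>2 * (4 * norm y)"
    by (intro mult_left_mono) auto
  then show ?thesis unfolding eq by (simp add: mult_ac)
qed

text \<open>The defects of the single steps add up: the powers are contractions, and they commute with \<open>J g\<close>, so
  that every intermediate vector is again of the form \<open>J g (J g y)\<close>.\<close>

lemma power_doubling_bound:
  assumes "k > 0" "g > 0"
  shows "norm ((J (2 * k) ^^ n) (J g (J g y)) - (J k ^^ (2 * n)) (J g (J g y)))
    \<le> real n * (4 * (k / g)\<^sup>2 * norm y)"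
proof (induction n)
  case (Suc n)
  define x where "x = J g (J g y)"
  have k2: "2 * k > 0" using assms by simp
  define a where "a = (J (2 * k) ^^ n) x"
  define b where "b = (J k ^^ (2 * n)) x"
  have b: "b = J g (J g ((J k ^^ (2 * n)) y))"
    unfolding b_def x_def by (simp add: J_power_commute[OF assms])
  have "(J (2 * k) ^^ Suc n) x - (J k ^^ (2 * Suc n)) x
      = J (2 * k) (a - b) + (J (2 * k) b - J k (J k b))"
    using linear_J[OF k2] by (simp add: a_def b_def linear_diff)
  also have "norm \<dots> \<le> norm (J (2 * k) (a - b)) + norm (J (2 * k) b - J k (J k b))"
    by (rule norm_triangle_ineq)
  also have "norm (J (2 * k) (a - b)) \<le> norm (a - b)" by (rule contraction[OF k2])
  also have "norm (a - b) \<le> real n * (4 * (k / g)\<^sup>2 * norm y)"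
    using Suc.IH unfolding a_def b_def x_def .
  also have "norm (J (2 * k) b - J k (J k b)) \<le> 4 * (k / g)\<^sup>2 * norm ((J k ^^ (2 * n)) y)"
    unfolding b by (rule step_doubling_bound[OF assms])
  also have "\<dots> \<le> 4 * (k / g)\<^sup>2 * norm y"
    by (intro mult_left_mono J_power_contraction assms) auto
  finally show ?case by (simp add: x_def algebra_simps)
qed simp

lemma power_lipschitz:
  assumes "h > 0"
  shows "norm ((J h ^^ (n + m)) x - (J h ^^ n) x) \<le> real m * norm (J h x - x)"
proof (induction m)
  case (Suc m)
  have "(J h ^^ (n + Suc m)) x - (J h ^^ n) x
      = (J h ^^ (n + m)) (J h x - x) + ((J h ^^ (n + m)) x - (J h ^^ n) x)"
    using linear_J_power[OF assms] by (simp add: linear_diff funpow_Suc_right del: funpow.simps)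
  also have "norm \<dots> \<le> norm (J h x - x) + real m * norm (J h x - x)"
    using Suc.IH J_power_contraction[OF assms] by (intro norm_triangle_mono) auto
  finally show ?case by (simp add: algebra_simps)
qed simp

text \<open>Implicit Euler steps of dyadic length, with the time rounded down to the grid: passing from \<open>m\<close> to
  \<open>m + 1\<close> halves the step, which is the comparison made above.\<close>

definition euler :: "nat \<Rightarrow> real \<Rightarrow> 'e \<Rightarrow> 'e" where
  "euler m t = J (1 / 2 ^ m) ^^ nat \<lfloor>t * 2 ^ m\<rfloor>"

lemma euler_contraction: "norm (euler m t x) \<le> norm x"
  unfolding euler_def by (rule J_power_contraction) simp

lemma euler_diff: "euler m t (x - y) = euler m t x - euler m t y"
  unfolding euler_def by (rule linear_diff[OF linear_J_power]) simp

text \<open>Doubling at most \<open>t 2\<^sup>m\<close> steps costs \<open>O (4\<^sup>-\<^sup>m)\<close> each. Rounding the time on the finer grid may add one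
  more step, which costs \<open>O (2\<^sup>-\<^sup>m)\<close>.\<close>

lemma euler_refine:
  assumes "t \<ge> 0" "g > 0"
  shows "norm (euler m t (J g (J g y)) - euler (Suc m) t (J g (J g y)))
    \<le> (t / g\<^sup>2 + 1 / g) * norm y * (1 / 2) ^ m"
proof -
  define x where "x = J g (J g y)"
  define k where "k = (1::real) / 2 ^ Suc m"
  have k: "k > 0" "2 * k = 1 / 2 ^ m" by (simp_all add: k_def)
  define n where "n = nat \<lfloor>t * 2 ^ m\<rfloor>"
  define n' where "n' = nat \<lfloor>t * 2 ^ Suc m\<rfloor>"
  have nn: "0 \<le> t * 2 ^ m" using assms by simp
  then have n_le: "real n \<le> t * 2 ^ m" unfolding n_def by (metis of_nat_floor)
  have "n' = 2 * n \<or> n' = 2 * n + 1"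
    unfolding n_def n'_def power_Suc using nn by linarith
  then obtain i where i: "n' = 2 * n + i" "i \<le> 1" by (cases "n' = 2 * n") auto
  have e: "euler m t x = (J (2 * k) ^^ n) x" "euler (Suc m) t x = (J k ^^ n') x"
    by (simp_all add: euler_def n_def n'_def k(2)) (simp add: k_def)
  have 1: "norm ((J (2 * k) ^^ n) x - (J k ^^ (2 * n)) x) \<le> real n * (4 * (k / g)\<^sup>2 * norm y)"
    unfolding x_def by (rule power_doubling_bound[OF k(1) assms(2)])
  also have "\<dots> \<le> t * 2 ^ m * (4 * (k / g)\<^sup>2 * norm y)"
    by (intro mult_right_mono n_le) auto
  also have "\<dots> = t / g\<^sup>2 * norm y * (1 / 2) ^ m"
    by (simp add: k_def power2_eq_square field_simps)
  finally have A: "norm ((J (2 * k) ^^ n) x - (J k ^^ (2 * n)) x) \<le> t / g\<^sup>2 * norm y * (1 / 2) ^ m" .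
  have "norm ((J k ^^ n') x - (J k ^^ (2 * n)) x) \<le> real i * norm (J k x - x)"
    unfolding i(1) by (rule power_lipschitz[OF k(1)])
  also have "\<dots> \<le> 1 * (2 * k / g * norm (J g y))"
    unfolding x_def using i(2) J_minus_id_bound[OF k(1) assms(2)] by (intro mult_mono) auto
  also have "\<dots> \<le> 1 * (2 * k / g * norm y)"
    using k(1) assms(2) contraction[OF assms(2)] by (intro mult_left_mono) auto
  also have "\<dots> = 1 / g * norm y * (1 / 2) ^ m"
    by (simp add: k_def field_simps)
  finally have B: "norm ((J k ^^ n') x - (J k ^^ (2 * n)) x) \<le> 1 / g * norm y * (1 / 2) ^ m" .
  have "euler m t x - euler (Suc m) t x
      = ((J (2 * k) ^^ n) x - (J k ^^ (2 * n)) x) - ((J k ^^ n') x - (J k ^^ (2 * n)) x)"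
    unfolding e by simp
  also have "norm \<dots> \<le> norm ((J (2 * k) ^^ n) x - (J k ^^ (2 * n)) x)
      + norm ((J k ^^ n') x - (J k ^^ (2 * n)) x)"
    by (rule norm_triangle_ineq4)
  also have "\<dots> \<le> t / g\<^sup>2 * norm y * (1 / 2) ^ m + 1 / g * norm y * (1 / 2) ^ m"
    by (rule add_mono[OF A B])
  finally show ?thesis unfolding x_def by (simp add: algebra_simps)
qed

lemma euler_uniformly_Cauchy_smooth:
  assumes "g > 0" "e > 0"
  shows "\<exists>M. \<forall>t\<in>{0..T}. \<forall>m\<ge>M. \<forall>n\<ge>M.
    norm (euler m t (J g (J g y)) - euler n t (J g (J g y))) < e"
proof -
  define x where "x = J g (J g y)"
  define C where "C = (\<bar>T\<bar> / g\<^sup>2 + 1 / g) * norm y"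
  have C0: "C \<ge> 0" using assms(1) by (simp add: C_def)
  have step: "norm (euler m t x - euler (Suc m) t x) \<le> C * (1 / 2) ^ m" if "t \<in> {0..T}" for m t
  proof -
    have "(t / g\<^sup>2 + 1 / g) * norm y * (1 / 2) ^ m \<le> C * (1 / 2) ^ m"
      unfolding C_def using that assms(1) by (intro mult_right_mono add_mono divide_right_mono) auto
    moreover have "0 \<le> t" using that by simp
    ultimately show ?thesis
      unfolding x_def using euler_refine[OF _ assms(1), of t m y] by (meson order_trans)
  qed
  have tele: "norm (euler m t x - euler (m + j) t x) \<le> C * (2 * (1 / 2) ^ m - 2 * (1 / 2) ^ (m + j))"
    if "t \<in> {0..T}" for m j t
  proof (induction j)
    case (Suc j)
    have "norm (euler m t x - euler (m + Suc j) t x)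
        \<le> norm (euler m t x - euler (m + j) t x) + norm (euler (m + j) t x - euler (Suc (m + j)) t x)"
      using norm_triangle_ineq[of "euler m t x - euler (m + j) t x"
          "euler (m + j) t x - euler (Suc (m + j)) t x"] by simp
    also have "\<dots> \<le> C * (2 * (1 / 2) ^ m - 2 * (1 / 2) ^ (m + j)) + C * (1 / 2) ^ (m + j)"
      using Suc.IH step[OF that, of "m + j"] by simp
    finally show ?case by (simp add: algebra_simps)
  qed simp
  obtain M where M: "(1 / 2 :: real) ^ M < e / (2 * (2 * C + 1))"
    using real_arch_pow_inv[of "e / (2 * (2 * C + 1))" "1 / 2"] assms(2) C0 by auto
  have half: "norm (euler M t x - euler n t x) < e / 2" if t: "t \<in> {0..T}" and n: "n \<ge> M" for t n
  proof -
    obtain j where j: "n = M + j" using n le_Suc_ex by blast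
    have "C * (2 * (1 / 2) ^ M - 2 * (1 / 2) ^ (M + j)) \<le> C * (2 * (1 / 2) ^ M)"
      using C0 by (intro mult_left_mono) auto
    then have "norm (euler M t x - euler n t x) \<le> 2 * C * (1 / 2) ^ M"
      using tele[OF t, of M j] unfolding j by (simp add: algebra_simps)
    also have "\<dots> \<le> (2 * C + 1) * (1 / 2) ^ M" using C0 by (intro mult_right_mono) auto
    also have "\<dots> < (2 * C + 1) * (e / (2 * (2 * C + 1)))"
      using M C0 by (intro mult_strict_left_mono) auto
    also have "\<dots> = e / 2" using C0 by (simp add: field_simps)
    finally show ?thesis .
  qed
  show ?thesis
  proof (intro exI ballI allI impI)
    fix t m n assume "t \<in> {0..T}" "M \<le> m" "M \<le> n"
    then have "norm (euler M t x - euler m t x) < e / 2" "norm (euler M t x - euler n t x) < e / 2"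
      using half by auto
    then show "norm (euler m t (J g (J g y)) - euler n t (J g (J g y))) < e"
      unfolding x_def[symmetric] using dist_triangle_half_r[of "euler M t x" "euler m t x" e "euler n t x"]
      by (simp add: dist_norm norm_minus_commute)
  qed
qed

text \<open>If \<open>J g x\<close> is close to \<open>x\<close>, then so is \<open>J g (J g x)\<close>, for which the approximations converge uniformly;
  contractivity carries this over to \<open>x\<close>. The limit is continuous because on \<open>J g x\<close> the approximation
  with step \<open>2\<^sup>-\<^sup>m\<close> is Lipschitz in time up to an error \<open>O (2\<^sup>-\<^sup>m)\<close> due to rounding.\<close>

lemma semigroup_limit:
  assumes approx: "\<And>e. e > 0 \<Longrightarrow> \<exists>g>0. norm (J g x - x) < e"
  obtains z where "uniform_limit {0..T} (\<lambda>m t. euler m t x) z sequentially"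
    and "continuous_on {0..T} z"
proof -
  have "uniformly_Cauchy_on {0..T} (\<lambda>m t. euler m t x)"
  proof (rule uniformly_Cauchy_onI)
    fix e :: real assume e: "e > 0"
    then obtain g where g: "g > 0" "norm (J g x - x) < e / 6" using approx[of "e / 6"] by auto
    (* Smooth vectors of this form are what the convergence estimate applies to. *)
    define x' where "x' = J g (J g x)"
    have "x' - x = J g (J g x - x) + (J g x - x)"
      using linear_J[OF g(1)] by (simp add: x'_def linear_diff)
    then have "norm (x' - x) \<le> norm (J g (J g x - x)) + norm (J g x - x)"
      by (simp only: norm_triangle_ineq)
    then have x': "norm (x' - x) < e / 3"
      using contraction[OF g(1), of "J g x - x"] g(2) by linarith
    have d: "norm (euler m t x' - euler m t x) < e / 3" for m t
      using euler_contraction[of m t "x' - x"] x' by (simp add: euler_diff)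
    obtain M where M: "\<And>t m n. t \<in> {0..T} \<Longrightarrow> m \<ge> M \<Longrightarrow> n \<ge> M \<Longrightarrow>
        norm (euler m t x' - euler n t x') < e / 3"
      using euler_uniformly_Cauchy_smooth[OF g(1), of "e / 3" T x] e unfolding x'_def
      by (metis divide_pos_pos zero_less_numeral)
    show "\<exists>M. \<forall>t\<in>{0..T}. \<forall>m\<ge>M. \<forall>n\<ge>M. dist (euler m t x) (euler n t x) < e"
    proof (intro exI ballI allI impI)
      fix t m n assume "t \<in> {0..T}" "M \<le> m" "M \<le> n"
      have "euler m t x - euler n t x = (euler m t x' - euler n t x')
          - (euler m t x' - euler m t x) + (euler n t x' - euler n t x)" by simp
      then have "norm (euler m t x - euler n t x) \<le> norm (euler m t x' - euler n t x')
          + norm (euler m t x' - euler m t x) + norm (euler n t x' - euler n t x)"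
        by (simp only: norm_diff_add_le)
      then show "dist (euler m t x) (euler n t x) < e"
        using M[OF \<open>t \<in> {0..T}\<close> \<open>M \<le> m\<close> \<open>M \<le> n\<close>] d[of m t] d[of n t]
        unfolding dist_norm by linarith
    qed
  qed
  then obtain z where z: "uniform_limit {0..T} (\<lambda>m t. euler m t x) z sequentially"
    using uniformly_convergent_eq_Cauchy[of "{0..T}" "\<lambda>m t. euler m t x"]
    by (auto simp: uniformly_convergent_on_def)
  have lim: "(\<lambda>m. euler m t x) \<longlonglongrightarrow> z t" if "t \<in> {0..T}" for t
    using tendsto_uniform_limitI[OF z that] .
  have "continuous_on {0..T} z"
  proof (rule continuous_on_iff[THEN iffD2], intro ballI allI impI)
    fix t e :: real assume t: "t \<in> {0..T}" and e: "e > 0"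
    then obtain g where g: "g > 0" "norm (J g x - x) < e / 4" using approx[of "e / 4"] by auto
    define x' where "x' = J g x"
    define C where "C = 2 / g * norm x"
    have C0: "C \<ge> 0" using g by (simp add: C_def)
    have lip: "norm (euler m a x' - euler m b x') \<le> (\<bar>a - b\<bar> + 1 / 2 ^ m) * C"
      if "0 \<le> a" "a \<le> b" for m a b
    proof -
      define n where "n = nat \<lfloor>a * 2 ^ m\<rfloor>"
      define n' where "n' = nat \<lfloor>b * 2 ^ m\<rfloor>"
      have ab: "0 \<le> a * 2 ^ m" "a * 2 ^ m \<le> b * 2 ^ m" using that by (auto intro: mult_right_mono)
      then obtain i where i: "n' = n + i"
        unfolding n_def n'_def using le_Suc_ex nat_mono floor_mono by metis
      have "real n' \<le> b * 2 ^ m" "a * 2 ^ m \<le> real n + 1"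
        unfolding n_def n'_def using ab by linarith+
      then have ib: "real i \<le> (b - a) * 2 ^ m + 1" using i by (simp add: algebra_simps)
      have h: "(1::real) / 2 ^ m > 0" by simp
      have "norm (euler m b x' - euler m a x') \<le> real i * norm (J (1 / 2 ^ m) x' - x')"
        unfolding euler_def n_def[symmetric] n'_def[symmetric] i by (rule power_lipschitz[OF h])
      also have "\<dots> \<le> ((b - a) * 2 ^ m + 1) * (2 * (1 / 2 ^ m) / g * norm x)"
        unfolding x'_def using ib J_minus_id_bound[OF h g(1), of x] that
        by (intro mult_mono) auto
      also have "\<dots> = ((b - a) + 1 / 2 ^ m) * C" by (simp add: C_def field_simps)
      finally show ?thesis using that C0 by (auto simp: norm_minus_commute abs_if)
    qed
    have lipx: "norm (euler m a x - euler m b x) \<le> e / 2 + (\<bar>a - b\<bar> + 1 / 2 ^ m) * C"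
      if "a \<in> {0..T}" "b \<in> {0..T}" for m a b
    proof -
      have d: "norm (euler m c x' - euler m c x) \<le> e / 4" for c
        using euler_contraction[of m c "x' - x"] g(2) by (simp add: euler_diff x'_def)
      have "norm (euler m a x' - euler m b x') \<le> (\<bar>a - b\<bar> + 1 / 2 ^ m) * C"
        using lip[of a b m] lip[of b a m] that by (cases "a \<le> b") (auto simp: norm_minus_commute abs_minus_commute)
      moreover have "euler m a x - euler m b x = (euler m a x' - euler m b x')
          - (euler m a x' - euler m a x) + (euler m b x' - euler m b x)" by simp
      then have "norm (euler m a x - euler m b x) \<le> norm (euler m a x' - euler m b x')
          + norm (euler m a x' - euler m a x) + norm (euler m b x' - euler m b x)"
        by (simp only: norm_diff_add_le)
      ultimately show ?thesis using d[of a] d[of b] by linarith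
    qed
    have zlip: "norm (z a - z b) \<le> e / 2 + (\<bar>a - b\<bar> + 0) * C" if "a \<in> {0..T}" "b \<in> {0..T}" for a b
    proof (rule LIMSEQ_le)
      show "(\<lambda>m. norm (euler m a x - euler m b x)) \<longlonglongrightarrow> norm (z a - z b)"
        using lim that by (intro tendsto_intros) auto
      show "(\<lambda>m. e / 2 + (\<bar>a - b\<bar> + 1 / 2 ^ m) * C) \<longlonglongrightarrow> e / 2 + (\<bar>a - b\<bar> + 0) * C"
        using LIMSEQ_power_zero[of "1 / 2 :: real"]
        by (intro tendsto_intros) (simp add: power_one_over)
    qed (use lipx[OF that] in auto)
    show "\<exists>d>0. \<forall>t'\<in>{0..T}. dist t' t < d \<longrightarrow> dist (z t') (z t) < e"
    proof (intro exI conjI ballI impI)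
      show "e / (2 * (C + 1)) > 0" using e C0 by simp
      fix t' assume t': "t' \<in> {0..T}" "dist t' t < e / (2 * (C + 1))"
      then have "\<bar>t' - t\<bar> * (C + 1) < e / 2"
        using C0 by (simp add: dist_real_def field_simps)
      moreover have "\<bar>t' - t\<bar> * C \<le> \<bar>t' - t\<bar> * (C + 1)" by (intro mult_left_mono) auto
      ultimately have "\<bar>t' - t\<bar> * C < e / 2" by linarith
      then show "dist (z t') (z t) < e" using zlip[OF t'(1) t] by (simp add: dist_norm)
    qed
  qed
  with z show ?thesis using that by blast
qed

text \<open>On the range of \<open>J g\<close> the operators \<open>J h\<close> tend to the identity as \<open>h \<rightarrow> 0\<close>, and by contractivity they
  do so on its closure.\<close>

lemma approximation_on_closure_range:
  assumes g: "g > 0" and x: "x \<in> closure (range (J g))" and e: "e > 0"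
  shows "\<exists>h>0. norm (J h x - x) < e"
proof -
  obtain y where y: "dist (J g y) x < e / 3"
    using x e closure_approachable[of x "range (J g)"] by (auto dest: spec[of _ "e / 3"])
  define h where "h = g * e / (6 * (norm y + 1))"
  have y1: "norm y + 1 > 0" by (simp add: add_nonneg_pos)
  have h: "h > 0" using g e y1 by (simp add: h_def)
  have "norm (J h (J g y) - J g y) \<le> 2 * h / g * norm y" by (rule J_minus_id_bound[OF h g])
  also have "\<dots> = e / 3 * (norm y / (norm y + 1))" using g y1
    by (simp add: h_def divide_simps)
  also have "\<dots> \<le> e / 3 * 1" using e by (intro mult_left_mono) (auto simp: add_nonneg_pos)
  finally have 1: "norm (J h (J g y) - J g y) \<le> e / 3" by simp
  have "J h x - x = J h (x - J g y) + (J h (J g y) - J g y) + (J g y - x)"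
    using linear_J[OF h] by (simp add: linear_diff)
  then have "norm (J h x - x) \<le> norm (J h (x - J g y)) + norm (J h (J g y) - J g y) + norm (J g y - x)"
    by (simp only: norm_triangle_le norm_triangle_ineq add_right_mono)
  moreover have "norm (J h (x - J g y)) < e / 3"
    using contraction[OF h, of "x - J g y"] y by (simp add: dist_norm norm_minus_commute)
  ultimately have "norm (J h x - x) < e" using 1 y by (simp add: dist_norm)
  then show ?thesis using h by blast
qed

end

section \<open>The abstract wave equation\<close>

lemma subspace_closure:
  fixes S :: "'a::real_normed_vector set"
  assumes "subspace S"
  shows "subspace (closure S)"
  unfolding subspace_def
proof (intro conjI ballI allI)
  show "0 \<in> closure S" using subspace_0[OF assms] closure_subset by blast
  fix x y :: 'a and c :: real assume x: "x \<in> closure S"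
  then obtain f where f: "\<And>n. f n \<in> S" "f \<longlonglongrightarrow> x" by (auto simp: closure_sequential)
  have "(\<lambda>n. c *\<^sub>R f n) \<longlonglongrightarrow> c *\<^sub>R x" by (intro tendsto_intros f)
  then show "c *\<^sub>R x \<in> closure S"
    using f(1) subspace_mul[OF assms]
    by (auto simp: closure_sequential intro!: exI[of _ "\<lambda>n. c *\<^sub>R f n"])
  assume "y \<in> closure S"
  then obtain g where g: "\<And>n. g n \<in> S" "g \<longlonglongrightarrow> y" by (auto simp: closure_sequential)
  have "(\<lambda>n. f n + g n) \<longlonglongrightarrow> x + y" by (intro tendsto_intros f g)
  then show "x + y \<in> closure S"
    using f(1) g(1) subspace_add[OF assms]
    by (auto simp: closure_sequential intro!: exI[of _ "\<lambda>n. f n + g n"])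
qed

text \<open>An unbounded closed operator \<open>L\<close> with domain \<open>V\<close>; as a total function, \<open>L\<close> is arbitrary outside \<open>V\<close>.\<close>

locale closed_operator =
  fixes V :: "'h::{real_inner, banach} set"
    and L :: "'h \<Rightarrow> 'w::{real_inner, banach}"
  assumes subspace_V: "subspace V"
    and L_add: "x \<in> V \<Longrightarrow> y \<in> V \<Longrightarrow> L (x + y) = L x + L y"
    and L_scale: "x \<in> V \<Longrightarrow> L (c *\<^sub>R x) = c *\<^sub>R L x"
    and closed_graph: "closed ((\<lambda>x. (x, L x)) ` V)"
begin

lemma V_simps [simp, intro]:
  "0 \<in> V" "x \<in> V \<Longrightarrow> y \<in> V \<Longrightarrow> x + y \<in> V" "x \<in> V \<Longrightarrow> y \<in> V \<Longrightarrow> x - y \<in> V"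
  "x \<in> V \<Longrightarrow> c *\<^sub>R x \<in> V"
  using subspace_V by (auto simp: subspace_def subspace_diff)

lemma L_diff: "x \<in> V \<Longrightarrow> y \<in> V \<Longrightarrow> L (x - y) = L x - L y"
  using L_add[of "x - y" y] by (simp add: algebra_simps)

lemma L_zero: "L 0 = 0"
  using L_scale[of 0 0] by simp

lemma graph_limit:
  assumes "\<And>n. x n \<in> V" "x \<longlonglongrightarrow> a" "(\<lambda>n. L (x n)) \<longlonglongrightarrow> b"
  shows "a \<in> V \<and> L a = b"
proof -
  have "(a, b) \<in> (\<lambda>x. (x, L x)) ` V"
    using closed_sequentially[OF closed_graph, of "\<lambda>n. (x n, L (x n))" "(a, b)"] assms
      tendsto_Pair[OF assms(2,3)] by blast
  then show ?thesis by auto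
qed

text \<open>With \<open>w = L u\<close> and \<open>v = u'\<close> the equation \<open>u'' = - L\<^sup>* L u\<close> becomes the skew-symmetric system
  \<open>w' = L v\<close>, \<open>v' = - L\<^sup>* w\<close>. This is its implicit Euler step, with the adjoint in weak form.\<close>

definition euler_step :: "real \<Rightarrow> 'w \<times> 'h \<Rightarrow> 'w \<times> 'h \<Rightarrow> bool" where
  "euler_step h x z \<longleftrightarrow> snd z \<in> V \<and> fst z = fst x + h *\<^sub>R L (snd z) \<and>
     (\<forall>\<phi>\<in>V. snd z \<bullet> \<phi> + h * (fst z \<bullet> L \<phi>) = snd x \<bullet> \<phi>)"

text \<open>Eliminating \<open>w\<close> from the step with data \<open>x = (p, q)\<close> leaves \<open>v \<bullet> \<phi> + h\<^sup>2 (L v \<bullet> L \<phi>) = q \<bullet> \<phi> - h (p \<bullet> L \<phi>)\<close>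
  for all \<open>\<phi> \<in> V\<close>. This says that \<open>(v, h L v)\<close> is the orthogonal projection of \<open>(q, - p)\<close> onto the graph of
  \<open>h L\<close>, which is closed. Negative \<open>h\<close> are allowed, as the density argument below uses \<open>h = - 1\<close>.\<close>

lemma euler_step_exists:
  assumes "h \<noteq> 0"
  shows "\<exists>z. euler_step h x z"
proof -
  define S where "S = (\<lambda>v. (v, h *\<^sub>R L v)) ` V"
  have S_eq: "S = (\<lambda>y. (fst y, (1 / h) *\<^sub>R snd y)) -` ((\<lambda>x. (x, L x)) ` V)"
  proof (intro set_eqI iffI)
    fix y assume "y \<in> (\<lambda>y. (fst y, (1 / h) *\<^sub>R snd y)) -` ((\<lambda>x. (x, L x)) ` V)"
    then have "fst y \<in> V" "(1 / h) *\<^sub>R snd y = L (fst y)" by auto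
    then have "y = (fst y, h *\<^sub>R L (fst y))" using assms by (metis prod.collapse
          divide_self nonzero_mult_div_cancel_left scaleR_one scaleR_scaleR times_divide_eq_right)
    then show "y \<in> S" unfolding S_def using \<open>fst y \<in> V\<close> by blast
  qed (use assms in \<open>auto simp: S_def\<close>)
  have "closed S"
    unfolding S_eq by (intro closed_vimage closed_graph continuous_intros)
  moreover have "subspace S"
    unfolding S_def subspace_def
    by (auto simp: zero_prod_def L_zero image_iff L_add L_scale scaleR_add_right)
  ultimately obtain p where p: "p \<in> S" "\<And>s. s \<in> S \<Longrightarrow> ((snd x, - fst x) - p) \<bullet> s = 0"
    using orthogonal_projection_exists by blast
  then obtain v where v: "v \<in> V" "p = (v, h *\<^sub>R L v)" by (auto simp: S_def)
  have "v \<bullet> \<phi> + h * ((fst x + h *\<^sub>R L v) \<bullet> L \<phi>) = snd x \<bullet> \<phi>" if "\<phi> \<in> V" for \<phi>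
    using p(2)[of "(\<phi>, h *\<^sub>R L \<phi>)", unfolded S_def, OF imageI[OF that]] v
    by (simp add: inner_prod_def inner_diff_left inner_add_left algebra_simps)
  then have "euler_step h x (fst x + h *\<^sub>R L v, v)"
    using v by (simp add: euler_step_def)
  then show ?thesis ..
qed

lemma euler_step_linear:
  assumes "euler_step h x z" "euler_step h x' z'"
  shows "euler_step h (a *\<^sub>R x + b *\<^sub>R x') (a *\<^sub>R z + b *\<^sub>R z')"
proof -
  have "(a *\<^sub>R snd z + b *\<^sub>R snd z') \<bullet> \<phi> + h * ((a *\<^sub>R fst z + b *\<^sub>R fst z') \<bullet> L \<phi>)
      = (a *\<^sub>R snd x + b *\<^sub>R snd x') \<bullet> \<phi>" if "\<phi> \<in> V" for \<phi>
  proof -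
    have "snd z \<bullet> \<phi> + h * (fst z \<bullet> L \<phi>) = snd x \<bullet> \<phi>"
      "snd z' \<bullet> \<phi> + h * (fst z' \<bullet> L \<phi>) = snd x' \<bullet> \<phi>"
      using assms that by (auto simp: euler_step_def)
    then show ?thesis
      by (simp add: inner_add_left flip: \<open>snd z \<bullet> \<phi> + h * (fst z \<bullet> L \<phi>) = snd x \<bullet> \<phi>\<close>
          \<open>snd z' \<bullet> \<phi> + h * (fst z' \<bullet> L \<phi>) = snd x' \<bullet> \<phi>\<close>) (simp add: algebra_simps)
  qed
  then show ?thesis
    using assms by (auto simp: euler_step_def L_add L_scale algebra_simps)
qed

text \<open>By skew-symmetry: testing the weak equation with \<open>\<phi> = snd z\<close> cancels the mixed terms.\<close>

lemma euler_step_energy: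
  assumes "euler_step h x z"
  shows "z \<bullet> z = x \<bullet> z"
proof -
  have v: "snd z \<in> V" "fst z - fst x = h *\<^sub>R L (snd z)"
    and "snd z \<bullet> snd z + h * (fst z \<bullet> L (snd z)) = snd x \<bullet> snd z"
    using assms by (auto simp: euler_step_def)
  then have "snd z \<bullet> snd z + fst z \<bullet> (fst z - fst x) = snd x \<bullet> snd z"
    by simp
  then show ?thesis by (simp add: inner_prod_def inner_diff_right inner_commute)
qed

lemma euler_step_contraction:
  assumes "euler_step h x z"
  shows "norm z \<le> norm x"
proof (cases "z = 0")
  case False
  have "norm z * norm z = x \<bullet> z"
    using euler_step_energy[OF assms] by (metis power2_norm_eq_inner power2_eq_square)
  also have "\<dots> \<le> norm x * norm z" by (rule norm_cauchy_schwarz)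
  finally show ?thesis using False by simp
qed simp

lemma euler_step_unique:
  assumes "euler_step h x z" "euler_step h x z'"
  shows "z = z'"
  using euler_step_contraction[OF euler_step_linear[OF assms, of 1 "-1"]] by simp

text \<open>Writing the step as \<open>z - h B z = x\<close>, this is the linear combination \<open>z - k B z = (k / h) x + (1 - k / h) z\<close>;
  it yields the resolvent equation.\<close>

lemma euler_step_resolvent:
  assumes "euler_step h x z" "h > 0"
  shows "euler_step k ((k / h) *\<^sub>R x + (1 - k / h) *\<^sub>R z) z"
proof -
  have v: "snd z \<in> V" "fst z = fst x + h *\<^sub>R L (snd z)"
    and e: "\<And>\<phi>. \<phi> \<in> V \<Longrightarrow> snd z \<bullet> \<phi> + h * (fst z \<bullet> L \<phi>) = snd x \<bullet> \<phi>"
    using assms by (auto simp: euler_step_def)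
  have "(k / h) *\<^sub>R fst z = (k / h) *\<^sub>R fst x + k *\<^sub>R L (snd z)"
    using assms(2) by (simp add: v(2) scaleR_add_right)
  then have "(k / h) *\<^sub>R fst x + (1 - k / h) *\<^sub>R fst z + k *\<^sub>R L (snd z) = fst z"
    by (simp add: algebra_simps)
  moreover have "snd z \<bullet> \<phi> + k * (fst z \<bullet> L \<phi>)
      = ((k / h) *\<^sub>R snd x + (1 - k / h) *\<^sub>R snd z) \<bullet> \<phi>" if "\<phi> \<in> V" for \<phi>
    using assms(2) by (simp add: inner_add_left flip: e[OF that]) (simp add: field_simps)
  ultimately show ?thesis using v(1) by (simp add: euler_step_def)
qed

definition wave_resolvent :: "real \<Rightarrow> 'w \<times> 'h \<Rightarrow> 'w \<times> 'h" where
  "wave_resolvent h x = (SOME z. euler_step h x z)"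

lemma euler_step_wave_resolvent: "h \<noteq> 0 \<Longrightarrow> euler_step h x (wave_resolvent h x)"
  unfolding wave_resolvent_def by (rule someI_ex[OF euler_step_exists])

lemma wave_resolvent_eqI: "h \<noteq> 0 \<Longrightarrow> euler_step h x z \<Longrightarrow> wave_resolvent h x = z"
  using euler_step_unique euler_step_wave_resolvent by blast

lemma wave_resolvent_linear:
  assumes "h > 0"
  shows "wave_resolvent h (a *\<^sub>R x + b *\<^sub>R y) = a *\<^sub>R wave_resolvent h x + b *\<^sub>R wave_resolvent h y"
  using assms by (intro wave_resolvent_eqI euler_step_linear euler_step_wave_resolvent) auto

lemma wave_resolvent_identity:
  assumes h: "h > 0" and k: "k > 0"
  shows "h *\<^sub>R wave_resolvent h x
      = k *\<^sub>R wave_resolvent k x + (h - k) *\<^sub>R wave_resolvent k (wave_resolvent h x)"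
proof -
  have "wave_resolvent h x
      = wave_resolvent k ((k / h) *\<^sub>R x + (1 - k / h) *\<^sub>R wave_resolvent h x)"
    using h k by (intro wave_resolvent_eqI[symmetric] euler_step_resolvent euler_step_wave_resolvent) auto
  then have "h *\<^sub>R wave_resolvent h x = h *\<^sub>R ((k / h) *\<^sub>R wave_resolvent k x
      + (1 - k / h) *\<^sub>R wave_resolvent k (wave_resolvent h x))"
    unfolding wave_resolvent_linear[OF k] by simp
  also have "\<dots> = k *\<^sub>R wave_resolvent k x + (h - k) *\<^sub>R wave_resolvent k (wave_resolvent h x)"
    using h by (simp add: scaleR_add_right right_diff_distrib)
  finally show ?thesis .
qed

sublocale wave: contraction_pseudoresolvent wave_resolvent
proof (rule contraction_pseudoresolvent.intro, goal_cases)
  case (1 h)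
  show ?case
    using wave_resolvent_linear[OF 1, of 1 _ 1] wave_resolvent_linear[OF 1, of _ _ 0]
    by (intro linearI) (simp_all del: split_paired_All)
next
  case (2 h x)
  then show ?case using euler_step_contraction[OF euler_step_wave_resolvent[of h x]] by simp
next
  case (3 h k x)
  then show ?case by (rule wave_resolvent_identity)
qed

lemma closure_V: "subspace (closure V)" "closed (closure V)"
  using subspace_V by (auto intro: subspace_closure closed_closure)

text \<open>Let \<open>(a, b)\<close> be orthogonal to the range. Testing with the step applied to a solution \<open>z'\<close> of the adjoint
  problem with data \<open>(a, b)\<close> gives \<open>z' \<bullet> z' = 0\<close>; hence \<open>a = 0\<close>, and \<open>b\<close> is orthogonal to \<open>V\<close>. So the closure of
  the range contains all of \<open>UNIV \<times> closure V\<close>, which is where the initial data of the wave equation live.\<close>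

lemma wave_resolvent_range:
  assumes "q \<in> closure V"
  shows "(p, q) \<in> closure (range (wave_resolvent 1))"
proof -
  define R where "R = closure (range (wave_resolvent 1))"
  have "subspace (range (wave_resolvent 1))"
    using wave.linear_J[of 1] subspace_UNIV linear_subspace_image by fastforce
  then have "subspace R" "closed R" unfolding R_def by (auto intro: subspace_closure)
  then obtain r where r: "r \<in> R" "\<And>s. s \<in> R \<Longrightarrow> ((p, q) - r) \<bullet> s = 0"
    using orthogonal_projection_exists by blast
  define a where "a = fst ((p, q) - r)"
  define b where "b = snd ((p, q) - r)"
  have orth: "a \<bullet> fst z + b \<bullet> snd z = 0" if "z \<in> range (wave_resolvent 1)" for z
    using r(2)[of z] that closure_subset[of "range (wave_resolvent 1)"]
    by (auto simp: a_def b_def R_def inner_prod_def)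
  (* By skew-symmetry the step of length -1 is the adjoint of the step of length 1. *)
  have "\<exists>z'. euler_step (-1) (a, b) z'" by (rule euler_step_exists) simp
  then obtain z' where z': "euler_step (-1) (a, b) z'" by blast
  have v': "snd z' \<in> V" "fst z' = a - L (snd z')"
    and e': "\<And>\<phi>. \<phi> \<in> V \<Longrightarrow> snd z' \<bullet> \<phi> - fst z' \<bullet> L \<phi> = b \<bullet> \<phi>"
    using z' by (auto simp: euler_step_def)
  define z where "z = wave_resolvent 1 z'"
  have "euler_step 1 z' z" unfolding z_def by (rule euler_step_wave_resolvent) simp
  then have v: "snd z \<in> V" "fst z = fst z' + L (snd z)"
    and e: "\<And>\<phi>. \<phi> \<in> V \<Longrightarrow> snd z \<bullet> \<phi> + fst z \<bullet> L \<phi> = snd z' \<bullet> \<phi>"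
    by (auto simp: euler_step_def)
  have "a \<bullet> fst z = (fst z' + L (snd z')) \<bullet> fst z" using v'(2) by simp
  moreover have "b \<bullet> snd z = snd z' \<bullet> snd z - fst z' \<bullet> L (snd z)" using e'[OF v(1)] by simp
  ultimately have "a \<bullet> fst z + b \<bullet> snd z
      = fst z' \<bullet> fst z + fst z \<bullet> L (snd z') + snd z' \<bullet> snd z - fst z' \<bullet> L (snd z)"
    by (simp add: inner_add_left inner_commute[of "L (snd z')"])
  also have "\<dots> = fst z' \<bullet> fst z' + snd z' \<bullet> snd z'"
    using e[OF v'(1)] v(2) by (simp add: inner_add_right inner_commute)
  finally have "fst z' \<bullet> fst z' + snd z' \<bullet> snd z' = 0"
    using orth[of z] by (simp add: z_def)
  then have "fst z' = 0" "snd z' = 0"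
    by (metis add_nonneg_eq_0_iff inner_ge_zero inner_eq_zero_iff)+
  then have a0: "a = 0" and b0: "\<And>\<phi>. \<phi> \<in> V \<Longrightarrow> b \<bullet> \<phi> = 0"
    using v'(2) e' by (auto simp: L_zero)
  have "range (wave_resolvent 1) \<subseteq> UNIV \<times> V"
  proof (intro subsetI, elim imageE)
    fix z x assume "z = wave_resolvent 1 x"
    then show "z \<in> UNIV \<times> V"
      using euler_step_wave_resolvent[of 1 x] by (simp add: euler_step_def mem_Times_iff)
  qed
  then have "R \<subseteq> closure (UNIV \<times> V)" unfolding R_def by (rule closure_mono)
  then have "snd r \<in> closure V" using r(1) by (auto simp: closure_Times mem_Times_iff)
  then have "b \<in> closure V"
    unfolding b_def using assms closure_V(1) by (simp add: subspace_diff)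
  have "closure V \<subseteq> {x. b \<bullet> x = 0}"
    using b0 by (intro closure_minimal closed_hyperplane) auto
  then have "b = 0" using \<open>b \<in> closure V\<close> by auto
  then have "(p, q) = r" using a0 by (simp add: a_def b_def prod_eq_iff)
  then show ?thesis using r(1) by (simp add: R_def)
qed

text \<open>Summing the Euler steps: the sum of the increments of \<open>u\<close> stays in \<open>V\<close>, with a value of \<open>L\<close> that is
  controlled by the iterates. Closedness of \<open>L\<close> preserves this in the limit, where it identifies \<open>w\<close> with \<open>L u\<close>.\<close>

lemma euler_iterates:
  fixes x :: "'w \<times> 'h"
  assumes "h > 0"
  defines "z \<equiv> \<lambda>n. (wave_resolvent h ^^ n) x"
  shows "(\<Sum>j<n. h *\<^sub>R snd (z (Suc j))) \<in> V
      \<and> L (\<Sum>j<n. h *\<^sub>R snd (z (Suc j))) = fst (z n) - fst x"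
    and "\<phi> \<in> V \<Longrightarrow> snd (z n) \<bullet> \<phi> = snd x \<bullet> \<phi> - (\<Sum>j<n. h *\<^sub>R fst (z (Suc j))) \<bullet> L \<phi>"
proof -
  have step: "euler_step h (z j) (z (Suc j))" for j
    using assms euler_step_wave_resolvent[of h "z j"] by (simp add: z_def)
  show "(\<Sum>j<n. h *\<^sub>R snd (z (Suc j))) \<in> V
      \<and> L (\<Sum>j<n. h *\<^sub>R snd (z (Suc j))) = fst (z n) - fst x"
  proof (induction n)
    case 0
    then show ?case by (simp add: z_def L_zero)
  next
    case (Suc n)
    then show ?case using step[of n] by (auto simp: euler_step_def L_add L_scale)
  qed
  show "snd (z n) \<bullet> \<phi> = snd x \<bullet> \<phi> - (\<Sum>j<n. h *\<^sub>R fst (z (Suc j))) \<bullet> L \<phi>" if "\<phi> \<in> V"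
  proof (induction n)
    case 0
    then show ?case by (simp add: z_def)
  next
    case (Suc n)
    then show ?case using step[of n] that by (auto simp: euler_step_def inner_add_left algebra_simps)
  qed
qed

text \<open>The semigroup applied to \<open>(L u0, v0)\<close> yields \<open>(w, v)\<close>, and \<open>u\<close> is obtained by integrating \<open>v\<close>. The Euler
  sums of \<open>euler_iterates\<close> are perturbed Riemann sums and converge to integrals, so both of its statements
  pass to the limit. For \<open>v0\<close> only membership in the closure of the domain is required, so \<open>v\<close> need not take
  values in \<open>V\<close>, and the equation holds when tested with \<open>\<phi> \<in> V\<close>.\<close>

theorem wave_solution:
  fixes T :: real
  assumes u0: "u0 \<in> V" and v0: "v0 \<in> closure V" and T: "T > 0"
  obtains u v where
    "continuous_on {0..T} v" "continuous_on {0..T} (\<lambda>t. L (u t))"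
    "u 0 = u0" "v 0 = v0"
    "\<And>t. t \<in> {0..T} \<Longrightarrow> u t \<in> V" "\<And>t. t \<in> {0..T} \<Longrightarrow> v t \<in> closure V"
    "\<And>t. t \<in> {0..T} \<Longrightarrow> u t = u0 + integral {0..t} v"
    "\<And>t \<phi>. t \<in> {0..T} \<Longrightarrow> \<phi> \<in> V \<Longrightarrow>
      v t \<bullet> \<phi> = v0 \<bullet> \<phi> - integral {0..t} (\<lambda>\<tau>. L (u \<tau>)) \<bullet> L \<phi>"
proof -
  (* The state of the first order system is (w, v) = (L u, u'). *)
  define x where "x = (L u0, v0)"
  have "\<And>e. e > 0 \<Longrightarrow> \<exists>g>0. norm (wave_resolvent g x - x) < e"
    using wave.approximation_on_closure_range[of 1] wave_resolvent_range[OF v0] unfolding x_def by auto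
  from wave.semigroup_limit[OF this]
  obtain z where unif: "uniform_limit {0..T} (\<lambda>m t. wave.euler m t x) z sequentially"
    and cont: "continuous_on {0..T} z" by blast
  define h where "h m = (1 / 2 ^ m :: real)" for m :: nat
  define n where "n t m = nat \<lfloor>t * 2 ^ m\<rfloor>" for t :: real and m :: nat
  have h_pos: "h m > 0" for m by (simp add: h_def)
  have h_lim: "h \<longlonglongrightarrow> 0"
    using LIMSEQ_power_zero[of "1 / 2 :: real"] by (simp add: h_def[abs_def] power_one_over)
  have n_le: "real (n t m) * h m \<le> t" and n_ge: "t - h m \<le> real (n t m) * h m" if "t \<ge> 0" for t m
  proof -
    have "real (n t m) \<le> t * 2 ^ m" "t * 2 ^ m \<le> real (n t m) + 1"
      unfolding n_def using that by (auto intro: less_imp_le)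
    then have "real (n t m) / 2 ^ m \<le> t" "t \<le> (real (n t m) + 1) / 2 ^ m"
      by (simp_all add: pos_le_divide_eq pos_divide_le_eq)
    then show "real (n t m) * h m \<le> t" "t - h m \<le> real (n t m) * h m"
      by (simp_all add: h_def add_divide_distrib)
  qed
  have euler_grid: "wave.euler m (real j * h m) x = (wave_resolvent (h m) ^^ j) x" for m j
    by (simp add: wave.euler_def h_def)
  have lim: "(\<lambda>m. (wave_resolvent (h m) ^^ n t m) x) \<longlonglongrightarrow> z t" if "t \<in> {0..T}" for t
    using tendsto_uniform_limitI[OF unif that] by (simp add: wave.euler_def h_def n_def)
  have int: "z integrable_on {0..t}" if "t \<in> {0..T}" for t
    using cont that by (intro integrable_continuous_real continuous_on_subset[OF cont]) auto
  (* The iterates are uniformly close to z at the grid points, so the Euler sums are Riemann sums of z up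
     to a uniform error; the remaining piece of [0, t] is shorter than one step. *)
  have sum_lim: "(\<lambda>m. \<Sum>j<n t m. h m *\<^sub>R (wave_resolvent (h m) ^^ Suc j) x) \<longlonglongrightarrow> integral {0..t} z"
    if t: "t \<in> {0..T}" for t
  proof (rule metric_LIMSEQ_I)
    fix e :: real assume e: "e > 0"
    define e' where "e' = e / (2 * (T + 1))"
    have e': "e' > 0" using e T by (simp add: e'_def)
    obtain B where B: "\<And>s. s \<in> {0..T} \<Longrightarrow> norm (z s) \<le> B" "B > 0"
      using compact_imp_bounded[OF compact_continuous_image[OF cont compact_Icc]]
      by (metis bounded_pos imageI)
    have "uniformly_continuous_on {0..T} z"
      using cont by (intro compact_uniformly_continuous) auto
    then obtain d where d: "d > 0"
      "\<And>s s'. s \<in> {0..T} \<Longrightarrow> s' \<in> {0..T} \<Longrightarrow> dist s' s < d \<Longrightarrow> dist (z s') (z s) < e' / 2"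
      using e' unfolding uniformly_continuous_on_def by (metis half_gt_zero)
    have "eventually (\<lambda>m. \<forall>s\<in>{0..T}. dist (wave.euler m s x) (z s) < e' / 2) sequentially"
      using unif e' unfolding uniform_limit_iff by (meson half_gt_zero)
    moreover have "eventually (\<lambda>m. h m < min d (e / (2 * B))) sequentially"
      using order_tendstoD(2)[OF h_lim, of "min d (e / (2 * B))"] d(1) e B(2) by auto
    ultimately have "eventually (\<lambda>m. dist (\<Sum>j<n t m. h m *\<^sub>R (wave_resolvent (h m) ^^ Suc j) x)
        (integral {0..t} z) < e) sequentially"
    proof eventually_elim
      case (elim m)
      define N where "N = n t m"
      have t0: "0 \<le> t" "t \<le> T" using t by auto
      have Nt: "real N * h m \<le> t" "t - h m \<le> real N * h m"
        using n_le n_ge t0 by (auto simp: N_def)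
      have N0: "0 \<le> real N * h m" using h_pos[of m] by simp
      have close: "norm (z s - (wave_resolvent (h m) ^^ Suc j) x) \<le> e'"
        if "j < N" "real j * h m \<le> s" "s \<le> real (Suc j) * h m" for j s
      proof -
        have "real (Suc j) * h m \<le> real N * h m"
          using that(1) h_pos[of m] by (intro mult_right_mono) auto
        moreover have j0: "0 \<le> real j * h m" "0 \<le> real (Suc j) * h m" using h_pos[of m] by simp_all
        ultimately have in_T: "s \<in> {0..T}" "real (Suc j) * h m \<in> {0..T}"
          unfolding atLeastAtMost_iff using that(2,3) Nt t0 by linarith+
        have "dist (real (Suc j) * h m) s < d"
          using that elim(2) by (simp add: dist_real_def algebra_simps)
        then have "dist (z (real (Suc j) * h m)) (z s) < e' / 2" using d(2) in_T by blast
        moreover have "dist (wave.euler m (real (Suc j) * h m) x) (z (real (Suc j) * h m)) < e' / 2"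
          using elim(1) in_T(2) by blast
        ultimately have "dist (wave.euler m (real (Suc j) * h m) x) (z s) < e'"
          using dist_triangle_half_r dist_commute by metis
        then show ?thesis unfolding euler_grid dist_norm by (simp add: norm_minus_commute)
      qed
      have "continuous_on {0..real N * h m} z"
        using Nt t0 by (intro continuous_on_subset[OF cont]) auto
      then have "norm (integral {0..real N * h m} z
          - (\<Sum>j<N. h m *\<^sub>R (wave_resolvent (h m) ^^ Suc j) x)) \<le> real N * h m * e'"
        using h_pos[of m] close by (intro riemann_sum_error) auto
      also have "\<dots> \<le> T * e'" using Nt t0 e' by (intro mult_right_mono) auto
      also have "\<dots> < e / 2" using e T by (simp add: e'_def field_simps)
      finally have 1: "norm (integral {0..real N * h m} z
          - (\<Sum>j<N. h m *\<^sub>R (wave_resolvent (h m) ^^ Suc j) x)) < e / 2" .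
      have split: "integral {0..t} z = integral {0..real N * h m} z + integral {real N * h m..t} z"
        using Henstock_Kurzweil_Integration.integral_combine[OF N0 Nt(1) int[OF t]] by simp
      have "norm (integral {real N * h m..t} z) \<le> B * (t - real N * h m)"
      proof (intro integral_bound continuous_on_subset[OF cont] B(1))
        fix s assume "s \<in> {real N * h m..t}"
        then show "s \<in> {0..T}" using N0 t0 by (meson atLeastAtMost_iff order_trans)
      qed (use Nt N0 t0 in auto)
      also have "\<dots> \<le> B * h m" using B Nt by (intro mult_left_mono) auto
      also have "\<dots> < e / 2" using elim(2) B(2) by (simp add: field_simps)
      finally have 2: "norm (integral {real N * h m..t} z) < e / 2" .
      have "dist (\<Sum>j<N. h m *\<^sub>R (wave_resolvent (h m) ^^ Suc j) x) (integral {0..t} z)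
          = norm ((integral {0..real N * h m} z - (\<Sum>j<N. h m *\<^sub>R (wave_resolvent (h m) ^^ Suc j) x))
            + integral {real N * h m..t} z)"
        unfolding split by (simp add: dist_norm norm_minus_commute algebra_simps)
      also have "\<dots> < e" using 1 2 by (intro norm_triangle_lt) linarith
      finally show ?case unfolding N_def .
    qed
    then show "\<exists>no. \<forall>m\<ge>no. dist (\<Sum>j<n t m. h m *\<^sub>R (wave_resolvent (h m) ^^ Suc j) x)
        (integral {0..t} z) < e"
      by (simp add: eventually_sequentially)
  qed
  have int_fst: "integral {0..t} (\<lambda>s. fst (z s)) = fst (integral {0..t} z)"
    and int_snd: "integral {0..t} (\<lambda>s. snd (z s)) = snd (integral {0..t} z)" if "t \<in> {0..T}" for t
    using integral_linear[OF int[OF that] bounded_linear_fst]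
      integral_linear[OF int[OF that] bounded_linear_snd] by (simp_all add: o_def)
  define v where "v = (\<lambda>t. snd (z t))"
  define u where "u = (\<lambda>t. u0 + integral {0..t} v)"
  have z0: "z 0 = x"
    using lim[of 0] T by (simp add: n_def LIMSEQ_const_iff)
  have Lint: "integral {0..t} v \<in> V \<and> L (integral {0..t} v) = fst (z t) - L u0"
    if t: "t \<in> {0..T}" for t
  proof (rule graph_limit)
    let ?s = "\<lambda>m. \<Sum>j<n t m. h m *\<^sub>R snd ((wave_resolvent (h m) ^^ Suc j) x)"
    show "?s m \<in> V" for m using euler_iterates(1)[OF h_pos] by blast
    have "?s = (\<lambda>m. snd (\<Sum>j<n t m. h m *\<^sub>R (wave_resolvent (h m) ^^ Suc j) x))"
      by (simp add: snd_sum)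
    then show "?s \<longlonglongrightarrow> integral {0..t} v"
      unfolding v_def int_snd[OF t] using tendsto_snd[OF sum_lim[OF t]] by simp
    have "L (?s m) = fst ((wave_resolvent (h m) ^^ n t m) x) - fst x" for m
      using euler_iterates(1)[OF h_pos] by blast
    then show "(\<lambda>m. L (?s m)) \<longlonglongrightarrow> fst (z t) - L u0"
      using tendsto_fst[OF lim[OF t]] by (simp add: x_def tendsto_diff)
  qed
  have u: "u t \<in> V" "L (u t) = fst (z t)" if "t \<in> {0..T}" for t
    using Lint[OF that] u0 by (auto simp: u_def L_add)
  show ?thesis
  proof (rule that)
    show "continuous_on {0..T} v" unfolding v_def by (intro continuous_intros cont)
    have "continuous_on {0..T} (\<lambda>t. fst (z t))" by (intro continuous_intros cont)
    then show "continuous_on {0..T} (\<lambda>t. L (u t))"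
      using continuous_on_cong[of "{0..T}" "{0..T}" "\<lambda>t. L (u t)" "\<lambda>t. fst (z t)"] u(2) by simp
    show "u 0 = u0" by (simp add: u_def)
    show "v 0 = v0" by (simp add: v_def z0 x_def)
    show "u t \<in> V" if "t \<in> {0..T}" for t using u(1) that .
    show "u t = u0 + integral {0..t} v" for t by (simp add: u_def)
    show "v t \<in> closure V" if t: "t \<in> {0..T}" for t
    proof (rule closed_sequentially[OF closed_closure])
      show "(\<lambda>m. snd ((wave_resolvent (h m) ^^ n t m) x)) \<longlonglongrightarrow> v t"
        unfolding v_def by (intro tendsto_snd lim t)
      show "snd ((wave_resolvent (h m) ^^ n t m) x) \<in> closure V" for m
      proof (cases "n t m")
        case 0
        then show ?thesis using v0 by (simp add: x_def)
      next
        case (Suc j)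
        then show ?thesis
          using euler_step_wave_resolvent[of "h m" "(wave_resolvent (h m) ^^ j) x"] h_pos[of m]
            closure_subset[of V] by (auto simp: euler_step_def)
      qed
    qed
    show "v t \<bullet> \<phi> = v0 \<bullet> \<phi> - integral {0..t} (\<lambda>\<tau>. L (u \<tau>)) \<bullet> L \<phi>"
      if t: "t \<in> {0..T}" and \<phi>: "\<phi> \<in> V" for t \<phi>
    proof (rule LIMSEQ_unique)
      show "(\<lambda>m. snd ((wave_resolvent (h m) ^^ n t m) x) \<bullet> \<phi>) \<longlonglongrightarrow> v t \<bullet> \<phi>"
        unfolding v_def by (intro tendsto_intros tendsto_snd lim t)
      have "integral {0..t} (\<lambda>\<tau>. L (u \<tau>)) = integral {0..t} (\<lambda>\<tau>. fst (z \<tau>))"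
        using t u(2) by (intro Henstock_Kurzweil_Integration.integral_cong) auto
      then have i: "integral {0..t} (\<lambda>\<tau>. L (u \<tau>)) = fst (integral {0..t} z)"
        using int_fst[OF t] by simp
      have "snd ((wave_resolvent (h m) ^^ n t m) x) \<bullet> \<phi> = v0 \<bullet> \<phi>
          - fst (\<Sum>j<n t m. h m *\<^sub>R (wave_resolvent (h m) ^^ Suc j) x) \<bullet> L \<phi>" for m
        using euler_iterates(2)[OF h_pos \<phi>, where x=x] by (simp add: x_def fst_sum)
      then show "(\<lambda>m. snd ((wave_resolvent (h m) ^^ n t m) x) \<bullet> \<phi>)
          \<longlonglongrightarrow> v0 \<bullet> \<phi> - integral {0..t} (\<lambda>\<tau>. L (u \<tau>)) \<bullet> L \<phi>"
        unfolding i by (simp only:) (intro tendsto_intros tendsto_fst sum_lim t)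
    qed
  qed
qed

end

section \<open>The Hilbert space of square-integrable functions\<close>

definition square_integrable :: "('a::euclidean_space \<Rightarrow> 'b::euclidean_space) set" where
  "square_integrable = {f \<in> borel_measurable lebesgue. integrable lebesgue (\<lambda>x. (norm (f x))\<^sup>2)}"

lemma square_integrableD:
  assumes "f \<in> square_integrable"
  shows "f \<in> borel_measurable lebesgue" "integrable lebesgue (\<lambda>x. (norm (f x))\<^sup>2)"
  using assms by (auto simp: square_integrable_def)

lemma square_integrable_iff_nn_integral:
  "f \<in> square_integrable \<longleftrightarrow>
    f \<in> borel_measurable lebesgue \<and> (\<integral>\<^sup>+x. ennreal ((norm (f x))\<^sup>2) \<partial>lebesgue) < \<infinity>"
  by (auto simp: square_integrable_def integrable_iff_bounded)

lemma norm_add_square_le: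
  fixes a b :: "'b::real_normed_vector"
  shows "(norm (a + b))\<^sup>2 \<le> 2 * (norm a)\<^sup>2 + 2 * (norm b)\<^sup>2"
proof -
  have "(norm (a + b))\<^sup>2 \<le> (norm a + norm b)\<^sup>2"
    by (intro power_mono norm_triangle_ineq) auto
  also have "\<dots> \<le> 2 * (norm a)\<^sup>2 + 2 * (norm b)\<^sup>2"
    using sum_squares_bound[of "norm a" "norm b"] by (simp add: power2_sum)
  finally show ?thesis .
qed

lemma square_integrable_bound:
  assumes g: "integrable lebesgue g" and f: "f \<in> borel_measurable lebesgue"
    and le: "AE x in lebesgue. (norm (f x))\<^sup>2 \<le> g x"
  shows "f \<in> square_integrable"
proof -
  have "integrable lebesgue (\<lambda>x. (norm (f x))\<^sup>2)"
  proof (rule Bochner_Integration.integrable_bound[OF g])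
    show "(\<lambda>x. (norm (f x))\<^sup>2) \<in> borel_measurable lebesgue" using f by measurable
    show "AE x in lebesgue. norm ((norm (f x))\<^sup>2) \<le> norm (g x)"
      using le by eventually_elim auto
  qed
  then show ?thesis using f by (simp add: square_integrable_def)
qed

lemma square_integrable_add:
  assumes "f \<in> square_integrable" "g \<in> square_integrable"
  shows "(\<lambda>x. f x + g x) \<in> square_integrable"
proof (rule square_integrable_bound)
  show "integrable lebesgue (\<lambda>x. 2 * (norm (f x))\<^sup>2 + 2 * (norm (g x))\<^sup>2)"
    using assms by (auto simp: square_integrable_def)
qed (use assms in \<open>auto simp: square_integrable_def norm_add_square_le\<close>)

lemma square_integrable_scaleR:
  "f \<in> square_integrable \<Longrightarrow> (\<lambda>x. c *\<^sub>R f x) \<in> square_integrable"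
  by (auto simp: square_integrable_def power_mult_distrib)

lemma square_integrable_zero: "(\<lambda>x. 0) \<in> square_integrable"
  by (simp add: square_integrable_def)

lemma square_integrable_uminus: "f \<in> square_integrable \<Longrightarrow> (\<lambda>x. - f x) \<in> square_integrable"
  by (auto simp: square_integrable_def)

lemma square_integrable_diff:
  "f \<in> square_integrable \<Longrightarrow> g \<in> square_integrable \<Longrightarrow> (\<lambda>x. f x - g x) \<in> square_integrable"
  using square_integrable_add[of f "\<lambda>x. - g x"] square_integrable_uminus[of g] by simp

lemma square_integrable_cong_AE:
  assumes "f \<in> square_integrable" "g \<in> borel_measurable lebesgue" "AE x in lebesgue. f x = g x"
  shows "g \<in> square_integrable"
  by (rule square_integrable_bound[of "\<lambda>x. (norm (f x))\<^sup>2"])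
    (use assms in \<open>auto simp: square_integrable_def elim: eventually_mono\<close>)

lemma square_integrable_inner:
  assumes "f \<in> square_integrable" "g \<in> square_integrable"
  shows "integrable lebesgue (\<lambda>x. f x \<bullet> g x)"
proof (rule Bochner_Integration.integrable_bound)
  show "integrable lebesgue (\<lambda>x. (norm (f x))\<^sup>2 + (norm (g x))\<^sup>2)"
    using assms by (auto simp: square_integrable_def)
  show "(\<lambda>x. f x \<bullet> g x) \<in> borel_measurable lebesgue"
    using assms by (auto simp: square_integrable_def)
  have "norm (a \<bullet> b) \<le> norm ((norm a)\<^sup>2 + (norm b)\<^sup>2)" for a b :: 'b
    using Cauchy_Schwarz_ineq2[of a b] sum_squares_bound[of "norm a" "norm b"]
      zero_le_power2[of "norm a"] zero_le_power2[of "norm b"] by auto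
  then show "AE x in lebesgue. norm (f x \<bullet> g x) \<le> norm ((norm (f x))\<^sup>2 + (norm (g x))\<^sup>2)"
    by simp
qed

text \<open>The sum \<open>\<Sum>\<^sub>n 2\<^sup>n |f\<^sub>n\<^sub>+\<^sub>1 - f\<^sub>n|\<^sup>2\<close> has finite integral and is therefore finite almost everywhere; the
  increments themselves are summable there because \<open>d \<le> 2\<^sup>n d\<^sup>2 + 2\<^sup>-\<^sup>n\<close> for \<open>d \<ge> 0\<close>.\<close>

lemma square_integrable_rapidly_Cauchy_limit:
  fixes f :: "nat \<Rightarrow> 'a::euclidean_space \<Rightarrow> 'b::euclidean_space"
  assumes f: "\<And>n. f n \<in> square_integrable"
    and rapid: "\<And>n. (\<integral>x. (norm (f (Suc n) x - f n x))\<^sup>2 \<partial>lebesgue) \<le> (1 / 4) ^ n"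
  obtains g where "g \<in> borel_measurable lebesgue" "AE x in lebesgue. (\<lambda>n. f n x) \<longlonglongrightarrow> g x"
proof -
  have meas [measurable]: "f n \<in> borel_measurable lebesgue" for n
    using f by (auto simp: square_integrable_def)
  define d where "d n x = norm (f (Suc n) x - f n x)" for n x
  have "(\<integral>\<^sup>+x. (\<Sum>n. ennreal (2 ^ n * (d n x)\<^sup>2)) \<partial>lebesgue)
      = (\<Sum>n. \<integral>\<^sup>+x. ennreal (2 ^ n * (d n x)\<^sup>2) \<partial>lebesgue)"
    unfolding d_def by (intro nn_integral_suminf) measurable
  also have "\<dots> \<le> (\<Sum>n. ennreal ((1 / 2) ^ n))"
  proof (intro suminf_le)
    fix n
    have "integrable lebesgue (\<lambda>x. (d n x)\<^sup>2)"
      unfolding d_def using square_integrable_diff[OF f f] by (rule square_integrableD)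
    then have "(\<integral>\<^sup>+x. ennreal (2 ^ n * (d n x)\<^sup>2) \<partial>lebesgue) = ennreal (2 ^ n * (\<integral>x. (d n x)\<^sup>2 \<partial>lebesgue))"
      by (subst nn_integral_eq_integral) auto
    also have "\<dots> \<le> ennreal (2 ^ n * (1 / 4) ^ n)"
      using rapid[of n] by (intro ennreal_leI mult_left_mono) (auto simp: d_def)
    also have "2 ^ n * (1 / 4 :: real) ^ n = (1 / 2) ^ n"
      by (simp flip: power_mult_distrib)
    finally show "(\<integral>\<^sup>+x. ennreal (2 ^ n * (d n x)\<^sup>2) \<partial>lebesgue) \<le> ennreal ((1 / 2) ^ n)" .
  qed auto
  also have "\<dots> = ennreal (\<Sum>n. (1 / 2) ^ n)"
    by (intro suminf_ennreal2) auto
  also have "\<dots> < \<infinity>" by simp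
  finally have "(\<integral>\<^sup>+x. (\<Sum>n. ennreal (2 ^ n * (d n x)\<^sup>2)) \<partial>lebesgue) \<noteq> \<infinity>" by simp
  then have "AE x in lebesgue. (\<Sum>n. ennreal (2 ^ n * (d n x)\<^sup>2)) \<noteq> \<infinity>"
    unfolding d_def by (intro nn_integral_noteq_infinite) measurable
  then have conv: "AE x in lebesgue. convergent (\<lambda>n. f n x)"
  proof eventually_elim
    case (elim x)
    have "summable (\<lambda>n. 2 ^ n * (d n x)\<^sup>2)"
      by (rule summable_suminf_not_top) (use elim in auto)
    then have "summable (\<lambda>n. 2 ^ n * (d n x)\<^sup>2 + (1 / 2) ^ n)"
      by (intro summable_add summable_geometric) auto
    then have "summable (\<lambda>n. d n x)"
    proof (rule summable_comparison_test')
      fix n :: nat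
      have "0 \<le> (2 ^ n * d n x - 1)\<^sup>2 + 1" by simp
      then have "2 * (2 ^ n * d n x) \<le> (2 ^ n * d n x)\<^sup>2 + 2" by (simp add: power2_diff)
      moreover have "0 \<le> (2 ^ n * d n x - 1)\<^sup>2" by simp
      then have "2 * (2 ^ n * d n x) \<le> (2 ^ n * d n x)\<^sup>2 + 1" by (simp add: power2_diff)
      moreover have "0 \<le> 2 ^ n * d n x" by (simp add: d_def)
      ultimately have "2 ^ n * d n x \<le> (2 ^ n * d n x)\<^sup>2 + 1" by linarith
      then have "d n x \<le> ((2 ^ n * d n x)\<^sup>2 + 1) / 2 ^ n" by (simp add: pos_le_divide_eq mult.commute)
      also have "\<dots> = 2 ^ n * (d n x)\<^sup>2 + (1 / 2) ^ n"
        by (simp add: power2_eq_square field_simps)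
      finally show "norm (d n x) \<le> 2 ^ n * (d n x)\<^sup>2 + (1 / 2) ^ n" by (simp add: d_def)
    qed
    then have "summable (\<lambda>n. f (Suc n) x - f n x)"
      unfolding d_def by (rule summable_norm_cancel)
    then have "convergent (\<lambda>n. \<Sum>i<n. f (Suc i) x - f i x)" by (simp add: summable_iff_convergent)
    then have "convergent (\<lambda>n. f n x - f 0 x)" by (simp only: sum_lessThan_telescope[of "\<lambda>i. f i x"])
    then have "convergent (\<lambda>n. (f n x - f 0 x) + f 0 x)" by (intro convergent_add convergent_const)
    then show ?case by simp
  qed
  show ?thesis
  proof
    show "AE x in lebesgue. (\<lambda>n. f n x) \<longlonglongrightarrow> lim (\<lambda>n. f n x)"
      using conv by eventually_elim (rule convergent_LIMSEQ_iff[THEN iffD1])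
    show "(\<lambda>x. lim (\<lambda>n. f n x)) \<in> borel_measurable lebesgue" by measurable
  qed
qed

text \<open>Fatou's lemma: it turns almost everywhere limits of Cauchy sequences into limits in the mean.\<close>

lemma nn_integral_norm_square_limit_le:
  fixes f :: "nat \<Rightarrow> 'a::euclidean_space \<Rightarrow> 'b::euclidean_space"
  assumes f: "\<And>n. f n \<in> borel_measurable lebesgue"
    and lim: "AE x in lebesgue. (\<lambda>n. f n x) \<longlonglongrightarrow> g x"
    and bound: "eventually (\<lambda>n. (\<integral>\<^sup>+x. ennreal ((norm (f n x))\<^sup>2) \<partial>lebesgue) \<le> C) sequentially"
  shows "(\<integral>\<^sup>+x. ennreal ((norm (g x))\<^sup>2) \<partial>lebesgue) \<le> C"
proof -
  note f [measurable]
  have "(\<integral>\<^sup>+x. ennreal ((norm (g x))\<^sup>2) \<partial>lebesgue)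
      = (\<integral>\<^sup>+x. liminf (\<lambda>n. ennreal ((norm (f n x))\<^sup>2)) \<partial>lebesgue)"
  proof (rule nn_integral_cong_AE, use lim in eventually_elim)
    case (elim x)
    then have "(\<lambda>n. ennreal ((norm (f n x))\<^sup>2)) \<longlonglongrightarrow> ennreal ((norm (g x))\<^sup>2)"
      by (intro tendsto_ennrealI tendsto_intros)
    then show ?case by (intro lim_imp_Liminf[symmetric]) auto
  qed
  also have "\<dots> \<le> liminf (\<lambda>n. \<integral>\<^sup>+x. ennreal ((norm (f n x))\<^sup>2) \<partial>lebesgue)"
    by (intro nn_integral_liminf) measurable
  also have "\<dots> \<le> C"
    using Liminf_mono[OF bound] by (simp add: Liminf_const)
  finally show ?thesis .
qed

text \<open>The relation is partial, so the classes of square-integrable functions form a type of their own, to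
  which the theory of real inner product spaces and of Banach spaces applies.\<close>

quotient_type (overloaded) ('a, 'b) L2_space = "'a::euclidean_space \<Rightarrow> 'b::euclidean_space" /
  partial: "\<lambda>f g. f \<in> square_integrable \<and> g \<in> square_integrable \<and> (AE x in lebesgue. f x = g x)"
proof (rule part_equivpI)
  show "\<exists>f :: 'a \<Rightarrow> 'b. f \<in> square_integrable \<and> f \<in> square_integrable \<and> (AE x in lebesgue. f x = f x)"
    using square_integrable_zero by auto
  show "symp (\<lambda>f g :: 'a \<Rightarrow> 'b. f \<in> square_integrable \<and> g \<in> square_integrable \<and> (AE x in lebesgue. f x = g x))"
    by (auto simp: symp_def eq_commute)
  show "transp (\<lambda>f g :: 'a \<Rightarrow> 'b. f \<in> square_integrable \<and> g \<in> square_integrable \<and> (AE x in lebesgue. f x = g x))"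
    unfolding transp_def by (auto elim: eventually_elim2)
qed

lemma integral_inner_self:
  fixes f :: "'a::euclidean_space \<Rightarrow> 'b::euclidean_space"
  shows "(\<integral>x. f x \<bullet> f x \<partial>lebesgue) = (\<integral>x. (norm (f x))\<^sup>2 \<partial>lebesgue)"
  by (simp add: power2_norm_eq_inner)

instantiation L2_space :: (euclidean_space, euclidean_space) real_inner
begin

lift_definition zero_L2_space :: "('a, 'b) L2_space" is "\<lambda>x. 0"
  by (simp add: square_integrable_zero)

lift_definition plus_L2_space :: "('a, 'b) L2_space \<Rightarrow> ('a, 'b) L2_space \<Rightarrow> ('a, 'b) L2_space"
  is "\<lambda>f g x. f x + g x"
  by (auto intro: square_integrable_add elim: eventually_elim2)

lift_definition uminus_L2_space :: "('a, 'b) L2_space \<Rightarrow> ('a, 'b) L2_space" is "\<lambda>f x. - f x"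
  by (auto intro: square_integrable_uminus elim: eventually_mono)

lift_definition minus_L2_space :: "('a, 'b) L2_space \<Rightarrow> ('a, 'b) L2_space \<Rightarrow> ('a, 'b) L2_space"
  is "\<lambda>f g x. f x - g x"
  by (auto intro: square_integrable_diff elim: eventually_elim2)

lift_definition scaleR_L2_space :: "real \<Rightarrow> ('a, 'b) L2_space \<Rightarrow> ('a, 'b) L2_space"
  is "\<lambda>c f x. c *\<^sub>R f x"
  by (auto intro: square_integrable_scaleR elim: eventually_mono)

lift_definition inner_L2_space :: "('a, 'b) L2_space \<Rightarrow> ('a, 'b) L2_space \<Rightarrow> real"
  is "\<lambda>f g. \<integral>x. f x \<bullet> g x \<partial>lebesgue"
proof -
  fix f f' g g' :: "'a \<Rightarrow> 'b"
  assume "f \<in> square_integrable \<and> f' \<in> square_integrable \<and> (AE x in lebesgue. f x = f' x)"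
    and "g \<in> square_integrable \<and> g' \<in> square_integrable \<and> (AE x in lebesgue. g x = g' x)"
  then show "(\<integral>x. f x \<bullet> g x \<partial>lebesgue) = (\<integral>x. f' x \<bullet> g' x \<partial>lebesgue)"
    by (intro integral_cong_AE borel_measurable_inner) (auto simp: square_integrable_def elim: eventually_elim2)
qed

definition norm_L2_space :: "('a, 'b) L2_space \<Rightarrow> real" where
  "norm_L2_space x = sqrt (inner x x)"

definition dist_L2_space :: "('a, 'b) L2_space \<Rightarrow> ('a, 'b) L2_space \<Rightarrow> real" where
  "dist_L2_space x y = norm (x - y)"

definition sgn_L2_space :: "('a, 'b) L2_space \<Rightarrow> ('a, 'b) L2_space" where
  "sgn_L2_space x = inverse (norm x) *\<^sub>R x"

definition uniformity_L2_space :: "(('a, 'b) L2_space \<times> ('a, 'b) L2_space) filter" where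
  "uniformity_L2_space = (INF e\<in>{0<..}. principal {(x, y). dist x y < e})"

definition open_L2_space :: "('a, 'b) L2_space set \<Rightarrow> bool" where
  "open_L2_space U \<longleftrightarrow> (\<forall>x\<in>U. eventually (\<lambda>(x', y). x' = x \<longrightarrow> y \<in> U) uniformity)"

instance
proof
  fix x y z :: "('a, 'b) L2_space" and a b :: real
  show "dist x y = norm (x - y)" by (rule dist_L2_space_def)
  show "sgn x = inverse (norm x) *\<^sub>R x" by (rule sgn_L2_space_def)
  show "norm x = sqrt (inner x x)" by (rule norm_L2_space_def)
  show "(uniformity :: (('a, 'b) L2_space \<times> ('a, 'b) L2_space) filter)
      = (INF e\<in>{0<..}. principal {(x, y). dist x y < e})" by (rule uniformity_L2_space_def)
  show "open U \<longleftrightarrow> (\<forall>x\<in>U. eventually (\<lambda>(x', y). x' = x \<longrightarrow> y \<in> U) uniformity)"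
    for U :: "('a, 'b) L2_space set" by (rule open_L2_space_def)
  show "x + y + z = x + (y + z)"
    by transfer (auto intro!: square_integrable_add simp: add.assoc)
  show "x + y = y + x"
    by transfer (auto intro!: square_integrable_add simp: add.commute)
  show "0 + x = x" by transfer auto
  show "- x + x = 0" by transfer (auto simp: square_integrable_zero)
  show "x - y = x + - y"
    by transfer (auto intro!: square_integrable_add square_integrable_diff square_integrable_uminus)
  show "a *\<^sub>R (x + y) = a *\<^sub>R x + a *\<^sub>R y"
    by transfer (auto intro!: square_integrable_add square_integrable_scaleR simp: scaleR_add_right)
  show "(a + b) *\<^sub>R x = a *\<^sub>R x + b *\<^sub>R x"
    by transfer (auto intro!: square_integrable_add square_integrable_scaleR simp: scaleR_add_left)
  show "a *\<^sub>R b *\<^sub>R x = (a * b) *\<^sub>R x"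
    by transfer (auto intro!: square_integrable_scaleR)
  show "1 *\<^sub>R x = x" by transfer auto
  show "inner x y = inner y x" by transfer (simp add: inner_commute)
  show "inner (x + y) z = inner x z + inner y z"
    by transfer (simp add: inner_add_left square_integrable_inner)
  show "inner (a *\<^sub>R x) y = a * inner x y" by transfer simp
  show "0 \<le> inner x x" by transfer simp
  show "inner x x = 0 \<longleftrightarrow> x = 0"
  proof (transfer, elim conjE)
    fix f :: "'a \<Rightarrow> 'b" assume f: "f \<in> square_integrable"
    have "(\<integral>x. (norm (f x))\<^sup>2 \<partial>lebesgue) = 0 \<longleftrightarrow> (AE x in lebesgue. (norm (f x))\<^sup>2 = 0)"
      using f by (intro integral_nonneg_eq_0_iff_AE) (auto simp: square_integrable_def)
    then show "(\<integral>x. f x \<bullet> f x \<partial>lebesgue) = 0 \<longleftrightarrow>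
        f \<in> square_integrable \<and> (\<lambda>x. 0) \<in> square_integrable \<and> (AE x in lebesgue. f x = 0)"
      using f by (simp add: integral_inner_self square_integrable_zero)
  qed
qed

end

abbreviation L2_class :: "('a::euclidean_space \<Rightarrow> 'b::euclidean_space) \<Rightarrow> ('a, 'b) L2_space" where
  "L2_class \<equiv> abs_L2_space"

lemma L2_class_eq_iff:
  assumes "f \<in> square_integrable" "g \<in> square_integrable"
  shows "L2_class f = L2_class g \<longleftrightarrow> (AE x in lebesgue. f x = g x)"
  using Quotient_rel_abs2[OF Quotient_L2_space] Quotient_rel[OF Quotient_L2_space, of f g] assms by auto

lemma L2_class_arith:
  assumes "f \<in> square_integrable" "g \<in> square_integrable"
  shows L2_class_add: "L2_class (\<lambda>x. f x + g x) = L2_class f + L2_class g"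
    and L2_class_diff: "L2_class (\<lambda>x. f x - g x) = L2_class f - L2_class g"
    and L2_class_inner: "inner (L2_class f) (L2_class g) = (\<integral>x. f x \<bullet> g x \<partial>lebesgue)"
  using assms by (auto simp: plus_L2_space.abs_eq minus_L2_space.abs_eq inner_L2_space.abs_eq)

lemma L2_class_scaleR: "f \<in> square_integrable \<Longrightarrow> L2_class (\<lambda>x. c *\<^sub>R f x) = c *\<^sub>R L2_class f"
  by (auto simp: scaleR_L2_space.abs_eq)

lemma L2_class_zero: "L2_class (\<lambda>x. 0) = 0"
  by (simp add: zero_L2_space.abs_eq)

lemma norm_L2_class:
  assumes "f \<in> square_integrable"
  shows "(norm (L2_class f))\<^sup>2 = (\<integral>x. (norm (f x))\<^sup>2 \<partial>lebesgue)"
  using assms by (simp add: power2_norm_eq_inner L2_class_inner)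

lemma nn_integral_norm_square:
  assumes "f \<in> square_integrable"
  shows "(\<integral>\<^sup>+x. ennreal ((norm (f x))\<^sup>2) \<partial>lebesgue) = ennreal ((norm (L2_class f))\<^sup>2)"
  unfolding norm_L2_class[OF assms]
  using assms by (intro nn_integral_eq_integral) (auto simp: square_integrable_def)

lemma completion_ex_borel_measurable_euclidean:
  fixes f :: "'a \<Rightarrow> 'b::euclidean_space"
  assumes "f \<in> borel_measurable (completion M)"
  shows "\<exists>g\<in>borel_measurable M. AE x in M. f x = g x"
proof -
  have "\<exists>g\<in>borel_measurable M. AE x in M. f x \<bullet> b = g x" if "b \<in> Basis" for b
    using assms by (intro completion_ex_borel_measurable_real) auto
  then obtain g where g: "\<And>b. b \<in> Basis \<Longrightarrow> g b \<in> borel_measurable M"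
    "\<And>b. b \<in> Basis \<Longrightarrow> AE x in M. f x \<bullet> b = g b x" by metis
  have "AE x in M. \<forall>b\<in>Basis. f x \<bullet> b = g b x"
    using g(2) by (intro AE_finite_allI) auto
  then have "AE x in M. f x = (\<Sum>b\<in>Basis. g b x *\<^sub>R b)"
  proof eventually_elim
    case (elim x)
    have "f x = (\<Sum>b\<in>Basis. (f x \<bullet> b) *\<^sub>R b)" by (simp add: euclidean_representation)
    then show ?case using elim by simp
  qed
  moreover have "(\<lambda>x. \<Sum>b\<in>Basis. g b x *\<^sub>R b) \<in> borel_measurable M"
    using g(1) by (intro borel_measurable_sum borel_measurable_scaleR) auto
  ultimately show ?thesis by (intro bexI)
qed

lemma L2_space_borel_representative:
  "\<exists>f. f \<in> borel_measurable borel \<and> f \<in> square_integrable \<and> L2_class f = x"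
proof -
  obtain f where f: "f \<in> square_integrable" "L2_class f = x"
    using Quotient_rep_reflp[OF Quotient_L2_space, of x] Quotient_abs_rep[OF Quotient_L2_space, of x] by auto
  obtain g where g: "g \<in> borel_measurable lborel" "AE x in lborel. f x = g x"
    using completion_ex_borel_measurable_euclidean[of f lborel] f(1) by (auto simp: square_integrable_def)
  have ae: "AE x in lebesgue. f x = g x" by (rule AE_completion[OF g(2)])
  have "g \<in> square_integrable"
    using f(1) measurable_completion[OF g(1)] ae by (rule square_integrable_cong_AE)
  then have "L2_class g = x" using f ae L2_class_eq_iff[OF f(1), of g] by simp
  then show ?thesis using g(1) \<open>g \<in> square_integrable\<close> by (intro exI[of _ g]) simp
qed

text \<open>The representative is chosen to be Borel measurable rather than merely Lebesgue measurable: the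
  Fubini arguments for the Fourier integral need measurability on product spaces.\<close>

definition L2_fun :: "('a::euclidean_space, 'b::euclidean_space) L2_space \<Rightarrow> 'a \<Rightarrow> 'b" where
  "L2_fun x = (SOME f. f \<in> borel_measurable borel \<and> f \<in> square_integrable \<and> L2_class f = x)"

lemma L2_fun:
  "L2_fun x \<in> borel_measurable borel \<and> L2_fun x \<in> square_integrable \<and> L2_class (L2_fun x) = x"
  unfolding L2_fun_def by (rule someI_ex[OF L2_space_borel_representative])

lemmas L2_fun_borel [measurable] = L2_fun[THEN conjunct1]
  and L2_fun_square_integrable [simp] = L2_fun[THEN conjunct2, THEN conjunct1]
  and L2_class_fun [simp] = L2_fun[THEN conjunct2, THEN conjunct2]

lemma L2_fun_AE:
  assumes "f \<in> square_integrable"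
  shows "AE x in lebesgue. L2_fun (L2_class f) x = f x"
  using L2_class_eq_iff[of "L2_fun (L2_class f)" f] assms by simp

lemma nn_integral_L2_fun_diff:
  "(\<integral>\<^sup>+t. ennreal ((norm (L2_fun x t - L2_fun y t))\<^sup>2) \<partial>lebesgue) = ennreal ((norm (x - y))\<^sup>2)"
proof -
  have "(\<lambda>t. L2_fun x t - L2_fun y t) \<in> square_integrable" by (intro square_integrable_diff) auto
  from nn_integral_norm_square[OF this] show ?thesis by (simp add: L2_class_diff)
qed

text \<open>The Riesz--Fischer argument: a rapidly Cauchy subsequence converges almost everywhere, the limit is
  attained in the mean by Fatou's lemma, and a Cauchy sequence converges with its subsequences.\<close>

instance L2_space :: (euclidean_space, euclidean_space) banach
proof
  fix X :: "nat \<Rightarrow> ('a, 'b) L2_space" assume X: "Cauchy X"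
  have "\<exists>N. \<forall>m\<ge>N. \<forall>n\<ge>N. dist (X m) (X n) < (1 / 2) ^ j" for j
    using metric_CauchyD[OF X, of "(1 / 2) ^ j"] by simp
  then obtain N where N: "\<And>j m n. m \<ge> N j \<Longrightarrow> n \<ge> N j \<Longrightarrow> dist (X m) (X n) < (1 / 2) ^ j" by metis
  define r where "r j = (\<Sum>i\<le>j. N i) + j" for j
  have r: "N j \<le> r j" "r j \<le> r (Suc j)" "j \<le> r j" for j
    by (auto simp: r_def intro: member_le_sum trans_le_add1)
  define f where "f j = L2_fun (X (r j))" for j
  have f: "f j \<in> square_integrable" for j by (simp add: f_def)
  have "(\<integral>x. (norm (f (Suc j) x - f j x))\<^sup>2 \<partial>lebesgue) \<le> (1 / 4) ^ j" for j
  proof -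
    have "(\<integral>x. (norm (f (Suc j) x - f j x))\<^sup>2 \<partial>lebesgue) = (norm (X (r (Suc j)) - X (r j)))\<^sup>2"
      using norm_L2_class[OF square_integrable_diff[OF f f], of "Suc j" j]
      by (simp add: L2_class_diff f) (simp add: f_def)
    also have "\<dots> \<le> ((1 / 2) ^ j)\<^sup>2"
      using N[of j "r (Suc j)" "r j"] r(1)[of j] r(2)[of j]
      by (intro power_mono) (auto simp: dist_norm intro: less_imp_le)
    also have "\<dots> = (1 / 4) ^ j" by (simp add: power2_eq_square flip: power_mult_distrib)
    finally show ?thesis .
  qed
  from square_integrable_rapidly_Cauchy_limit[OF f this]
  obtain g where g: "g \<in> borel_measurable lebesgue" "AE x in lebesgue. (\<lambda>n. f n x) \<longlonglongrightarrow> g x" by blast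
  have fm: "f n \<in> borel_measurable lebesgue" for n using f square_integrableD by blast
  have close: "(\<integral>\<^sup>+x. ennreal ((norm (f j x - g x))\<^sup>2) \<partial>lebesgue) \<le> ennreal (((1 / 2) ^ j)\<^sup>2)" for j
  proof (rule nn_integral_norm_square_limit_le)
    show "(\<lambda>x. f j x - f n x) \<in> borel_measurable lebesgue" for n using fm by measurable
    show "AE x in lebesgue. (\<lambda>n. f j x - f n x) \<longlonglongrightarrow> f j x - g x"
      using g(2) by eventually_elim (intro tendsto_intros)
    show "\<forall>\<^sub>F n in sequentially. (\<integral>\<^sup>+x. ennreal ((norm (f j x - f n x))\<^sup>2) \<partial>lebesgue) \<le> ennreal (((1 / 2) ^ j)\<^sup>2)"
    proof (rule eventually_sequentiallyI)
      fix n assume "N j \<le> n"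
      then have "dist (X (r j)) (X (r n)) < (1 / 2) ^ j"
        using r(1)[of j] r(3)[of n] by (intro N) auto
      then show "(\<integral>\<^sup>+x. ennreal ((norm (f j x - f n x))\<^sup>2) \<partial>lebesgue) \<le> ennreal (((1 / 2) ^ j)\<^sup>2)"
        unfolding f_def nn_integral_L2_fun_diff
        by (intro ennreal_leI power_mono) (auto simp: dist_norm)
    qed
  qed
  have fg: "(\<lambda>x. f j x - g x) \<in> square_integrable" for j
    using close[of j] fm g(1) by (auto simp: square_integrable_iff_nn_integral intro: le_less_trans)
  have gs: "g \<in> square_integrable"
    using square_integrable_diff[OF f fg, of 0 0] by simp
  have le: "norm (X (r j) - L2_class g) \<le> (1 / 2) ^ j" for j
  proof -
    have "X (r j) - L2_class g = L2_class (\<lambda>x. f j x - g x)"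
      by (simp add: L2_class_diff[OF f gs]) (simp add: f_def)
    then have "ennreal ((norm (X (r j) - L2_class g))\<^sup>2) \<le> ennreal (((1 / 2) ^ j)\<^sup>2)"
      using close[of j] nn_integral_norm_square[OF fg[of j]] by simp
    then show ?thesis by (simp add: power2_le_iff_abs_le)
  qed
  have "X \<longlonglongrightarrow> L2_class g"
  proof (rule metric_LIMSEQ_I)
    fix e :: real assume "e > 0"
    then obtain j where j: "(1 / 2) ^ j < e / 2"
      using real_arch_pow_inv[of "e / 2" "1 / 2"] by auto
    show "\<exists>no. \<forall>n\<ge>no. dist (X n) (L2_class g) < e"
    proof (intro exI allI impI)
      fix n assume n: "N j \<le> n"
      have "dist (X n) (L2_class g) \<le> dist (X n) (X (r j)) + dist (X (r j)) (L2_class g)"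
        by (rule dist_triangle)
      also have "\<dots> < e" using N[OF n r(1)[of j]] le[of j] j by (simp add: dist_norm)
      finally show "dist (X n) (L2_class g) < e" .
    qed
  qed
  then show "convergent X" by (auto simp: convergent_def)
qed

lemma L2_AE_subsequence:
  assumes f: "\<And>n. f n \<in> square_integrable" and g: "g \<in> square_integrable"
    and lim: "(\<lambda>n. L2_class (f n)) \<longlonglongrightarrow> L2_class g"
  obtains r :: "nat \<Rightarrow> nat" where "strict_mono r" "AE x in lebesgue. (\<lambda>n. f (r n) x) \<longlonglongrightarrow> g x"
proof -
  have d: "(\<lambda>x. f n x - g x) \<in> square_integrable" for n by (intro square_integrable_diff f g)
  have "(\<lambda>n. \<integral>x. norm ((norm (f n x - g x))\<^sup>2) \<partial>lebesgue) = (\<lambda>n. (norm (L2_class (f n) - L2_class g))\<^sup>2)"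
    using norm_L2_class[OF d] by (simp add: L2_class_diff[OF f g])
  also have "\<dots> \<longlonglongrightarrow> 0\<^sup>2"
    using lim by (intro tendsto_power tendsto_norm_zero LIM_zero)
  finally have "\<exists>r::nat\<Rightarrow>nat. strict_mono r \<and> (AE x in lebesgue. (\<lambda>n. (norm (f (r n) x - g x))\<^sup>2) \<longlonglongrightarrow> 0)"
    using square_integrableD(2)[OF d] by (intro tendsto_L1_AE_subseq) simp_all
  then obtain r :: "nat \<Rightarrow> nat" where r: "strict_mono r"
    and ae: "AE x in lebesgue. (\<lambda>n. (norm (f (r n) x - g x))\<^sup>2) \<longlonglongrightarrow> 0" by blast
  from ae have "AE x in lebesgue. (\<lambda>n. f (r n) x) \<longlonglongrightarrow> g x"
  proof eventually_elim
    case (elim x)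
    have "(\<lambda>n. sqrt ((norm (f (r n) x - g x))\<^sup>2)) \<longlonglongrightarrow> sqrt 0" by (intro tendsto_real_sqrt elim)
    then show ?case by (simp add: tendsto_norm_zero_iff LIM_zero_iff)
  qed
  with r show ?thesis by (rule that)
qed


section \<open>Product and Gaussian integrals\<close>

lemma lborel_affine_integral:
  fixes f :: "'a::euclidean_space \<Rightarrow> 'b::{banach, second_countable_topology}" and t :: 'a
  assumes [measurable]: "f \<in> borel_measurable borel" and c: "c \<noteq> 0"
  shows "(\<integral>x. f x \<partial>lborel) = \<bar>c\<bar> ^ DIM('a) *\<^sub>R (\<integral>x. f (t + c *\<^sub>R x) \<partial>lborel)"
    and "integrable lborel (\<lambda>x. f (t + c *\<^sub>R x)) \<longleftrightarrow> integrable lborel f"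
proof -
  have "(\<integral>x. f x \<partial>lborel)
      = (\<integral>x. f x \<partial>density (distr lborel borel (\<lambda>x. t + c *\<^sub>R x)) (\<lambda>_. \<bar>c\<bar> ^ DIM('a)))"
    using lborel_affine[OF c, of t] by simp
  also have "\<dots> = \<bar>c\<bar> ^ DIM('a) *\<^sub>R (\<integral>x. f (t + c *\<^sub>R x) \<partial>lborel)"
    by (simp add: integral_density integral_distr)
  finally show "(\<integral>x. f x \<partial>lborel) = \<bar>c\<bar> ^ DIM('a) *\<^sub>R (\<integral>x. f (t + c *\<^sub>R x) \<partial>lborel)" .
  have "integrable lborel f
      \<longleftrightarrow> integrable (density (distr lborel borel (\<lambda>x. t + c *\<^sub>R x)) (\<lambda>_. \<bar>c\<bar> ^ DIM('a))) f"
    using lborel_affine[OF c, of t] by simp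
  also have "\<dots> \<longleftrightarrow> integrable lborel (\<lambda>x. f (t + c *\<^sub>R x))"
  proof -
    have iff: "integrable lborel (\<lambda>x. a *\<^sub>R g x) \<longleftrightarrow> integrable lborel g"
      if "a \<noteq> 0" for a and g :: "'a \<Rightarrow> 'b"
      using that integrable_scaleR_right[of a lborel g]
        integrable_scaleR_right[of "inverse a" lborel "\<lambda>x. a *\<^sub>R g x"] by auto
    show ?thesis using c by (simp add: integrable_density integrable_distr_eq iff)
  qed
  finally show "integrable lborel (\<lambda>x. f (t + c *\<^sub>R x)) \<longleftrightarrow> integrable lborel f" by simp
qed

lemma lborel_product_integral:
  fixes f :: "'a::euclidean_space \<Rightarrow> real \<Rightarrow> 'c::{real_normed_field, banach, second_countable_topology}"
  assumes int: "\<And>b. b \<in> Basis \<Longrightarrow> integrable lborel (f b)"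
  shows "integrable lborel (\<lambda>x. \<Prod>b\<in>Basis. f b (x \<bullet> b))"
    and "(\<integral>x. (\<Prod>b\<in>Basis. f b (x \<bullet> b)) \<partial>lborel) = (\<Prod>b\<in>Basis. (\<integral>t. f b t \<partial>lborel))"
proof -
  interpret product_sigma_finite "\<lambda>_ :: 'a. lborel :: real measure" ..
  have meas [measurable]: "f b \<in> borel_measurable borel" if "b \<in> Basis" for b
    using int[OF that] by auto
  have coord: "(\<Sum>b\<in>Basis. y b *\<^sub>R b) \<bullet> c = y c" if "c \<in> Basis" for y and c :: 'a
    using that by (simp add: inner_sum_left inner_Basis if_distrib sum.delta cong: if_cong)
  have prod_meas: "(\<lambda>x. \<Prod>b\<in>Basis. f b (x \<bullet> b)) \<in> borel_measurable borel"
    by (intro borel_measurable_prod) measurable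
  have map_meas: "(\<lambda>y. \<Sum>b\<in>Basis. y b *\<^sub>R b) \<in> (\<Pi>\<^sub>M b\<in>(Basis :: 'a set). lborel) \<rightarrow>\<^sub>M borel"
    by (intro borel_measurable_sum borel_measurable_scaleR) auto
  show "integrable lborel (\<lambda>x. \<Prod>b\<in>Basis. f b (x \<bullet> b))"
    by (subst lborel_eq, subst integrable_distr_eq[OF map_meas])
      (use prod_meas in \<open>simp_all add: coord product_integrable_prod int\<close>)
  show "(\<integral>x. (\<Prod>b\<in>Basis. f b (x \<bullet> b)) \<partial>lborel) = (\<Prod>b\<in>Basis. (\<integral>t. f b t \<partial>lborel))"
    by (subst lborel_eq, subst integral_distr[OF map_meas])
      (use prod_meas in \<open>simp_all add: coord product_integral_prod int\<close>)
qed

lemma cis_sum: "finite A \<Longrightarrow> cis (\<Sum>a\<in>A. f a) = (\<Prod>a\<in>A. cis (f a))"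
  by (induction A rule: finite_induct) (auto simp flip: cis_mult)

lemma cis_measurable [measurable (raw)]:
  "f \<in> borel_measurable M \<Longrightarrow> (\<lambda>x. cis (f x)) \<in> borel_measurable M"
  by (rule borel_measurable_continuous_on[where f=cis]) (intro continuous_intros)

lemma cnj_measurable [measurable (raw)]:
  "f \<in> borel_measurable M \<Longrightarrow> (\<lambda>x. cnj (f x)) \<in> borel_measurable M"
  by (rule borel_measurable_continuous_on[where f=cnj]) (intro continuous_intros)

definition gauss :: "'a::euclidean_space \<Rightarrow> real" where
  "gauss x = exp (- (norm x)\<^sup>2 / 2)"

lemma gauss_pos: "0 < gauss x" and gauss_le_1: "gauss x \<le> 1"
  by (auto simp: gauss_def)

lemma gauss_measurable [measurable]: "gauss \<in> borel_measurable borel"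
  unfolding gauss_def[abs_def] by measurable

lemma gauss_prod: "gauss (x :: 'a::euclidean_space) = (\<Prod>b\<in>Basis. exp (- (x \<bullet> b)\<^sup>2 / 2))"
proof -
  have "(norm x)\<^sup>2 = (\<Sum>b\<in>Basis. (x \<bullet> b)\<^sup>2)"
    unfolding power2_norm_eq_inner by (subst euclidean_inner) (simp add: power2_eq_square)
  then show ?thesis
    unfolding gauss_def by (simp add: exp_sum[symmetric] sum_negf sum_divide_distrib)
qed

text \<open>This is the characteristic function of the standard normal distribution.\<close>

lemma gauss_fourier_1:
  fixes x :: real
  shows "integrable lborel (\<lambda>t. complex_of_real (exp (- t\<^sup>2 / 2)) * cis (t * x))"
    and "(\<integral>t. complex_of_real (exp (- t\<^sup>2 / 2)) * cis (t * x) \<partial>lborel)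
      = complex_of_real (sqrt (2 * pi) * exp (- x\<^sup>2 / 2))"
proof -
  have i: "integrable lborel (\<lambda>t::real. exp (- t\<^sup>2 / 2))"
    using integrable_mult_right[of "sqrt (2 * pi)" lborel std_normal_density] integrable_normal_density[of 1 0]
    by (simp add: std_normal_density_def)
  show "integrable lborel (\<lambda>t. complex_of_real (exp (- t\<^sup>2 / 2)) * cis (t * x))"
    by (rule Bochner_Integration.integrable_bound[OF i]) (auto simp: norm_mult)
  have "complex_of_real (exp (- (x\<^sup>2) / 2)) = char std_normal_distribution x"
    by (simp add: char_std_normal_distribution)
  also have "\<dots> = (\<integral>t. std_normal_density t *\<^sub>R iexp (x * t) \<partial>lborel)"
    unfolding char_def by (subst integral_density) auto
  also have "\<dots> = (\<integral>t. complex_of_real (1 / sqrt (2 * pi)) * (complex_of_real (exp (- t\<^sup>2 / 2)) * cis (t * x)) \<partial>lborel)"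
    by (intro Bochner_Integration.integral_cong)
      (auto simp: std_normal_density_def scaleR_conv_of_real cis_conv_exp mult.commute)
  also have "\<dots> = complex_of_real (1 / sqrt (2 * pi)) * (\<integral>t. complex_of_real (exp (- t\<^sup>2 / 2)) * cis (t * x) \<partial>lborel)"
    by (rule integral_mult_right_zero)
  finally show "(\<integral>t. complex_of_real (exp (- t\<^sup>2 / 2)) * cis (t * x) \<partial>lborel)
      = complex_of_real (sqrt (2 * pi) * exp (- x\<^sup>2 / 2))"
    by (simp add: field_simps)
qed

lemma gauss_fourier:
  fixes x :: "'a::euclidean_space"
  shows "integrable lborel (\<lambda>t. complex_of_real (gauss t) * cis (t \<bullet> x))"
    and "(\<integral>t. complex_of_real (gauss t) * cis (t \<bullet> x) \<partial>lborel)
      = complex_of_real (sqrt (2 * pi) ^ DIM('a) * gauss x)"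
proof -
  have e: "complex_of_real (gauss t) * cis (t \<bullet> x)
      = (\<Prod>b\<in>Basis. complex_of_real (exp (- (t \<bullet> b)\<^sup>2 / 2)) * cis ((t \<bullet> b) * (x \<bullet> b)))" for t
    by (simp add: gauss_prod euclidean_inner[of t x] cis_sum prod.distrib)
  show "integrable lborel (\<lambda>t. complex_of_real (gauss t) * cis (t \<bullet> x))"
    unfolding e
    by (rule lborel_product_integral(1)[of "\<lambda>b s. complex_of_real (exp (- s\<^sup>2 / 2)) * cis (s * (x \<bullet> b))"])
      (rule gauss_fourier_1)
  show "(\<integral>t. complex_of_real (gauss t) * cis (t \<bullet> x) \<partial>lborel)
      = complex_of_real (sqrt (2 * pi) ^ DIM('a) * gauss x)"
    unfolding e
    by (subst lborel_product_integral(2)[of "\<lambda>b s. complex_of_real (exp (- s\<^sup>2 / 2)) * cis (s * (x \<bullet> b))"])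
      (simp_all only: gauss_fourier_1 gauss_prod of_real_mult of_real_prod prod.distrib prod_constant of_real_power)
qed

lemma gauss_integrable: "integrable lborel (gauss :: 'a::euclidean_space \<Rightarrow> real)"
  and gauss_integral: "(\<integral>x. gauss (x :: 'a) \<partial>lborel) = sqrt (2 * pi) ^ DIM('a::euclidean_space)"
proof -
  have c: "integrable lborel (\<lambda>t :: 'a. complex_of_real (gauss t))"
    using gauss_fourier(1)[of 0] by simp
  then show "integrable lborel (gauss :: 'a \<Rightarrow> real)" by (simp only: complex_of_real_integrable_eq)
  have "complex_of_real (\<integral>x. gauss (x :: 'a) \<partial>lborel) = complex_of_real (sqrt (2 * pi) ^ DIM('a))"
    using gauss_fourier(2)[of "0 :: 'a"] by (simp add: gauss_def)
  then show "(\<integral>x. gauss (x :: 'a) \<partial>lborel) = sqrt (2 * pi) ^ DIM('a)" by (simp only: of_real_eq_iff)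
qed

lemma gauss_scaled_fourier:
  fixes x :: "'a::euclidean_space"
  assumes e: "e > 0"
  shows "integrable lborel (\<lambda>t. complex_of_real (gauss (e *\<^sub>R t)) * cis (t \<bullet> x))"
    and "(\<integral>t. complex_of_real (gauss (e *\<^sub>R t)) * cis (t \<bullet> x) \<partial>lborel)
      = complex_of_real ((sqrt (2 * pi) / e) ^ DIM('a) * gauss ((1 / e) *\<^sub>R x))"
proof -
  let ?f = "\<lambda>t. complex_of_real (gauss t) * cis (t \<bullet> ((1 / e) *\<^sub>R x))"
  have m: "?f \<in> borel_measurable borel" by measurable
  have eq: "?f (0 + e *\<^sub>R t) = complex_of_real (gauss (e *\<^sub>R t)) * cis (t \<bullet> x)" for t
    using e by simp
  show "integrable lborel (\<lambda>t. complex_of_real (gauss (e *\<^sub>R t)) * cis (t \<bullet> x))"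
    using lborel_affine_integral(2)[OF m, of e 0] gauss_fourier(1)[of "(1 / e) *\<^sub>R x"] e
    unfolding eq by simp
  have "complex_of_real (sqrt (2 * pi) ^ DIM('a) * gauss ((1 / e) *\<^sub>R x))
      = \<bar>e\<bar> ^ DIM('a) *\<^sub>R (\<integral>t. complex_of_real (gauss (e *\<^sub>R t)) * cis (t \<bullet> x) \<partial>lborel)"
    using lborel_affine_integral(1)[OF m, of e 0] gauss_fourier(2)[of "(1 / e) *\<^sub>R x"] e
    unfolding eq by simp
  then show "(\<integral>t. complex_of_real (gauss (e *\<^sub>R t)) * cis (t \<bullet> x) \<partial>lborel)
      = complex_of_real ((sqrt (2 * pi) / e) ^ DIM('a) * gauss ((1 / e) *\<^sub>R x))"
    using e by (simp add: scaleR_conv_of_real power_divide field_simps)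
qed


section \<open>The Fourier integral\<close>

text \<open>The unnormalised integral, for Borel functions. The sign \<open>\<sigma> = \<plusminus> 1\<close> is a parameter because the transform
  and its inverse are treated alike.\<close>

definition fourier_integral :: "real \<Rightarrow> ('a::euclidean_space \<Rightarrow> complex) \<Rightarrow> 'a \<Rightarrow> complex" where
  "fourier_integral \<sigma> f \<xi> = (\<integral>x. f x * cis (\<sigma> * (\<xi> \<bullet> x)) \<partial>lborel)"

lemma integrable_times_cis:
  assumes "integrable lborel f" "g \<in> borel_measurable borel"
  shows "integrable lborel (\<lambda>x. f x * cis (g x))"
  by (rule Bochner_Integration.integrable_bound[OF integrable_norm[OF assms(1)]])
    (use assms in \<open>auto simp: norm_mult\<close>)

lemma fourier_integral_measurable [measurable]:
  assumes [measurable]: "f \<in> borel_measurable borel"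
  shows "fourier_integral \<sigma> f \<in> borel_measurable borel"
  unfolding fourier_integral_def[abs_def] by measurable

lemma fourier_integral_bound:
  assumes "integrable lborel f"
  shows "norm (fourier_integral \<sigma> f \<xi>) \<le> (\<integral>x. norm (f x) \<partial>lborel)"
proof -
  have "norm (fourier_integral \<sigma> f \<xi>) \<le> (\<integral>x. norm (f x * cis (\<sigma> * (\<xi> \<bullet> x))) \<partial>lborel)"
    unfolding fourier_integral_def by (rule integral_norm_bound)
  then show ?thesis by (simp add: norm_mult)
qed

lemma fourier_integral_diff:
  assumes "integrable lborel f" "integrable lborel g"
  shows "fourier_integral \<sigma> (\<lambda>x. f x - g x) \<xi> = fourier_integral \<sigma> f \<xi> - fourier_integral \<sigma> g \<xi>"
  using assms unfolding fourier_integral_def left_diff_distrib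
  by (intro Bochner_Integration.integral_diff integrable_times_cis) auto

text \<open>The multiplication formula: by Fubini, both sides are the double integral of \<open>f x g y cis (\<sigma> x \<bullet> y)\<close>.\<close>

lemma fourier_integral_multiplication:
  fixes f g :: "'a::euclidean_space \<Rightarrow> complex"
  assumes f: "integrable lborel f" and g: "integrable lborel g"
  shows "integrable lborel (\<lambda>x. f x * fourier_integral \<sigma> g x)"
    and "(\<integral>x. f x * fourier_integral \<sigma> g x \<partial>lborel) = (\<integral>x. fourier_integral \<sigma> f x * g x \<partial>lborel)"
proof -
  have [measurable]: "f \<in> borel_measurable borel" "g \<in> borel_measurable borel" using f g by auto
  let ?k = "\<lambda>(x, y). f x * g y * cis (\<sigma> * (x \<bullet> y))"
  have k: "integrable (lborel \<Otimes>\<^sub>M lborel) ?k"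
  proof (rule lborel_pair.Fubini_integrable)
    show "?k \<in> borel_measurable (lborel \<Otimes>\<^sub>M lborel)" by measurable
    show "AE x in lborel. integrable lborel (\<lambda>y. ?k (x, y))"
      using integrable_times_cis[OF integrable_mult_right[OF g]] by simp
    have "integrable lborel (\<lambda>x. norm (f x) * (\<integral>y. norm (g y) \<partial>lborel))"
      using f by (intro integrable_mult_left integrable_norm)
    then show "integrable lborel (\<lambda>x. \<integral>y. norm (?k (x, y)) \<partial>lborel)"
      by (simp add: norm_mult)
  qed
  have 1: "(\<integral>y. ?k (x, y) \<partial>lborel) = f x * fourier_integral \<sigma> g x" for x
    unfolding fourier_integral_def by (simp add: mult.assoc)
  have 2: "(\<integral>x. ?k (x, y) \<partial>lborel) = fourier_integral \<sigma> f y * g y" for y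
    unfolding fourier_integral_def
    by (subst integral_mult_left_zero[symmetric]) (simp add: inner_commute mult_ac)
  show "integrable lborel (\<lambda>x. f x * fourier_integral \<sigma> g x)"
    using lborel_pair.integrable_fst'[OF k] unfolding 1 .
  show "(\<integral>x. f x * fourier_integral \<sigma> g x \<partial>lborel) = (\<integral>x. fourier_integral \<sigma> f x * g x \<partial>lborel)"
    using lborel_pair.Fubini_integral[of "\<lambda>x y. ?k (x, y)"] k unfolding 1 2 by simp
qed

text \<open>The weighted integral of \<open>|F f|\<^sup>2\<close> is the integral of \<open>F f\<close> against \<open>h = cnj (F f) G\<close> with a Gaussian
  \<open>G\<close>. By the multiplication formula the transform can be moved to \<open>h\<close>, whose transform is the conjugate
  of \<open>f\<close> averaged over a Gaussian of width \<open>e\<close>.\<close>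

lemma fourier_integral_gauss_weighted:
  fixes f :: "'a::euclidean_space \<Rightarrow> complex"
  assumes f: "integrable lborel f" and e: "e > 0" and \<sigma>: "\<bar>\<sigma>\<bar> = 1"
  shows "integrable lborel (\<lambda>\<xi>. (norm (fourier_integral \<sigma> f \<xi>))\<^sup>2 * gauss (e *\<^sub>R \<xi>))"
    and "complex_of_real (\<integral>\<xi>. (norm (fourier_integral \<sigma> f \<xi>))\<^sup>2 * gauss (e *\<^sub>R \<xi>) \<partial>lborel)
      = complex_of_real (sqrt (2 * pi) ^ DIM('a)) *
        (\<integral>x. f x * (\<integral>z. cnj (f (x + e *\<^sub>R z)) * complex_of_real (gauss z) \<partial>lborel) \<partial>lborel)"
proof -
  have [measurable]: "f \<in> borel_measurable borel" using f by auto
  define G where "G \<xi> = complex_of_real (gauss (e *\<^sub>R \<xi>))" for \<xi> :: 'a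
  have [measurable]: "G \<in> borel_measurable borel" unfolding G_def[abs_def] by measurable
  have G: "integrable lborel G"
    using gauss_scaled_fourier(1)[OF e, of 0] by (simp add: G_def[abs_def])
  define h where "h \<xi> = cnj (fourier_integral \<sigma> f \<xi>) * G \<xi>" for \<xi>
  have [measurable]: "h \<in> borel_measurable borel" unfolding h_def[abs_def] by measurable
  define C where "C = (\<integral>x. norm (f x) \<partial>lborel)"
  have h: "integrable lborel h"
  proof (rule Bochner_Integration.integrable_bound)
    show "integrable lborel (\<lambda>\<xi>. C * norm (G \<xi>))" using G by (intro integrable_mult_right integrable_norm)
    have "0 \<le> C" by (simp add: C_def)
    then show "AE \<xi> in lborel. norm (h \<xi>) \<le> norm (C * norm (G \<xi>))"
      using fourier_integral_bound[OF f, of \<sigma>] by (simp add: h_def norm_mult C_def mult_right_mono)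
  qed measurable
  have sq: "fourier_integral \<sigma> f \<xi> * h \<xi> = complex_of_real ((norm (fourier_integral \<sigma> f \<xi>))\<^sup>2 * gauss (e *\<^sub>R \<xi>))" for \<xi>
    by (simp add: h_def G_def mult.assoc[symmetric] flip: complex_norm_square)
  have "integrable lborel (\<lambda>\<xi>. h \<xi> * fourier_integral \<sigma> f \<xi>)"
    by (rule fourier_integral_multiplication(1)[OF h f])
  then have "integrable lborel (\<lambda>\<xi>. complex_of_real ((norm (fourier_integral \<sigma> f \<xi>))\<^sup>2 * gauss (e *\<^sub>R \<xi>)))"
    unfolding sq[symmetric] by (simp add: mult.commute)
  then show "integrable lborel (\<lambda>\<xi>. (norm (fourier_integral \<sigma> f \<xi>))\<^sup>2 * gauss (e *\<^sub>R \<xi>))"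
    unfolding complex_of_real_integrable_eq .
  have fh: "fourier_integral \<sigma> h x
      = complex_of_real (sqrt (2 * pi) ^ DIM('a)) * (\<integral>z. cnj (f (x + e *\<^sub>R z)) * complex_of_real (gauss z) \<partial>lborel)" for x
  proof -
    let ?k = "\<lambda>\<xi>. G \<xi> * cis (- (\<sigma> * (x \<bullet> \<xi>)))"
    have k: "integrable lborel ?k" using G by (intro integrable_times_cis) auto
    have fk: "fourier_integral \<sigma> ?k y = complex_of_real ((sqrt (2 * pi) / e) ^ DIM('a) * gauss ((1 / e) *\<^sub>R (y - x)))" for y
    proof -
      have "fourier_integral \<sigma> ?k y = (\<integral>\<xi>. G \<xi> * cis (\<xi> \<bullet> (\<sigma> *\<^sub>R (y - x))) \<partial>lborel)"
        unfolding fourier_integral_def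
        by (intro Bochner_Integration.integral_cong refl)
          (simp add: mult.assoc cis_mult inner_commute inner_diff_right algebra_simps)
      also have "\<dots> = complex_of_real ((sqrt (2 * pi) / e) ^ DIM('a) * gauss ((1 / e) *\<^sub>R \<sigma> *\<^sub>R (y - x)))"
        unfolding G_def by (rule gauss_scaled_fourier(2)[OF e])
      also have "gauss ((1 / e) *\<^sub>R \<sigma> *\<^sub>R (y - x)) = gauss ((1 / e) *\<^sub>R (y - x))"
        using \<sigma> by (simp add: gauss_def)
      finally show ?thesis .
    qed
    have "cnj (fourier_integral \<sigma> h x) = (\<integral>\<xi>. cnj (h \<xi> * cis (\<sigma> * (x \<bullet> \<xi>))) \<partial>lborel)"
      unfolding fourier_integral_def by (rule Bochner_Integration.integral_cnj[symmetric])
    also have "\<dots> = (\<integral>\<xi>. fourier_integral \<sigma> f \<xi> * ?k \<xi> \<partial>lborel)"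
      by (simp add: h_def G_def cis_cnj mult.assoc)
    also have "\<dots> = (\<integral>y. f y * fourier_integral \<sigma> ?k y \<partial>lborel)"
      by (rule fourier_integral_multiplication(2)[OF f k, symmetric])
    also have "\<dots> = (\<integral>y. f y * complex_of_real ((sqrt (2 * pi) / e) ^ DIM('a) * gauss ((1 / e) *\<^sub>R (y - x))) \<partial>lborel)"
      unfolding fk ..
    also have "\<dots> = \<bar>e\<bar> ^ DIM('a) *\<^sub>R (\<integral>z. f (x + e *\<^sub>R z)
        * complex_of_real ((sqrt (2 * pi) / e) ^ DIM('a) * gauss ((1 / e) *\<^sub>R (x + e *\<^sub>R z - x))) \<partial>lborel)"
      using e by (intro lborel_affine_integral(1)) auto
    also have "\<dots> = complex_of_real (e ^ DIM('a)) * (\<integral>z. complex_of_real ((sqrt (2 * pi) / e) ^ DIM('a))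
        * (f (x + e *\<^sub>R z) * complex_of_real (gauss z)) \<partial>lborel)"
      using e by (simp add: scaleR_conv_of_real mult_ac)
    also have "\<dots> = complex_of_real (sqrt (2 * pi) ^ DIM('a))
        * (\<integral>z. f (x + e *\<^sub>R z) * complex_of_real (gauss z) \<partial>lborel)"
      unfolding integral_mult_right_zero using e by (simp add: power_divide)
    finally have "fourier_integral \<sigma> h x = cnj (complex_of_real (sqrt (2 * pi) ^ DIM('a))
        * (\<integral>z. f (x + e *\<^sub>R z) * complex_of_real (gauss z) \<partial>lborel))"
      by (metis complex_cnj_cnj)
    then show ?thesis by (simp flip: Bochner_Integration.integral_cnj)
  qed
  have "complex_of_real (\<integral>\<xi>. (norm (fourier_integral \<sigma> f \<xi>))\<^sup>2 * gauss (e *\<^sub>R \<xi>) \<partial>lborel)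
      = (\<integral>\<xi>. fourier_integral \<sigma> f \<xi> * h \<xi> \<partial>lborel)"
    unfolding sq by (rule integral_complex_of_real[symmetric])
  also have "\<dots> = (\<integral>x. f x * fourier_integral \<sigma> h x \<partial>lborel)"
    by (rule fourier_integral_multiplication(2)[OF f h, symmetric])
  also have "\<dots> = (\<integral>x. complex_of_real (sqrt (2 * pi) ^ DIM('a)) *
      (f x * (\<integral>z. cnj (f (x + e *\<^sub>R z)) * complex_of_real (gauss z) \<partial>lborel)) \<partial>lborel)"
    unfolding fh by (simp add: mult_ac)
  finally show "complex_of_real (\<integral>\<xi>. (norm (fourier_integral \<sigma> f \<xi>))\<^sup>2 * gauss (e *\<^sub>R \<xi>) \<partial>lborel)
      = complex_of_real (sqrt (2 * pi) ^ DIM('a)) *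
        (\<integral>x. f x * (\<integral>z. cnj (f (x + e *\<^sub>R z)) * complex_of_real (gauss z) \<partial>lborel) \<partial>lborel)"
    by (simp only: integral_mult_right_zero)
qed

text \<open>Letting the width \<open>e\<close> in \<open>fourier_integral_gauss_weighted\<close> tend to \<open>0\<close>, the weights increase to \<open>1\<close> on
  the frequency side (monotone convergence), while on the other side the Gaussian averages of \<open>cnj f\<close>
  tend to \<open>cnj f\<close> by continuity (dominated convergence).\<close>

lemma parseval_continuous:
  fixes f :: "'a::euclidean_space \<Rightarrow> complex"
  assumes cont: "continuous_on UNIV f" and supp: "\<And>x. norm x > R \<Longrightarrow> f x = 0" and \<sigma>: "\<bar>\<sigma>\<bar> = 1"
  shows "integrable lborel (\<lambda>\<xi>. (norm (fourier_integral \<sigma> f \<xi>))\<^sup>2)"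
    and "(\<integral>\<xi>. (norm (fourier_integral \<sigma> f \<xi>))\<^sup>2 \<partial>lborel) = (2 * pi) ^ DIM('a) * (\<integral>x. (norm (f x))\<^sup>2 \<partial>lborel)"
proof -
  have [measurable]: "f \<in> borel_measurable borel" using cont by (rule borel_measurable_continuous_onI)
  have "bounded (f ` cball 0 R)"
    using cont by (intro compact_imp_bounded compact_continuous_image continuous_on_subset[OF cont]) auto
  then obtain M where "M > 0" "\<forall>y\<in>f ` cball 0 R. norm y \<le> M" unfolding bounded_pos by blast
  then have M: "\<And>x. x \<in> cball 0 R \<Longrightarrow> norm (f x) \<le> M" "M > 0" by blast+
  have fM: "norm (f x) \<le> M" for x using M(1)[of x] M(2) supp[of x] by (cases "norm x > R") auto
  have f: "integrable lborel f"
  proof (rule Bochner_Integration.integrable_bound)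
    show "integrable lborel (\<lambda>x. indicator (cball 0 R :: 'a set) x * M)"
      using emeasure_bounded_finite[OF bounded_cball[of "0 :: 'a" R]]
      by (intro integrable_mult_left integrable_real_indicator) auto
    show "AE x in lborel. norm (f x) \<le> norm (indicator (cball 0 R :: 'a set) x * M)"
      using fM supp M(2) by (intro AE_I2) (auto simp: indicator_def)
  qed measurable
  define e where "e n = inverse (real (Suc n))" for n
  have e: "e n > 0" "e \<longlonglongrightarrow> 0" for n
    using LIMSEQ_inverse_real_of_nat by (auto simp: e_def[abs_def])
  have e_mono: "e (Suc n) \<le> e n" for n by (simp add: e_def)
  let ?F = "\<lambda>\<xi>. (norm (fourier_integral \<sigma> f \<xi>))\<^sup>2"
  define k where "k n p = f (fst p) * (cnj (f (fst p + e n *\<^sub>R snd p)) * complex_of_real (gauss (snd p)))"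
    for n and p :: "'a \<times> 'a"
  define k0 where "k0 p = f (fst p) * (cnj (f (fst p)) * complex_of_real (gauss (snd p)))"
    for p :: "'a \<times> 'a"
  define w where "w p = norm (f (fst p)) * M * gauss (snd p)" for p :: "'a \<times> 'a"
  have dom: "integrable (lborel \<Otimes>\<^sub>M lborel) w"
  proof (rule lborel_pair.Fubini_integrable)
    show "AE x in lborel. integrable lborel (\<lambda>z. w (x, z))"
      using gauss_integrable by (auto simp: w_def)
    show "integrable lborel (\<lambda>x. \<integral>z. norm (w (x, z)) \<partial>lborel)"
      using f M(2) by (simp add: w_def abs_mult)
    show "w \<in> borel_measurable (lborel \<Otimes>\<^sub>M lborel)" unfolding w_def[abs_def] by measurable
  qed
  have bound: "norm (k n p) \<le> w p" for n p
  proof -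
    have "norm (f (fst p)) * norm (f (fst p + e n *\<^sub>R snd p)) * gauss (snd p) \<le> w p"
      unfolding w_def by (intro mult_right_mono mult_left_mono fM) (use gauss_pos[of "snd p"] in auto)
    then show ?thesis using gauss_pos[of "snd p"] by (simp add: k_def norm_mult mult.assoc)
  qed
  have km: "k n \<in> borel_measurable (lborel \<Otimes>\<^sub>M lborel)" "k0 \<in> borel_measurable (lborel \<Otimes>\<^sub>M lborel)" for n
    unfolding k_def[abs_def] k0_def[abs_def] by measurable
  (* This is where continuity of f enters. *)
  have k_lim: "(\<lambda>n. k n p) \<longlonglongrightarrow> k0 p" for p
  proof -
    obtain x z where p: "p = (x, z)" by (cases p)
    have "(\<lambda>n. x + e n *\<^sub>R z) \<longlonglongrightarrow> x + 0 *\<^sub>R z" by (intro tendsto_intros e)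
    moreover have "isCont f x" using cont by (simp add: continuous_on_eq_continuous_at)
    ultimately have "(\<lambda>n. f (x + e n *\<^sub>R z)) \<longlonglongrightarrow> f x" by (auto intro: isCont_tendsto_compose)
    then show ?thesis unfolding p k_def k0_def by (auto intro!: tendsto_intros)
  qed
  have kint: "integrable (lborel \<Otimes>\<^sub>M lborel) (k n)" for n
    by (rule Bochner_Integration.integrable_bound[OF dom km(1)])
      (auto intro!: AE_I2 order_trans[OF bound])
  have k0int: "integrable (lborel \<Otimes>\<^sub>M lborel) k0"
    by (rule integrable_dominated_convergence[where s="k" and w=w])
      (use dom km k_lim bound in auto)
  have "(\<lambda>n. integral\<^sup>L (lborel \<Otimes>\<^sub>M lborel) (k n)) \<longlonglongrightarrow> integral\<^sup>L (lborel \<Otimes>\<^sub>M lborel) k0"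
    by (rule integral_dominated_convergence[where w=w])
      (use dom km k_lim bound in auto)
  moreover have "integral\<^sup>L (lborel \<Otimes>\<^sub>M lborel) (k n)
      = (\<integral>x. f x * (\<integral>z. cnj (f (x + e n *\<^sub>R z)) * complex_of_real (gauss z) \<partial>lborel) \<partial>lborel)" for n
    using lborel_pair.integral_fst'[OF kint[of n]] by (simp add: k_def)
  moreover have "integral\<^sup>L (lborel \<Otimes>\<^sub>M lborel) k0
      = complex_of_real (sqrt (2 * pi) ^ DIM('a)) * complex_of_real (\<integral>x. (norm (f x))\<^sup>2 \<partial>lborel)"
  proof -
    have "integral\<^sup>L (lborel \<Otimes>\<^sub>M lborel) k0 = (\<integral>x. \<integral>z. k0 (x, z) \<partial>lborel \<partial>lborel)"
      by (rule lborel_pair.integral_fst'[OF k0int, symmetric])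
    also have "(\<lambda>x. \<integral>z. k0 (x, z) \<partial>lborel)
        = (\<lambda>x. complex_of_real ((norm (f x))\<^sup>2) * complex_of_real (\<integral>z. gauss (z :: 'a) \<partial>lborel))"
      by (simp add: k0_def mult.assoc[symmetric] flip: complex_norm_square)
    finally show ?thesis
      by (simp only: gauss_integral integral_mult_left_zero integral_complex_of_real mult.commute)
  qed
  ultimately have "(\<lambda>n. complex_of_real (\<integral>\<xi>. ?F \<xi> * gauss (e n *\<^sub>R \<xi>) \<partial>lborel))
      \<longlonglongrightarrow> complex_of_real (sqrt (2 * pi) ^ DIM('a))
        * (complex_of_real (sqrt (2 * pi) ^ DIM('a)) * complex_of_real (\<integral>x. (norm (f x))\<^sup>2 \<partial>lborel))"
    unfolding fourier_integral_gauss_weighted(2)[OF f e(1) \<sigma>] by (intro tendsto_intros) simp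
  also have "complex_of_real (sqrt (2 * pi) ^ DIM('a))
        * (complex_of_real (sqrt (2 * pi) ^ DIM('a)) * complex_of_real (\<integral>x. (norm (f x))\<^sup>2 \<partial>lborel))
      = complex_of_real ((sqrt (2 * pi) * sqrt (2 * pi)) ^ DIM('a) * (\<integral>x. (norm (f x))\<^sup>2 \<partial>lborel))"
    by (simp only: power_mult_distrib of_real_mult mult.assoc)
  also have "sqrt (2 * pi) * sqrt (2 * pi) = 2 * pi" by simp
  finally have lim: "(\<lambda>n. \<integral>\<xi>. ?F \<xi> * gauss (e n *\<^sub>R \<xi>) \<partial>lborel)
      \<longlonglongrightarrow> (2 * pi) ^ DIM('a) * (\<integral>x. (norm (f x))\<^sup>2 \<partial>lborel)"
    by (simp only: tendsto_of_real_iff)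
  have mono: "mono (\<lambda>n. ?F \<xi> * gauss (e n *\<^sub>R \<xi>))" for \<xi>
  proof (intro incseq_SucI mult_left_mono)
    fix n
    have "(e (Suc n) * norm \<xi>)\<^sup>2 \<le> (e n * norm \<xi>)\<^sup>2"
      using e(1)[of "Suc n"] e(1)[of n] e_mono[of n] by (intro power_mono mult_right_mono) auto
    then show "gauss (e n *\<^sub>R \<xi>) \<le> gauss (e (Suc n) *\<^sub>R \<xi>)"
      using e(1)[of "Suc n"] e(1)[of n] by (simp add: gauss_def)
  qed auto
  have pt: "(\<lambda>n. ?F \<xi> * gauss (e n *\<^sub>R \<xi>)) \<longlonglongrightarrow> ?F \<xi>" for \<xi>
  proof -
    have "(\<lambda>n. ?F \<xi> * gauss (e n *\<^sub>R \<xi>)) \<longlonglongrightarrow> ?F \<xi> * exp (- (norm (0 *\<^sub>R \<xi>))\<^sup>2 / 2)"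
      unfolding gauss_def by (intro tendsto_intros e) auto
    then show ?thesis by simp
  qed
  show "integrable lborel ?F"
    by (rule integrable_monotone_convergence[where f="\<lambda>n \<xi>. ?F \<xi> * gauss (e n *\<^sub>R \<xi>)", OF _ _ _ lim])
      (use mono pt fourier_integral_gauss_weighted(1)[OF f e(1) \<sigma>] in auto)
  show "integral\<^sup>L lborel ?F = (2 * pi) ^ DIM('a) * (\<integral>x. (norm (f x))\<^sup>2 \<partial>lborel)"
    by (rule integral_monotone_convergence[where f="\<lambda>n \<xi>. ?F \<xi> * gauss (e n *\<^sub>R \<xi>)", OF _ _ _ lim])
      (use mono pt fourier_integral_gauss_weighted(1)[OF f e(1) \<sigma>] in auto)
qed

section \<open>Density of continuous functions\<close>

lemma clamp_norm_le:
  fixes w :: "'b::real_normed_vector"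
  assumes "M > 0"
  shows "norm (w /\<^sub>R max 1 (norm w / M)) \<le> M"
proof -
  have "norm w \<le> M * max 1 (norm w / M)"
    using assms by (simp add: max_mult_distrib_left)
  then show ?thesis
    by (simp add: pos_divide_le_eq divide_inverse[symmetric] mult.commute[of _ "norm w"] max_def split: if_splits)
qed

lemma bounded_support_integrable:
  fixes f :: "'a::euclidean_space \<Rightarrow> 'b::{banach, second_countable_topology}"
  assumes [measurable]: "f \<in> borel_measurable borel"
    and le: "\<And>x. norm (f x) \<le> K * indicator (cball 0 R) x"
  shows "integrable lborel f" "integrable lborel (\<lambda>x. (norm (f x))\<^sup>2)"
proof -
  have fin: "emeasure lborel (cball (0 :: 'a) R) < \<infinity>" by (rule emeasure_bounded_finite) simp
  have ind: "integrable lborel (\<lambda>x. C * indicator (cball (0 :: 'a) R) x)" for C :: real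
    using fin by (intro integrable_mult_right integrable_real_indicator) auto
  show "integrable lborel f"
    by (rule Bochner_Integration.integrable_bound[OF ind[of K]])
      (use order_trans[OF le abs_ge_self] in auto)
  have "(norm (f x))\<^sup>2 \<le> K\<^sup>2 * indicator (cball 0 R) x" for x
    using power_mono[OF le[of x], of 2] by (auto simp: indicator_def split: if_splits)
  from order_trans[OF this abs_ge_self] show "integrable lborel (\<lambda>x. (norm (f x))\<^sup>2)"
    by (intro Bochner_Integration.integrable_bound[OF ind[of "K\<^sup>2"]]) auto
qed

text \<open>A measurable function is an almost everywhere limit of continuous functions \<open>h n\<close>. Clamping these to
  norm \<open>\<le> M\<close> and multiplying by a continuous cutoff makes the convergence dominated.\<close>

lemma bounded_support_continuous_approximation:
  fixes f :: "'a::euclidean_space \<Rightarrow> complex"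
  assumes meas: "f \<in> borel_measurable borel" and M: "M > 0" and bound: "\<And>x. norm (f x) \<le> M"
    and supp: "\<And>x. norm x > R \<Longrightarrow> f x = 0"
  obtains g where "\<And>n. continuous_on UNIV (g n)" "\<And>n x. norm x > R + 1 \<Longrightarrow> g n x = (0 :: complex)"
    "(\<lambda>n. \<integral>x. norm (g n x - f x) \<partial>lborel) \<longlonglongrightarrow> 0" "(\<lambda>n. \<integral>x. (norm (g n x - f x))\<^sup>2 \<partial>lborel) \<longlonglongrightarrow> 0"
proof -
  have "f measurable_on UNIV"
    by (rule lebesgue_measurable_imp_measurable_on) (simp_all add: measurable_completion meas)
  then obtain N h where N: "negligible N" and h: "\<And>n. continuous_on UNIV (h n)"
    and lim: "\<And>x. x \<notin> N \<Longrightarrow> (\<lambda>n. h n x) \<longlonglongrightarrow> f x"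
    unfolding measurable_on_def by auto
  define c where "c x = max 0 (min 1 (R + 1 - norm x))" for x :: 'a
  define g where "g n x = c x *\<^sub>R (h n x /\<^sub>R max 1 (norm (h n x) / M))" for n x
  have c: "0 \<le> c x" "c x \<le> 1" "norm x \<le> R \<Longrightarrow> c x = 1" "norm x > R + 1 \<Longrightarrow> c x = 0" for x
    by (auto simp: c_def)
  have g_cont: "continuous_on UNIV (g n)" for n
    unfolding g_def[abs_def] c_def[abs_def] using M
    by (intro continuous_intros h) auto
  have g_supp: "g n x = 0" if "norm x > R + 1" for n x using c(4)[OF that] by (simp add: g_def)
  have g_bound: "norm (g n x) \<le> M" for n x
  proof -
    have "norm (g n x) \<le> 1 * M"
      unfolding g_def norm_scaleR using c[of x] clamp_norm_le[OF M, of "h n x"]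
      by (intro mult_mono) auto
    then show ?thesis by simp
  qed
  have [measurable]: "g n \<in> borel_measurable borel" "f \<in> borel_measurable borel" for n
    using g_cont meas by (auto intro: borel_measurable_continuous_onI)
  have AE_N: "AE x in lborel. x \<notin> N"
    using N unfolding negligible_iff_null_sets by (auto dest!: AE_not_in simp: AE_completion_iff)
  have g_lim: "AE x in lborel. (\<lambda>n. norm (g n x - f x)) \<longlonglongrightarrow> 0"
    using AE_N
  proof eventually_elim
    case (elim x)
    have "(\<lambda>n. g n x) \<longlonglongrightarrow> c x *\<^sub>R (f x /\<^sub>R max 1 (norm (f x) / M))"
      unfolding g_def using M by (intro tendsto_intros lim[OF elim]) auto
    moreover have "max 1 (norm (f x) / M) = 1" using bound[of x] M by (auto simp: max_def divide_simps)
    moreover have "c x *\<^sub>R f x = f x" using supp[of x] c(3)[of x] by (cases "norm x \<le> R") auto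
    ultimately have "(\<lambda>n. g n x) \<longlonglongrightarrow> f x" by simp
    then show ?case by (simp add: LIM_zero tendsto_norm_zero)
  qed
  have diff: "norm (g n x - f x) \<le> 2 * M * indicator (cball 0 (\<bar>R\<bar> + 1)) x" for n x
  proof (cases "norm x > R + 1")
    case True
    then show ?thesis using g_supp[of x n] supp[of x] M by (auto simp: indicator_def)
  next
    case False
    then show ?thesis using norm_triangle_ineq4[of "g n x" "f x"] g_bound[of n x] bound[of x]
      by (auto simp: indicator_def)
  qed
  have finite: "emeasure lborel (cball (0 :: 'a) (\<bar>R\<bar> + 1)) < \<infinity>"
    by (rule emeasure_bounded_finite) simp
  have ind: "integrable lborel (\<lambda>x. K * indicator (cball (0 :: 'a) (\<bar>R\<bar> + 1)) x)" for K :: real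
    using finite by (intro integrable_mult_right integrable_real_indicator) auto
  show ?thesis
  proof (rule that[of g])
    show "(\<lambda>n. \<integral>x. norm (g n x - f x) \<partial>lborel) \<longlonglongrightarrow> 0"
      using integral_dominated_convergence[OF _ _ ind[of "2 * M"] g_lim] diff by simp
    have "(norm (g n x - f x))\<^sup>2 \<le> (2 * M)\<^sup>2 * indicator (cball 0 (\<bar>R\<bar> + 1)) x" for n x
      using power_mono[OF diff[of n x], of 2] by (auto simp: indicator_def)
    moreover have "AE x in lborel. (\<lambda>n. (norm (g n x - f x))\<^sup>2) \<longlonglongrightarrow> 0"
      using g_lim by eventually_elim (auto intro: tendsto_eq_intros)
    ultimately show "(\<lambda>n. \<integral>x. (norm (g n x - f x))\<^sup>2 \<partial>lborel) \<longlonglongrightarrow> 0"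
      using integral_dominated_convergence[OF _ _ ind[of "(2 * M)\<^sup>2"], where f="\<lambda>_. 0"
          and s="\<lambda>n x. (norm (g n x - f x))\<^sup>2"] by simp
  qed (fact g_cont g_supp)+
qed

text \<open>Closeness in both norms at once is what extends Plancherel's theorem: closeness in mean controls the
  transforms pointwise, closeness in square mean controls their square integrals.\<close>

lemma continuous_approximation:
  fixes f :: "'a::euclidean_space \<Rightarrow> complex"
  assumes f: "integrable lborel f" "integrable lborel (\<lambda>x. (norm (f x))\<^sup>2)" and e: "e > 0"
  shows "\<exists>g R. continuous_on UNIV g \<and> (\<forall>x. norm x > R \<longrightarrow> g x = 0)
    \<and> (\<integral>x. norm (g x - f x) \<partial>lborel) < e \<and> (\<integral>x. (norm (g x - f x))\<^sup>2 \<partial>lborel) < e"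
proof -
  have [measurable]: "f \<in> borel_measurable borel" using f by auto
  define t where "t n x = (if norm x \<le> real n \<and> norm (f x) \<le> real n then f x else 0)" for n :: nat and x
  have [measurable]: "t n \<in> borel_measurable borel" for n unfolding t_def[abs_def] by measurable
  have t_lim: "(\<lambda>n. norm (t n x - f x)) \<longlonglongrightarrow> 0" for x
  proof (rule tendsto_eventually, rule eventually_sequentiallyI)
    fix n assume "nat \<lceil>max (norm x) (norm (f x))\<rceil> \<le> n"
    then have "max (norm x) (norm (f x)) \<le> real n" by linarith
    then show "norm (t n x - f x) = 0" by (simp add: t_def)
  qed
  have t_le: "norm (t n x - f x) \<le> norm (f x)" for n x by (simp add: t_def)
  have "(\<lambda>n. \<integral>x. norm (t n x - f x) \<partial>lborel) \<longlonglongrightarrow> (\<integral>x. 0 \<partial>(lborel :: 'a measure))"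
    by (rule integral_dominated_convergence[where w="\<lambda>x. norm (f x)"]) (use f t_lim t_le in auto)
  moreover have "(\<lambda>n. \<integral>x. (norm (t n x - f x))\<^sup>2 \<partial>lborel) \<longlonglongrightarrow> (\<integral>x. 0 \<partial>(lborel :: 'a measure))"
  proof (rule integral_dominated_convergence[where w="\<lambda>x. (norm (f x))\<^sup>2"])
    show "AE x in lborel. (\<lambda>n. (norm (t n x - f x))\<^sup>2) \<longlonglongrightarrow> 0"
      using t_lim by (auto intro: tendsto_eq_intros)
    show "AE x in lborel. norm ((norm (t n x - f x))\<^sup>2) \<le> (norm (f x))\<^sup>2" for n
      using t_le by (auto intro: power_mono)
  qed (use f in auto)
  ultimately have "eventually (\<lambda>n. (\<integral>x. norm (t n x - f x) \<partial>lborel) < e / 4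
      \<and> (\<integral>x. (norm (t n x - f x))\<^sup>2 \<partial>lborel) < e / 4 \<and> n \<ge> 1) sequentially"
    using e by (intro eventually_conj order_tendstoD(2)[of _ 0] eventually_ge_at_top) auto
  then obtain n where n: "(\<integral>x. norm (t n x - f x) \<partial>lborel) < e / 4"
      "(\<integral>x. (norm (t n x - f x))\<^sup>2 \<partial>lborel) < e / 4" "n \<ge> 1"
    by (auto dest!: eventually_happens)
  have tb: "norm (t n x) \<le> real n" "norm x > real n \<Longrightarrow> t n x = 0" for x by (auto simp: t_def)
  obtain g where g: "\<And>m. continuous_on UNIV (g m)" "\<And>m x. norm x > real n + 1 \<Longrightarrow> g m x = 0"
    "(\<lambda>m. \<integral>x. norm (g m x - t n x) \<partial>lborel) \<longlonglongrightarrow> 0" "(\<lambda>m. \<integral>x. (norm (g m x - t n x))\<^sup>2 \<partial>lborel) \<longlonglongrightarrow> 0"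
    by (rule bounded_support_continuous_approximation[of "t n" "real n" "real n"]) (use tb n(3) in auto)
  have "eventually (\<lambda>m. (\<integral>x. norm (g m x - t n x) \<partial>lborel) < e / 4
      \<and> (\<integral>x. (norm (g m x - t n x))\<^sup>2 \<partial>lborel) < e / 4) sequentially"
    using e by (intro eventually_conj order_tendstoD(2)[OF g(3)] order_tendstoD(2)[OF g(4)]) auto
  then obtain m where m: "(\<integral>x. norm (g m x - t n x) \<partial>lborel) < e / 4"
      "(\<integral>x. (norm (g m x - t n x))\<^sup>2 \<partial>lborel) < e / 4"
    by (auto dest!: eventually_happens)
  have [measurable]: "g m \<in> borel_measurable borel" using g(1) by (rule borel_measurable_continuous_onI)
  have "bounded (g m ` cball 0 (real n + 1))"
    using g(1) by (intro compact_imp_bounded compact_continuous_image continuous_on_subset[OF g(1)]) auto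
  then obtain K where "K > 0" "\<forall>y\<in>g m ` cball 0 (real n + 1). norm y \<le> K" unfolding bounded_pos by blast
  then have K: "norm (g m x) \<le> K * indicator (cball 0 (real n + 1)) x" for x
    using g(2)[of x m] by (cases "norm x > real n + 1") (auto simp: indicator_def)
  have gi: "integrable lborel (g m)"
    by (rule bounded_support_integrable(1)[OF _ K]) measurable
  have tf1: "integrable lborel (\<lambda>x. norm (t n x - f x))"
    by (rule Bochner_Integration.integrable_bound[OF integrable_norm[OF f(1)]]) (use t_le in auto)
  have tf2: "integrable lborel (\<lambda>x. (norm (t n x - f x))\<^sup>2)"
    by (rule Bochner_Integration.integrable_bound[OF f(2)]) (use t_le in \<open>auto intro: power_mono\<close>)
  have tn: "norm (t n x) \<le> real n * indicator (cball 0 (real n + 1)) x" for x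
    using tb[of x] by (auto simp: indicator_def)
  have gt_le: "norm (g m x - t n x) \<le> (K + n) * indicator (cball 0 (real n + 1)) x" for x
    using norm_triangle_ineq4[of "g m x" "t n x"] K[of x] tn[of x] by (auto simp: indicator_def split: if_splits)
  have gt1: "integrable lborel (\<lambda>x. norm (g m x - t n x))"
    by (rule integrable_norm[OF bounded_support_integrable(1)[OF _ gt_le]]) measurable
  have gt2: "integrable lborel (\<lambda>x. (norm (g m x - t n x))\<^sup>2)"
    by (rule bounded_support_integrable(2)[OF _ gt_le]) measurable
  have "(\<integral>x. norm (g m x - f x) \<partial>lborel) \<le> (\<integral>x. norm (g m x - t n x) + norm (t n x - f x) \<partial>lborel)"
  proof (rule integral_mono)
    show "norm (g m x - f x) \<le> norm (g m x - t n x) + norm (t n x - f x)" for x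
      using norm_triangle_ineq[of "g m x - t n x" "t n x - f x"] by simp
  qed (use gi f gt1 tf1 in auto)
  also have "\<dots> = (\<integral>x. norm (g m x - t n x) \<partial>lborel) + (\<integral>x. norm (t n x - f x) \<partial>lborel)"
    by (rule Bochner_Integration.integral_add[OF gt1 tf1])
  also have "\<dots> < e" using m(1) n(1) e by linarith
  finally have 1: "(\<integral>x. norm (g m x - f x) \<partial>lborel) < e" .
  have le2: "(norm (g m x - f x))\<^sup>2 \<le> 2 * (norm (g m x - t n x))\<^sup>2 + 2 * (norm (t n x - f x))\<^sup>2" for x
    using norm_add_square_le[of "g m x - t n x" "t n x - f x"] by simp
  have i2: "integrable lborel (\<lambda>x. 2 * (norm (g m x - t n x))\<^sup>2 + 2 * (norm (t n x - f x))\<^sup>2)"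
    using gt2 tf2 by auto
  have "(\<integral>x. (norm (g m x - f x))\<^sup>2 \<partial>lborel)
      \<le> (\<integral>x. 2 * (norm (g m x - t n x))\<^sup>2 + 2 * (norm (t n x - f x))\<^sup>2 \<partial>lborel)"
    by (rule integral_mono[OF Bochner_Integration.integrable_bound[OF i2] i2 le2]) (use le2 in auto)
  also have "\<dots> = 2 * (\<integral>x. (norm (g m x - t n x))\<^sup>2 \<partial>lborel) + 2 * (\<integral>x. (norm (t n x - f x))\<^sup>2 \<partial>lborel)"
    using gt2 tf2 by simp
  also have "\<dots> < e" using m(2) n(2) by linarith
  finally have "(\<integral>x. (norm (g m x - f x))\<^sup>2 \<partial>lborel) < e" .
  with 1 g(1)[of m] g(2)[of _ m] show ?thesis
    by (intro exI[of _ "g m"] exI[of _ "real n + 1"]) auto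
qed


section \<open>The Plancherel theorem\<close>

definition fourier :: "real \<Rightarrow> ('a::euclidean_space \<Rightarrow> complex) \<Rightarrow> 'a \<Rightarrow> complex" where
  "fourier \<sigma> f \<xi> = of_real ((2 * pi) powr (- real DIM('a) / 2)) * (\<integral>x. f x * cis (\<sigma> * (\<xi> \<bullet> x)) \<partial>lebesgue)"

lemma fourier_constant:
  "((2 * pi) powr (- real n / 2))\<^sup>2 * (2 * pi) ^ n = 1"
proof -
  have "((2 * pi) powr (- real n / 2))\<^sup>2 = (2 * pi) powr (- real n)"
    by (simp add: power2_eq_square flip: powr_add)
  also have "\<dots> = inverse ((2 * pi) ^ n)" by (simp only: powr_minus) (simp add: powr_realpow)
  finally have "((2 * pi) powr (- real n / 2))\<^sup>2 = inverse ((2 * pi) ^ n)" .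
  then show ?thesis by (simp only:) (rule left_inverse, simp)
qed

lemma fourier_cong_AE:
  fixes f g :: "'a::euclidean_space \<Rightarrow> complex"
  assumes "AE x in lebesgue. f x = g x" "f \<in> borel_measurable lebesgue" "g \<in> borel_measurable lebesgue"
  shows "fourier \<sigma> f = fourier \<sigma> g"
proof
  fix \<xi> :: 'a
  have "(\<lambda>x. cis (\<sigma> * (\<xi> \<bullet> x))) \<in> borel_measurable lebesgue"
    by (rule measurable_completion) measurable
  then have "(\<integral>x. f x * cis (\<sigma> * (\<xi> \<bullet> x)) \<partial>lebesgue) = (\<integral>x. g x * cis (\<sigma> * (\<xi> \<bullet> x)) \<partial>lebesgue)"
    using assms by (intro integral_cong_AE) (auto elim: eventually_mono)
  then show "fourier \<sigma> f \<xi> = fourier \<sigma> g \<xi>" by (simp add: fourier_def)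
qed

lemma fourier_eq_fourier_integral:
  assumes [measurable]: "f \<in> borel_measurable borel"
  shows "fourier \<sigma> f \<xi>
    = of_real ((2 * pi) powr (- real DIM('a::euclidean_space) / 2)) * fourier_integral \<sigma> f (\<xi> :: 'a)"
proof -
  have "(\<integral>x. f x * cis (\<sigma> * (\<xi> \<bullet> x)) \<partial>lebesgue) = (\<integral>x. f x * cis (\<sigma> * (\<xi> \<bullet> x)) \<partial>lborel)"
    by (rule integral_completion) measurable
  then show ?thesis by (simp add: fourier_def fourier_integral_def)
qed

definition L1L2 :: "('a::euclidean_space \<Rightarrow> complex) set" where
  "L1L2 = {f \<in> square_integrable. integrable lebesgue f}"

lemma L1L2_cong_AE:
  assumes "f \<in> L1L2" "g \<in> borel_measurable lebesgue" "AE x in lebesgue. f x = g x"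
  shows "g \<in> L1L2"
proof -
  have "f \<in> borel_measurable lebesgue" using assms(1) by (simp add: L1L2_def square_integrable_def)
  then have "integrable lebesgue g"
    using integrable_cong_AE[OF _ assms(2,3)] assms(1) by (simp add: L1L2_def)
  moreover have "g \<in> square_integrable"
    using square_integrable_cong_AE[OF _ assms(2,3)] assms(1) by (simp add: L1L2_def)
  ultimately show ?thesis by (simp add: L1L2_def)
qed

lemma L1L2_borel_iff:
  assumes "f \<in> borel_measurable borel"
  shows "f \<in> L1L2 \<longleftrightarrow> integrable lborel f \<and> integrable lborel (\<lambda>x. (norm (f x))\<^sup>2)"
proof -
  have "f \<in> borel_measurable lebesgue" using assms by (intro measurable_completion) simp
  moreover have "integrable lebesgue f \<longleftrightarrow> integrable lborel f"
    using assms by (intro integrable_completion) simp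
  moreover have "integrable lebesgue (\<lambda>x. (norm (f x))\<^sup>2) \<longleftrightarrow> integrable lborel (\<lambda>x. (norm (f x))\<^sup>2)"
    using assms by (intro integrable_completion) simp
  ultimately show ?thesis by (simp add: L1L2_def square_integrable_def conj_commute)
qed

text \<open>Consequences of Fubini's theorem are proved for Borel functions on the product of Borel measure spaces and
  carried over by this lemma.\<close>

lemma L1L2_borel_representative:
  assumes "f \<in> L1L2"
  obtains g where "g \<in> borel_measurable borel" "g \<in> L1L2" "AE x in lebesgue. f x = g x"
    "\<And>\<sigma>. fourier \<sigma> f = fourier \<sigma> g"
proof -
  have f: "f \<in> borel_measurable lebesgue" using assms by (auto simp: L1L2_def square_integrable_def)
  from completion_ex_borel_measurable_euclidean[OF f]
  obtain g where g: "g \<in> borel_measurable borel" "AE x in lborel. f x = g x" by auto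
  have ae: "AE x in lebesgue. f x = g x" using g(2) by (rule AE_completion)
  have gl: "g \<in> borel_measurable lebesgue" using g(1) by (intro measurable_completion) auto
  show ?thesis
    using that[OF g(1) L1L2_cong_AE[OF assms gl ae] ae fourier_cong_AE[OF ae f gl]] .
qed

lemma L1L2_diff: "f \<in> L1L2 \<Longrightarrow> g \<in> L1L2 \<Longrightarrow> (\<lambda>x. f x - g x) \<in> L1L2"
  by (simp add: L1L2_def square_integrable_diff)

lemma integrable_lebesgue_times_cis:
  fixes f :: "'a::euclidean_space \<Rightarrow> complex"
  assumes "integrable lebesgue f"
  shows "integrable lebesgue (\<lambda>x. f x * cis (\<sigma> * (\<xi> \<bullet> x)))"
proof (rule Bochner_Integration.integrable_bound[OF integrable_norm[OF assms]])
  have "(\<lambda>x. cis (\<sigma> * (\<xi> \<bullet> x))) \<in> borel_measurable lebesgue"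
    by (rule measurable_completion) measurable
  then show "(\<lambda>x. f x * cis (\<sigma> * (\<xi> \<bullet> x))) \<in> borel_measurable lebesgue" using assms by auto
qed (simp add: norm_mult)

lemma fourier_linear:
  assumes "f \<in> L1L2" "g \<in> L1L2"
  shows "fourier \<sigma> (\<lambda>x. a *\<^sub>R f x + b *\<^sub>R g x) \<xi> = a *\<^sub>R fourier \<sigma> f \<xi> + b *\<^sub>R fourier \<sigma> g \<xi>"
proof -
  have i: "integrable lebesgue (\<lambda>x. f x * cis (\<sigma> * (\<xi> \<bullet> x)))" "integrable lebesgue (\<lambda>x. g x * cis (\<sigma> * (\<xi> \<bullet> x)))"
    using assms by (auto simp: L1L2_def intro: integrable_lebesgue_times_cis)
  have "(\<integral>x. (a *\<^sub>R f x + b *\<^sub>R g x) * cis (\<sigma> * (\<xi> \<bullet> x)) \<partial>lebesgue)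
      = (\<integral>x. a *\<^sub>R (f x * cis (\<sigma> * (\<xi> \<bullet> x))) + b *\<^sub>R (g x * cis (\<sigma> * (\<xi> \<bullet> x))) \<partial>lebesgue)"
    by (simp add: distrib_right)
  also have "\<dots> = a *\<^sub>R (\<integral>x. f x * cis (\<sigma> * (\<xi> \<bullet> x)) \<partial>lebesgue) + b *\<^sub>R (\<integral>x. g x * cis (\<sigma> * (\<xi> \<bullet> x)) \<partial>lebesgue)"
    using i by simp
  finally show ?thesis by (simp add: fourier_def distrib_left)
qed

lemma fourier_diff:
  assumes "f \<in> L1L2" "g \<in> L1L2"
  shows "fourier \<sigma> (\<lambda>x. f x - g x) \<xi> = fourier \<sigma> f \<xi> - fourier \<sigma> g \<xi>"
  using fourier_linear[OF assms, of \<sigma> 1 "-1" \<xi>] by simp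

lemma continuous_compact_support_L1L2:
  fixes f :: "'a::euclidean_space \<Rightarrow> complex"
  assumes cont: "continuous_on UNIV f" and supp: "\<And>x. norm x > R \<Longrightarrow> f x = 0"
  shows "f \<in> L1L2"
proof -
  have fm [measurable]: "f \<in> borel_measurable borel" using cont by (rule borel_measurable_continuous_onI)
  have "bounded (f ` cball 0 R)"
    using cont by (intro compact_imp_bounded compact_continuous_image continuous_on_subset[OF cont]) auto
  then obtain M where "M > 0" "\<forall>y\<in>f ` cball 0 R. norm y \<le> M" unfolding bounded_pos by blast
  then have M: "norm (f x) \<le> M * indicator (cball 0 R) x" for x
    using supp[of x] by (cases "norm x > R") (auto simp: indicator_def)
  show ?thesis unfolding L1L2_borel_iff[OF fm] by (intro conjI bounded_support_integrable[OF fm M])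
qed

lemma plancherel_continuous:
  fixes f :: "'a::euclidean_space \<Rightarrow> complex"
  assumes cont: "continuous_on UNIV f" and supp: "\<And>x. norm x > R \<Longrightarrow> f x = 0" and \<sigma>: "\<bar>\<sigma>\<bar> = 1"
  shows "fourier \<sigma> f \<in> square_integrable" "norm (L2_class (fourier \<sigma> f)) = norm (L2_class f)"
proof -
  have fm [measurable]: "f \<in> borel_measurable borel" using cont by (rule borel_measurable_continuous_onI)
  let ?c = "(2 * pi) powr (- real DIM('a) / 2)"
  have F: "fourier \<sigma> f = (\<lambda>\<xi>. of_real ?c * fourier_integral \<sigma> f \<xi>)"
    by (intro ext fourier_eq_fourier_integral fm)
  have Fm [measurable]: "fourier \<sigma> f \<in> borel_measurable borel" unfolding F by measurable
  have sq: "(norm (fourier \<sigma> f \<xi>))\<^sup>2 = ?c\<^sup>2 * (norm (fourier_integral \<sigma> f \<xi>))\<^sup>2" for \<xi>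
    by (simp add: F norm_mult power_mult_distrib)
  have par: "integrable lborel (\<lambda>\<xi>. (norm (fourier_integral \<sigma> f \<xi>))\<^sup>2)"
    using cont supp \<sigma> by (rule parseval_continuous(1))
  have par2: "(\<integral>\<xi>. (norm (fourier_integral \<sigma> f \<xi>))\<^sup>2 \<partial>lborel)
      = (2 * pi) ^ DIM('a) * (\<integral>x. (norm (f x))\<^sup>2 \<partial>lborel)"
    using cont supp \<sigma> by (rule parseval_continuous(2))
  have "integrable lborel (\<lambda>\<xi>. (norm (fourier \<sigma> f \<xi>))\<^sup>2)"
    unfolding sq using par by (rule integrable_mult_right)
  then show 1: "fourier \<sigma> f \<in> square_integrable"
    using Fm by (simp add: square_integrable_def integrable_completion measurable_completion)
  have "f \<in> L1L2" using cont supp by (rule continuous_compact_support_L1L2)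
  then have f: "f \<in> square_integrable" by (simp add: L1L2_def)
  have "(norm (L2_class (fourier \<sigma> f)))\<^sup>2 = (\<integral>\<xi>. (norm (fourier \<sigma> f \<xi>))\<^sup>2 \<partial>lborel)"
    unfolding norm_L2_class[OF 1] by (rule integral_completion) measurable
  also have "\<dots> = ?c\<^sup>2 * ((2 * pi) ^ DIM('a) * (\<integral>x. (norm (f x))\<^sup>2 \<partial>lborel))"
    unfolding sq integral_mult_right_zero par2 ..
  also have "\<dots> = (\<integral>x. (norm (f x))\<^sup>2 \<partial>lborel)"
    using fourier_constant[of "DIM('a)"] by (simp flip: mult.assoc)
  also have "\<dots> = (norm (L2_class f))\<^sup>2"
    unfolding norm_L2_class[OF f] by (rule integral_completion[symmetric]) measurable
  finally show "norm (L2_class (fourier \<sigma> f)) = norm (L2_class f)" by simp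
qed

text \<open>The function is approximated by continuous \<open>p n\<close> with compact support. Their transforms converge
  pointwise because \<open>p n\<close> converges in mean, and they form a Cauchy sequence in square mean by the
  isometry; by Fatou's lemma the two limits agree.\<close>

lemma plancherel_L1L2:
  fixes f :: "'a::euclidean_space \<Rightarrow> complex"
  assumes f: "f \<in> L1L2" and \<sigma>: "\<bar>\<sigma>\<bar> = 1"
  shows "fourier \<sigma> f \<in> square_integrable \<and> norm (L2_class (fourier \<sigma> f)) = norm (L2_class f)"
proof -
  obtain g where g: "g \<in> borel_measurable borel" "g \<in> L1L2" "AE x in lebesgue. f x = g x"
    and Fg: "\<And>\<sigma>. fourier \<sigma> f = fourier \<sigma> g" using L1L2_borel_representative[OF f] by metis
  note g(1) [measurable]
  have gi: "integrable lborel g" "integrable lborel (\<lambda>x. (norm (g x))\<^sup>2)"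
    using g by (auto simp: L1L2_borel_iff)
  have gs: "g \<in> square_integrable" and fs: "f \<in> square_integrable" using g(2) f by (auto simp: L1L2_def)
  define P where "P n p R \<longleftrightarrow> continuous_on UNIV p \<and> (\<forall>x. norm x > R \<longrightarrow> p x = 0)
    \<and> (\<integral>x. norm (p x - g x) \<partial>lborel) < (1 / 4) ^ n \<and> (\<integral>x. (norm (p x - g x))\<^sup>2 \<partial>lborel) < (1 / 4) ^ n"
    for n :: nat and p and R :: real
  have "\<exists>p R. P n p R" for n
    unfolding P_def using gi by (rule continuous_approximation) simp
  then obtain p R where "\<And>n. P n (p n) (R n)" by metis
  then have p: "\<And>n. continuous_on UNIV (p n)" "\<And>n x. norm x > R n \<Longrightarrow> p n x = 0"
    "\<And>n :: nat. (\<integral>x. norm (p n x - g x) \<partial>lborel) < (1 / 4) ^ n"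
    "\<And>n. (\<integral>x. (norm (p n x - g x))\<^sup>2 \<partial>lborel) < (1 / 4) ^ n"
    unfolding P_def by blast+
  have [measurable]: "p n \<in> borel_measurable borel" for n
    using p(1) by (rule borel_measurable_continuous_onI)
  have pL: "p n \<in> L1L2" for n using p(1,2) by (rule continuous_compact_support_L1L2)
  then have ps: "p n \<in> square_integrable" for n by (simp add: L1L2_def)
  have pi: "integrable lborel (p n)" for n using pL[of n] by (simp add: L1L2_borel_iff)
  have pg: "norm (L2_class (p n) - L2_class g) \<le> (1 / 2) ^ n" for n
  proof -
    have "(norm (L2_class (p n) - L2_class g))\<^sup>2 = (\<integral>x. (norm (p n x - g x))\<^sup>2 \<partial>lebesgue)"
      using norm_L2_class[OF square_integrable_diff[OF ps gs]] by (simp add: L2_class_diff[OF ps gs])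
    also have "\<dots> = (\<integral>x. (norm (p n x - g x))\<^sup>2 \<partial>lborel)" by (rule integral_completion) measurable
    also have "\<dots> \<le> (1 / 4) ^ n" using p(4)[of n] by simp
    also have "\<dots> = ((1 / 2) ^ n)\<^sup>2" by (simp add: power2_eq_square flip: power_mult_distrib)
    finally show ?thesis by (rule power2_le_imp_le) simp
  qed
  have Fs: "fourier \<sigma> (p n) \<in> square_integrable" for n using p(1,2) \<sigma> by (rule plancherel_continuous)
  have Fm: "fourier \<sigma> (p n) \<in> borel_measurable lebesgue" for n using Fs square_integrableD by blast
  have Fnorm: "norm (L2_class (fourier \<sigma> (p n))) = norm (L2_class (p n))" for n
    using p(1,2) \<sigma> by (rule plancherel_continuous(2))
  have gm: "fourier \<sigma> g \<in> borel_measurable lebesgue"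
  proof -
    have "fourier \<sigma> g = (\<lambda>\<xi>. of_real ((2 * pi) powr (- real DIM('a) / 2)) * fourier_integral \<sigma> g \<xi>)"
      by (intro ext fourier_eq_fourier_integral g)
    also have "\<dots> \<in> borel_measurable lebesgue" by (intro measurable_completion) measurable
    finally show ?thesis .
  qed
  have pt: "(\<lambda>m. fourier \<sigma> (p m) \<xi>) \<longlonglongrightarrow> fourier \<sigma> g \<xi>" for \<xi>
  proof -
    have "(\<lambda>m. fourier_integral \<sigma> (p m) \<xi> - fourier_integral \<sigma> g \<xi>) \<longlonglongrightarrow> 0"
    proof (rule Lim_null_comparison)
      show "\<forall>\<^sub>F m in sequentially. norm (fourier_integral \<sigma> (p m) \<xi> - fourier_integral \<sigma> g \<xi>) \<le> (1 / 4) ^ m"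
      proof (intro always_eventually allI)
        fix m
        have "norm (fourier_integral \<sigma> (\<lambda>x. p m x - g x) \<xi>) \<le> (\<integral>x. norm (p m x - g x) \<partial>lborel)"
          using pi gi by (intro fourier_integral_bound) auto
        then show "norm (fourier_integral \<sigma> (p m) \<xi> - fourier_integral \<sigma> g \<xi>) \<le> (1 / 4) ^ m"
          using p(3)[of m] by (simp add: fourier_integral_diff[OF pi gi(1)])
      qed
      show "(\<lambda>m. (1 / 4 :: real) ^ m) \<longlonglongrightarrow> 0" by (rule LIMSEQ_power_zero) simp
    qed
    then have "(\<lambda>m. fourier_integral \<sigma> (p m) \<xi>) \<longlonglongrightarrow> fourier_integral \<sigma> g \<xi>" by (rule LIM_zero_cancel)
    then show ?thesis
      by (subst (1 2) fourier_eq_fourier_integral) (auto intro!: tendsto_intros)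
  qed
  have close: "(\<integral>\<^sup>+\<xi>. ennreal ((norm (fourier \<sigma> (p n) \<xi> - fourier \<sigma> g \<xi>))\<^sup>2) \<partial>lebesgue) \<le> ennreal ((2 * (1 / 2) ^ n)\<^sup>2)" for n
  proof (rule nn_integral_norm_square_limit_le)
    show "(\<lambda>\<xi>. fourier \<sigma> (p n) \<xi> - fourier \<sigma> (p m) \<xi>) \<in> borel_measurable lebesgue" for m
      using Fm by (intro borel_measurable_diff)
    show "AE \<xi> in lebesgue. (\<lambda>m. fourier \<sigma> (p n) \<xi> - fourier \<sigma> (p m) \<xi>) \<longlonglongrightarrow> fourier \<sigma> (p n) \<xi> - fourier \<sigma> g \<xi>"
      by (intro AE_I2 tendsto_intros pt)
    show "\<forall>\<^sub>F m in sequentially. (\<integral>\<^sup>+\<xi>. ennreal ((norm (fourier \<sigma> (p n) \<xi> - fourier \<sigma> (p m) \<xi>))\<^sup>2) \<partial>lebesgue)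
        \<le> ennreal ((2 * (1 / 2) ^ n)\<^sup>2)"
    proof (rule eventually_sequentiallyI)
      fix m assume m: "n \<le> m"
      let ?q = "\<lambda>x. p n x - p m x"
      have qc: "continuous_on UNIV ?q" by (intro continuous_intros p(1))
      have qs: "?q x = 0" if "norm x > max (R n) (R m)" for x using that p(2) by simp
      have Fq: "fourier \<sigma> ?q = (\<lambda>\<xi>. fourier \<sigma> (p n) \<xi> - fourier \<sigma> (p m) \<xi>)"
        by (intro ext fourier_diff pL)
      have Fqs: "fourier \<sigma> ?q \<in> square_integrable"
        using qc qs \<sigma> by (rule plancherel_continuous(1))
      have Fqn: "norm (L2_class (fourier \<sigma> ?q)) = norm (L2_class ?q)"
        using qc qs \<sigma> by (rule plancherel_continuous(2))
      have "norm (L2_class ?q) \<le> norm (L2_class (p n) - L2_class g) + norm (L2_class (p m) - L2_class g)"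
        unfolding L2_class_diff[OF ps ps]
        using norm_triangle_ineq4[of "L2_class (p n) - L2_class g" "L2_class (p m) - L2_class g"] by simp
      also have "\<dots> \<le> (1 / 2) ^ n + (1 / 2) ^ m" by (intro add_mono pg)
      also have "\<dots> \<le> 2 * (1 / 2) ^ n"
        using power_decreasing[OF m, of "1 / 2 :: real"] by simp
      finally have le: "norm (L2_class (fourier \<sigma> ?q)) \<le> 2 * (1 / 2) ^ n"
        unfolding Fqn .
      show "(\<integral>\<^sup>+\<xi>. ennreal ((norm (fourier \<sigma> (p n) \<xi> - fourier \<sigma> (p m) \<xi>))\<^sup>2) \<partial>lebesgue) \<le> ennreal ((2 * (1 / 2) ^ n)\<^sup>2)"
        using nn_integral_norm_square[OF Fqs] power_mono[OF le norm_ge_zero, of 2]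
        unfolding Fq by (simp only: ennreal_leI)
    qed
  qed
  have d: "(\<lambda>\<xi>. fourier \<sigma> (p n) \<xi> - fourier \<sigma> g \<xi>) \<in> square_integrable" for n
    unfolding square_integrable_iff_nn_integral
    using close[of n] Fm gm by (auto intro: le_less_trans)
  have Fgs: "fourier \<sigma> g \<in> square_integrable"
    using square_integrable_diff[OF Fs d, of 0 0] by simp
  have half: "(\<lambda>n. (1 / 2 :: real) ^ n) \<longlonglongrightarrow> 0" by (rule LIMSEQ_power_zero) simp
  have err: "norm (L2_class (fourier \<sigma> (p n)) - L2_class (fourier \<sigma> g)) \<le> 2 * (1 / 2) ^ n" for n
  proof (rule power2_le_imp_le)
    show "(norm (L2_class (fourier \<sigma> (p n)) - L2_class (fourier \<sigma> g)))\<^sup>2 \<le> (2 * (1 / 2) ^ n)\<^sup>2"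
      using close[of n] unfolding nn_integral_norm_square[OF d] L2_class_diff[OF Fs Fgs]
      by (simp only: ennreal_le_iff zero_le_power2)
  qed simp
  have "(\<lambda>n. L2_class (fourier \<sigma> (p n)) - L2_class (fourier \<sigma> g)) \<longlonglongrightarrow> 0"
    by (rule Lim_null_comparison[OF always_eventually tendsto_mult_right_zero[OF half, of 2]])
      (use err in blast)
  then have "(\<lambda>n. norm (L2_class (fourier \<sigma> (p n)))) \<longlonglongrightarrow> norm (L2_class (fourier \<sigma> g))"
    by (rule tendsto_norm[OF LIM_zero_cancel])
  moreover have "(\<lambda>n. L2_class (p n) - L2_class g) \<longlonglongrightarrow> 0"
    by (rule Lim_null_comparison[OF always_eventually half]) (use pg in blast)
  then have "(\<lambda>n. norm (L2_class (p n))) \<longlonglongrightarrow> norm (L2_class g)"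
    by (rule tendsto_norm[OF LIM_zero_cancel])
  ultimately have "norm (L2_class (fourier \<sigma> g)) = norm (L2_class g)"
    unfolding Fnorm by (rule LIMSEQ_unique)
  moreover have "L2_class f = L2_class g" using g(3) fs gs by (simp add: L2_class_eq_iff)
  ultimately show ?thesis using Fgs by (simp add: Fg)
qed

section \<open>The Fourier transform on square-integrable classes\<close>

definition cutoff :: "real \<Rightarrow> ('a::euclidean_space \<Rightarrow> 'b::euclidean_space) \<Rightarrow> 'a \<Rightarrow> 'b" where
  "cutoff R f x = indicator (cball 0 R) x *\<^sub>R f x"

lemma cutoff_measurable:
  fixes f :: "'a::euclidean_space \<Rightarrow> 'b::euclidean_space"
  shows "f \<in> borel_measurable lebesgue \<Longrightarrow> cutoff R f \<in> borel_measurable lebesgue"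
  unfolding cutoff_def[abs_def] by (intro borel_measurable_scaleR borel_measurable_indicator) auto

lemma norm_cutoff_le: "norm (cutoff R f x) \<le> norm (f x)"
  by (simp add: cutoff_def indicator_def)

lemma cutoff_square_integrable:
  assumes "f \<in> square_integrable"
  shows "cutoff R f \<in> square_integrable"
proof (rule square_integrable_bound)
  show "integrable lebesgue (\<lambda>x. (norm (f x))\<^sup>2)" using assms by (rule square_integrableD)
  show "cutoff R f \<in> borel_measurable lebesgue" using assms by (intro cutoff_measurable square_integrableD)
  show "AE x in lebesgue. (norm (cutoff R f x))\<^sup>2 \<le> (norm (f x))\<^sup>2"
    by (intro AE_I2 power_mono norm_cutoff_le norm_ge_zero)
qed

lemma cutoff_L1L2:
  fixes f :: "'a::euclidean_space \<Rightarrow> complex"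
  assumes "f \<in> square_integrable"
  shows "cutoff R f \<in> L1L2"
proof -
  have "integrable lebesgue (cutoff R f)"
  proof (rule Bochner_Integration.integrable_bound)
    have "integrable lebesgue (indicator (cball 0 R :: 'a set) :: 'a \<Rightarrow> real)"
      using emeasure_bounded_finite[OF bounded_cball[of "0 :: 'a" R]] by (intro integrable_real_indicator) auto
    then show "integrable lebesgue (\<lambda>x. (norm (f x))\<^sup>2 + indicator (cball 0 R) x)"
      using square_integrableD(2)[OF assms] by (intro Bochner_Integration.integrable_add)
    show "cutoff R f \<in> borel_measurable lebesgue" using assms by (intro cutoff_measurable square_integrableD)
    have "norm (f x) \<le> (norm (f x))\<^sup>2 + 1" for x
      using zero_le_power2[of "norm (f x) - 1"] norm_ge_zero[of "f x"]
      unfolding power2_diff one_power2 mult_1_right by linarith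
    then show "AE x in lebesgue. norm (cutoff R f x) \<le> norm ((norm (f x))\<^sup>2 + indicator (cball 0 R) x)"
      by (intro AE_I2) (auto simp: cutoff_def indicator_def)
  qed
  then show ?thesis using cutoff_square_integrable[OF assms] by (simp add: L1L2_def)
qed

lemma cutoff_tendsto:
  assumes f: "f \<in> square_integrable"
  shows "((\<lambda>R. L2_class (cutoff R f)) \<longlongrightarrow> L2_class f) at_top"
proof -
  have fm: "f \<in> borel_measurable lebesgue" and f2: "integrable lebesgue (\<lambda>x. (norm (f x))\<^sup>2)"
    using f by (auto dest: square_integrableD)
  have cm: "cutoff R f \<in> borel_measurable lebesgue" for R by (rule cutoff_measurable[OF fm])
  have "((\<lambda>R. \<integral>x. (norm (cutoff R f x - f x))\<^sup>2 \<partial>lebesgue) \<longlongrightarrow> (\<integral>x. 0 \<partial>(lebesgue :: 'a measure))) at_top"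
  proof (rule integral_dominated_convergence_at_top[OF _ _ f2])
    show "(\<lambda>x. (norm (cutoff R f x - f x))\<^sup>2) \<in> borel_measurable lebesgue" for R
      using fm cm by measurable
    show "AE x in lebesgue. ((\<lambda>R. (norm (cutoff R f x - f x))\<^sup>2) \<longlongrightarrow> 0) at_top"
    proof (intro AE_I2 tendsto_eventually)
      fix x
      show "\<forall>\<^sub>F R in at_top. (norm (cutoff R f x - f x))\<^sup>2 = 0"
        using eventually_ge_at_top[of "norm x"] by eventually_elim (simp add: cutoff_def)
    qed
    have "norm (cutoff R f x - f x) \<le> norm (f x)" for R x by (simp add: cutoff_def indicator_def)
    then show "\<forall>\<^sub>F R in at_top. AE x in lebesgue. norm ((norm (cutoff R f x - f x))\<^sup>2) \<le> (norm (f x))\<^sup>2"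
      by (intro always_eventually allI AE_I2) (simp add: power_mono)
  qed simp
  moreover have "(\<integral>x. (norm (cutoff R f x - f x))\<^sup>2 \<partial>lebesgue) = (norm (L2_class (cutoff R f) - L2_class f))\<^sup>2" for R
    using norm_L2_class[OF square_integrable_diff[OF cutoff_square_integrable[OF f] f]]
    by (simp add: L2_class_diff[OF cutoff_square_integrable[OF f] f])
  ultimately have "((\<lambda>R. sqrt ((norm (L2_class (cutoff R f) - L2_class f))\<^sup>2)) \<longlongrightarrow> sqrt 0) at_top"
    by (intro tendsto_real_sqrt) simp
  then have "((\<lambda>R. norm (L2_class (cutoff R f) - L2_class f)) \<longlongrightarrow> 0) at_top" by simp
  then show ?thesis by (simp add: tendsto_norm_zero_iff LIM_zero_iff)
qed

text \<open>Cut off to balls, square-integrable functions become integrable, and by the isometry the transforms of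
  the truncations converge in the mean.\<close>

definition L2_fourier :: "real \<Rightarrow> ('a::euclidean_space, complex) L2_space \<Rightarrow> ('a, complex) L2_space" where
  "L2_fourier \<sigma> x = lim (\<lambda>n. L2_class (fourier \<sigma> (cutoff (real n) (L2_fun x))))"

lemma fourier_square_integrable: "f \<in> L1L2 \<Longrightarrow> \<bar>\<sigma>\<bar> = 1 \<Longrightarrow> fourier \<sigma> f \<in> square_integrable"
  using plancherel_L1L2 by blast

lemma L2_class_fourier_linear:
  assumes "f \<in> L1L2" "g \<in> L1L2" "\<bar>\<sigma>\<bar> = 1"
  shows "L2_class (fourier \<sigma> (\<lambda>x. a *\<^sub>R f x + b *\<^sub>R g x))
    = a *\<^sub>R L2_class (fourier \<sigma> f) + b *\<^sub>R L2_class (fourier \<sigma> g)"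
proof -
  have s: "fourier \<sigma> f \<in> square_integrable" "fourier \<sigma> g \<in> square_integrable"
    using assms by (auto intro: fourier_square_integrable)
  have "fourier \<sigma> (\<lambda>x. a *\<^sub>R f x + b *\<^sub>R g x) = (\<lambda>\<xi>. a *\<^sub>R fourier \<sigma> f \<xi> + b *\<^sub>R fourier \<sigma> g \<xi>)"
    by (intro ext fourier_linear assms)
  then show ?thesis
    by (simp add: L2_class_add[OF square_integrable_scaleR[OF s(1)] square_integrable_scaleR[OF s(2)]]
        L2_class_scaleR s)
qed

lemma norm_L2_class_fourier_diff:
  assumes "f \<in> L1L2" "g \<in> L1L2" "\<bar>\<sigma>\<bar> = 1"
  shows "norm (L2_class (fourier \<sigma> f) - L2_class (fourier \<sigma> g)) = norm (L2_class f - L2_class g)"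
proof -
  have "norm (L2_class (fourier \<sigma> (\<lambda>x. f x - g x))) = norm (L2_class (\<lambda>x. f x - g x))"
    using plancherel_L1L2[OF L1L2_diff[OF assms(1,2)] assms(3)] by blast
  moreover have "f \<in> square_integrable" "g \<in> square_integrable" using assms by (auto simp: L1L2_def)
  ultimately show ?thesis
    using L2_class_fourier_linear[OF assms, of 1 "-1"] by (simp add: L2_class_diff)
qed

text \<open>The transform is an isometry on differences of truncations; let one of the two radii tend to infinity.\<close>

lemma L2_fourier_cutoff_error:
  fixes x :: "('a::euclidean_space, complex) L2_space"
  assumes \<sigma>: "\<bar>\<sigma>\<bar> = 1"
  shows "norm (L2_class (fourier \<sigma> (cutoff R (L2_fun x))) - L2_fourier \<sigma> x)
    \<le> norm (L2_class (cutoff R (L2_fun x)) - x)"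
proof -
  define c where "c R = L2_class (cutoff R (L2_fun x))" for R
  define t where "t R = L2_class (fourier \<sigma> (cutoff R (L2_fun x)))" for R
  have c_lim: "(c \<longlongrightarrow> x) at_top" using cutoff_tendsto[of "L2_fun x"] by (simp add: c_def[abs_def])
  then have c_seq: "(\<lambda>n. c (real n)) \<longlonglongrightarrow> x" by (rule filterlim_compose[OF _ filterlim_real_sequentially])
  have tc: "norm (t R - t R') = norm (c R - c R')" for R R'
    unfolding t_def c_def by (intro norm_L2_class_fourier_diff cutoff_L1L2 \<sigma>) simp_all
  have "Cauchy (\<lambda>n. c (real n))" using c_seq by (intro LIMSEQ_imp_Cauchy)
  then have "Cauchy (\<lambda>n. t (real n))" unfolding Cauchy_def dist_norm tc .
  then have "(\<lambda>n. t (real n)) \<longlonglongrightarrow> L2_fourier \<sigma> x"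
    unfolding L2_fourier_def t_def by (metis Cauchy_convergent convergent_LIMSEQ_iff)
  then have "(\<lambda>n. norm (t R - t (real n))) \<longlonglongrightarrow> norm (t R - L2_fourier \<sigma> x)" by (intro tendsto_intros)
  moreover have "(\<lambda>n. norm (t R - t (real n))) \<longlonglongrightarrow> norm (c R - x)"
    unfolding tc by (intro tendsto_intros c_seq)
  ultimately have "norm (t R - L2_fourier \<sigma> x) = norm (c R - x)" by (rule LIMSEQ_unique)
  then show ?thesis by (simp add: t_def c_def)
qed

lemma L2_fourier_tendsto:
  assumes f: "f \<in> square_integrable" and \<sigma>: "\<bar>\<sigma>\<bar> = 1"
  shows "((\<lambda>R. L2_class (fourier \<sigma> (cutoff R f))) \<longlongrightarrow> L2_fourier \<sigma> (L2_class f)) at_top"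
proof -
  let ?g = "L2_fun (L2_class f)"
  have "fourier \<sigma> (cutoff R f) = fourier \<sigma> (cutoff R ?g)" for R
  proof (rule fourier_cong_AE)
    show "AE x in lebesgue. cutoff R f x = cutoff R ?g x"
      using L2_fun_AE[OF f] by eventually_elim (simp add: cutoff_def)
    show "cutoff R f \<in> borel_measurable lebesgue" "cutoff R ?g \<in> borel_measurable lebesgue"
      using square_integrableD(1)[OF f] square_integrableD(1)[OF L2_fun_square_integrable]
      by (auto intro: cutoff_measurable)
  qed
  moreover have "((\<lambda>R. L2_class (fourier \<sigma> (cutoff R ?g)) - L2_fourier \<sigma> (L2_class f)) \<longlongrightarrow> 0) at_top"
  proof (rule Lim_null_comparison)
    show "\<forall>\<^sub>F R in at_top. norm (L2_class (fourier \<sigma> (cutoff R ?g)) - L2_fourier \<sigma> (L2_class f))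
        \<le> norm (L2_class (cutoff R ?g) - L2_class f)"
      by (intro always_eventually allI L2_fourier_cutoff_error \<sigma>)
    have "((\<lambda>R. L2_class (cutoff R ?g)) \<longlongrightarrow> L2_class f) at_top"
      using cutoff_tendsto[of ?g] by simp
    then show "((\<lambda>R. norm (L2_class (cutoff R ?g) - L2_class f)) \<longlongrightarrow> 0) at_top"
      by (intro tendsto_norm_zero) (simp add: LIM_zero)
  qed
  ultimately show ?thesis by (simp add: LIM_zero_iff)
qed

lemma L2_fourier_L1L2: "f \<in> L1L2 \<Longrightarrow> \<bar>\<sigma>\<bar> = 1 \<Longrightarrow> L2_fourier \<sigma> (L2_class f) = L2_class (fourier \<sigma> f)"
proof -
  assume f: "f \<in> L1L2" and \<sigma>: "\<bar>\<sigma>\<bar> = 1"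
  then have fs: "f \<in> square_integrable" by (simp add: L1L2_def)
  have "((\<lambda>R. L2_class (fourier \<sigma> (cutoff R f)) - L2_class (fourier \<sigma> f)) \<longlongrightarrow> 0) at_top"
  proof (rule Lim_null_comparison)
    show "\<forall>\<^sub>F R in at_top. norm (L2_class (fourier \<sigma> (cutoff R f)) - L2_class (fourier \<sigma> f))
        \<le> norm (L2_class (cutoff R f) - L2_class f)"
      by (intro always_eventually allI eq_refl norm_L2_class_fourier_diff cutoff_L1L2 f fs \<sigma>)
    show "((\<lambda>R. norm (L2_class (cutoff R f) - L2_class f)) \<longlongrightarrow> 0) at_top"
      by (intro tendsto_norm_zero LIM_zero cutoff_tendsto fs)
  qed
  then have "((\<lambda>R. L2_class (fourier \<sigma> (cutoff R f))) \<longlongrightarrow> L2_class (fourier \<sigma> f)) at_top" by (rule LIM_zero_cancel)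
  then show ?thesis using tendsto_unique[OF _ L2_fourier_tendsto[OF fs \<sigma>]] by simp
qed

lemma L2_fourier_linear:
  assumes \<sigma>: "\<bar>\<sigma>\<bar> = 1"
  shows "L2_fourier \<sigma> (a *\<^sub>R x + b *\<^sub>R y) = a *\<^sub>R L2_fourier \<sigma> x + b *\<^sub>R L2_fourier \<sigma> y"
proof -
  let ?f = "L2_fun x" and ?g = "L2_fun y"
  let ?h = "\<lambda>t. a *\<^sub>R ?f t + b *\<^sub>R ?g t"
  have h: "?h \<in> square_integrable" by (intro square_integrable_add square_integrable_scaleR) simp_all
  have hc: "L2_class ?h = a *\<^sub>R x + b *\<^sub>R y"
    by (simp add: L2_class_add[OF square_integrable_scaleR square_integrable_scaleR] L2_class_scaleR)
  have "L2_class (fourier \<sigma> (cutoff R ?h))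
      = a *\<^sub>R L2_class (fourier \<sigma> (cutoff R ?f)) + b *\<^sub>R L2_class (fourier \<sigma> (cutoff R ?g))" for R
  proof -
    have "cutoff R ?h = (\<lambda>t. a *\<^sub>R cutoff R ?f t + b *\<^sub>R cutoff R ?g t)"
      by (auto simp: cutoff_def scaleR_add_right mult.commute)
    then show ?thesis
      using L2_class_fourier_linear[OF cutoff_L1L2 cutoff_L1L2 \<sigma>, of ?f ?g a R b R] by simp
  qed
  then have "((\<lambda>R. L2_class (fourier \<sigma> (cutoff R ?h))) \<longlongrightarrow>
      a *\<^sub>R L2_fourier \<sigma> (L2_class ?f) + b *\<^sub>R L2_fourier \<sigma> (L2_class ?g)) at_top"
    by (simp only:) (intro tendsto_intros L2_fourier_tendsto \<sigma> L2_fun_square_integrable)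
  from tendsto_unique[OF _ this L2_fourier_tendsto[OF h \<sigma>]] show ?thesis by (simp add: hc)
qed

lemma norm_L2_fourier:
  assumes \<sigma>: "\<bar>\<sigma>\<bar> = 1"
  shows "norm (L2_fourier \<sigma> x) = norm x"
proof -
  have "((\<lambda>R. norm (L2_class (fourier \<sigma> (cutoff R (L2_fun x))))) \<longlongrightarrow> norm (L2_fourier \<sigma> x)) at_top"
    using L2_fourier_tendsto[OF L2_fun_square_integrable \<sigma>, of x] by (intro tendsto_norm) simp
  moreover have "norm (L2_class (fourier \<sigma> (cutoff R (L2_fun x)))) = norm (L2_class (cutoff R (L2_fun x)))" for R
    using plancherel_L1L2[OF cutoff_L1L2[OF L2_fun_square_integrable] \<sigma>] by blast
  moreover have "((\<lambda>R. norm (L2_class (cutoff R (L2_fun x)))) \<longlongrightarrow> norm x) at_top"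
    using cutoff_tendsto[of "L2_fun x"] by (intro tendsto_norm) simp
  ultimately show ?thesis using tendsto_unique[of "at_top :: real filter"] by simp
qed

text \<open>This is the multiplication formula for \<open>f\<close> and \<open>cnj g\<close>; the real inner product of complex-valued functions
  is the real part of the integral of \<open>f cnj g\<close>.\<close>

lemma fourier_adjoint:
  fixes f g :: "'a::euclidean_space \<Rightarrow> complex"
  assumes f: "f \<in> L1L2" and g: "g \<in> L1L2" and \<sigma>: "\<bar>\<sigma>\<bar> = 1"
  shows "inner (L2_class (fourier \<sigma> f)) (L2_class g) = inner (L2_class f) (L2_class (fourier (- \<sigma>) g))"
proof -
  obtain f' where f': "f' \<in> borel_measurable borel" "f' \<in> L1L2" "AE x in lebesgue. f x = f' x"
    "\<And>\<sigma>. fourier \<sigma> f = fourier \<sigma> f'" using L1L2_borel_representative[OF f] by metis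
  obtain g' where g': "g' \<in> borel_measurable borel" "g' \<in> L1L2" "AE x in lebesgue. g x = g' x"
    "\<And>\<sigma>. fourier \<sigma> g = fourier \<sigma> g'" using L1L2_borel_representative[OF g] by metis
  note f'(1) [measurable] g'(1) [measurable]
  have fi: "integrable lborel f'" using f'(1,2) by (simp add: L1L2_borel_iff)
  have gi: "integrable lborel (\<lambda>x. cnj (g' x))" using g'(1,2) by (simp add: L1L2_borel_iff)
  have sq: "f' \<in> square_integrable" "g' \<in> square_integrable" "f \<in> square_integrable" "g \<in> square_integrable"
    using f g f' g' by (auto simp: L1L2_def)
  have Fsq: "fourier \<sigma> f' \<in> square_integrable" "fourier (- \<sigma>) g' \<in> square_integrable"
    using f' g' \<sigma> by (auto intro: fourier_square_integrable)
  have cl: "L2_class f = L2_class f'" "L2_class g = L2_class g'"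
    using f'(3) g'(3) sq by (auto simp: L2_class_eq_iff)
  let ?c = "complex_of_real ((2 * pi) powr (- real DIM('a) / 2))"
  have F: "fourier s p = (\<lambda>\<xi>. ?c * fourier_integral s p \<xi>)" if "p \<in> borel_measurable borel" for s and p :: "'a \<Rightarrow> complex"
    using that by (intro ext fourier_eq_fourier_integral)
  have inner_Re: "a \<bullet> b = Re (a * cnj b)" for a b :: complex by (simp add: inner_complex_def)
  have cnj_F: "fourier_integral \<sigma> (\<lambda>x. cnj (g' x)) \<xi> = cnj (fourier_integral (- \<sigma>) g' \<xi>)" for \<xi>
    unfolding fourier_integral_def by (simp add: cis_cnj flip: Bochner_Integration.integral_cnj)
  have [measurable]: "fourier s f' \<in> borel_measurable borel" "fourier s g' \<in> borel_measurable borel" for s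
    by (simp_all add: F f'(1) g'(1))
  have m1: "integrable lborel (\<lambda>x. f' x * fourier_integral \<sigma> (\<lambda>x. cnj (g' x)) x)"
    by (rule fourier_integral_multiplication(1)[OF fi gi])
  have m1': "integrable lborel (\<lambda>x. fourier_integral \<sigma> f' x * cnj (g' x))"
    using fourier_integral_multiplication(1)[OF gi fi, of \<sigma>] by (simp add: mult.commute)
  have m2: "(\<integral>x. f' x * fourier_integral \<sigma> (\<lambda>x. cnj (g' x)) x \<partial>lborel)
      = (\<integral>x. fourier_integral \<sigma> f' x * cnj (g' x) \<partial>lborel)"
    by (rule fourier_integral_multiplication(2)[OF fi gi])
  have "inner (L2_class (fourier \<sigma> f)) (L2_class g) = (\<integral>\<xi>. fourier \<sigma> f' \<xi> \<bullet> g' \<xi> \<partial>lebesgue)"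
    unfolding cl f'(4) by (rule L2_class_inner[OF Fsq(1) sq(2)])
  also have "\<dots> = (\<integral>\<xi>. fourier \<sigma> f' \<xi> \<bullet> g' \<xi> \<partial>lborel)" by (rule integral_completion) measurable
  also have "\<dots> = (\<integral>\<xi>. Re (?c * (fourier_integral \<sigma> f' \<xi> * cnj (g' \<xi>))) \<partial>lborel)"
    by (simp add: F f'(1) inner_Re mult.assoc)
  also have "\<dots> = Re (?c * (\<integral>\<xi>. fourier_integral \<sigma> f' \<xi> * cnj (g' \<xi>) \<partial>lborel))"
    unfolding integral_Re[OF integrable_mult_right[OF m1']] integral_mult_right_zero ..
  also have "\<dots> = Re (?c * (\<integral>x. f' x * fourier_integral \<sigma> (\<lambda>x. cnj (g' x)) x \<partial>lborel))"
    unfolding m2 ..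
  also have "\<dots> = (\<integral>x. Re (?c * (f' x * fourier_integral \<sigma> (\<lambda>x. cnj (g' x)) x)) \<partial>lborel)"
    unfolding integral_Re[OF integrable_mult_right[OF m1]] integral_mult_right_zero ..
  also have "\<dots> = (\<integral>x. f' x \<bullet> fourier (- \<sigma>) g' x \<partial>lborel)"
    unfolding cnj_F by (simp add: F g'(1) inner_Re mult_ac)
  also have "\<dots> = (\<integral>x. f' x \<bullet> fourier (- \<sigma>) g' x \<partial>lebesgue)"
    by (rule integral_completion[symmetric]) measurable
  also have "\<dots> = inner (L2_class f) (L2_class (fourier (- \<sigma>) g))"
    unfolding cl g'(4) by (rule L2_class_inner[OF sq(1) Fsq(2), symmetric])
  finally show ?thesis .
qed

lemma L2_fourier_adjoint:
  assumes \<sigma>: "\<bar>\<sigma>\<bar> = 1"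
  shows "inner (L2_fourier \<sigma> x) y = inner x (L2_fourier (- \<sigma>) y)"
proof -
  let ?f = "L2_fun x" and ?g = "L2_fun y"
  have \<sigma>': "\<bar>- \<sigma>\<bar> = 1" using \<sigma> by simp
  have F: "((\<lambda>R. L2_class (fourier \<sigma> (cutoff R ?f))) \<longlongrightarrow> L2_fourier \<sigma> x) at_top"
    "((\<lambda>R. L2_class (fourier (- \<sigma>) (cutoff R ?g))) \<longlongrightarrow> L2_fourier (- \<sigma>) y) at_top"
    using L2_fourier_tendsto[OF L2_fun_square_integrable \<sigma>, of x]
      L2_fourier_tendsto[OF L2_fun_square_integrable \<sigma>', of y] by simp_all
  have c: "((\<lambda>R. L2_class (cutoff R ?f)) \<longlongrightarrow> x) at_top" "((\<lambda>R. L2_class (cutoff R ?g)) \<longlongrightarrow> y) at_top"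
    using cutoff_tendsto[of ?f] cutoff_tendsto[of ?g] by simp_all
  have "((\<lambda>R. inner (L2_class (fourier \<sigma> (cutoff R ?f))) (L2_class (cutoff R ?g))) \<longlongrightarrow> inner (L2_fourier \<sigma> x) y) at_top"
    by (intro tendsto_intros F c)
  moreover have "((\<lambda>R. inner (L2_class (cutoff R ?f)) (L2_class (fourier (- \<sigma>) (cutoff R ?g)))) \<longlongrightarrow> inner x (L2_fourier (- \<sigma>) y)) at_top"
    by (intro tendsto_intros F c)
  moreover have "inner (L2_class (fourier \<sigma> (cutoff R ?f))) (L2_class (cutoff R ?g))
      = inner (L2_class (cutoff R ?f)) (L2_class (fourier (- \<sigma>) (cutoff R ?g)))" for R
    by (intro fourier_adjoint cutoff_L1L2 \<sigma>) simp_all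
  ultimately show ?thesis using tendsto_unique[of "at_top :: real filter"] by simp
qed

text \<open>An isometry whose adjoint is an isometry as well is invertible.\<close>

lemma L2_fourier_inverse:
  assumes \<sigma>: "\<bar>\<sigma>\<bar> = 1"
  shows "L2_fourier \<sigma> (L2_fourier (- \<sigma>) y) = y"
proof -
  let ?z = "L2_fourier (- \<sigma>) y"
  have \<sigma>': "\<bar>- \<sigma>\<bar> = 1" using \<sigma> by simp
  have "(norm (L2_fourier \<sigma> ?z - y))\<^sup>2 = (norm (L2_fourier \<sigma> ?z))\<^sup>2 - 2 * inner (L2_fourier \<sigma> ?z) y + (norm y)\<^sup>2"
    by (simp add: power2_norm_eq_inner inner_diff_left inner_diff_right inner_commute)
  also have "\<dots> = 0"
    unfolding L2_fourier_adjoint[OF \<sigma>] norm_L2_fourier[OF \<sigma>]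
    using norm_L2_fourier[OF \<sigma>', of y] by (simp flip: power2_norm_eq_inner)
  finally show ?thesis by simp
qed


section \<open>Real-valued functions and Hermitian transforms\<close>

lemma AE_lebesgue_uminus:
  assumes "AE x :: 'a::euclidean_space in lebesgue. P x"
  shows "AE x in lebesgue. P (- x)"
proof -
  have eq: "distr lborel borel uminus = (lborel :: 'a measure)"
    by (subst lborel_affine[of "-1" 0]) (auto simp: density_1 distr_distr o_def one_ennreal_def[symmetric])
  have "AE x in lborel. P x" using assms by (simp add: AE_completion_iff)
  then have "AE x in distr lborel borel uminus. P x" unfolding eq .
  then have "AE x in lborel. P (- x)" by (rule AE_distrD[rotated]) simp
  then show ?thesis by (rule AE_completion)
qed

text \<open>The property that characterises the Fourier transforms of real-valued functions.\<close>

definition hermitian :: "('a::euclidean_space \<Rightarrow> complex) \<Rightarrow> bool" where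
  "hermitian g \<longleftrightarrow> (AE \<xi> in lebesgue. g (- \<xi>) = cnj (g \<xi>))"

lemma hermitian_limit:
  assumes "\<And>n. f n \<in> square_integrable" "g \<in> square_integrable" "\<And>n. hermitian (f n)"
    and "(\<lambda>n. L2_class (f n)) \<longlonglongrightarrow> L2_class g"
  shows "hermitian g"
proof -
  obtain r :: "nat \<Rightarrow> nat" where ae: "AE x in lebesgue. (\<lambda>n. f (r n) x) \<longlonglongrightarrow> g x"
    using L2_AE_subsequence[OF assms(1,2,4)] by blast
  have "AE x in lebesgue. \<forall>n. f n (- x) = cnj (f n x)"
    using assms(3) unfolding hermitian_def by (simp add: AE_all_countable)
  with ae AE_lebesgue_uminus[OF ae] show ?thesis
    unfolding hermitian_def
  proof eventually_elim
    case (elim x)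
    have "(\<lambda>n. cnj (f (r n) x)) \<longlonglongrightarrow> cnj (g x)" by (intro tendsto_intros elim)
    moreover have "(\<lambda>n. cnj (f (r n) x)) \<longlonglongrightarrow> g (- x)" using elim by simp
    ultimately show ?case by (rule LIMSEQ_unique[symmetric])
  qed
qed

lemma of_real_square_integrable:
  assumes "u \<in> square_integrable"
  shows "(\<lambda>x. complex_of_real (u x)) \<in> square_integrable"
proof -
  have "(\<lambda>x. complex_of_real (u x)) \<in> borel_measurable lebesgue"
    using square_integrableD(1)[OF assms] by measurable
  then show ?thesis using assms by (simp add: square_integrable_def)
qed

lemma hermitian_fourier_real:
  assumes u: "u \<in> square_integrable" and \<sigma>: "\<bar>\<sigma>\<bar> = 1"
    and g: "g \<in> square_integrable" "L2_fourier \<sigma> (L2_class (\<lambda>x. complex_of_real (u x))) = L2_class g"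
  shows "hermitian g"
proof (rule hermitian_limit)
  let ?u = "\<lambda>x. complex_of_real (u x)"
  have us: "?u \<in> square_integrable" by (rule of_real_square_integrable[OF u])
  show "fourier \<sigma> (cutoff (real n) ?u) \<in> square_integrable" for n
    by (intro fourier_square_integrable cutoff_L1L2 us \<sigma>)
  show "(\<lambda>n. L2_class (fourier \<sigma> (cutoff (real n) ?u))) \<longlonglongrightarrow> L2_class g"
    using filterlim_compose[OF L2_fourier_tendsto[OF us \<sigma>] filterlim_real_sequentially] g(2) by simp
  show "hermitian (fourier \<sigma> (cutoff (real n) ?u))" for n
    unfolding hermitian_def fourier_def cutoff_def
    by (intro AE_I2) (simp add: cis_cnj scaleR_conv_of_real flip: Bochner_Integration.integral_cnj)
qed (rule g)

lemma fourier_hermitian_real: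
  fixes y :: "'a::euclidean_space \<Rightarrow> complex"
  assumes y: "y \<in> borel_measurable borel" "hermitian y"
  shows "cnj (fourier \<sigma> (cutoff R y) \<xi>) = fourier \<sigma> (cutoff R y) \<xi>"
proof -
  note y(1) [measurable]
  have cm [measurable]: "cutoff R y \<in> borel_measurable borel"
    unfolding cutoff_def[abs_def] by (intro borel_measurable_scaleR borel_measurable_indicator) auto
  have "cnj (fourier_integral \<sigma> (cutoff R y) \<xi>) = (\<integral>x. cnj (cutoff R y x) * cis (\<sigma> * (\<xi> \<bullet> (- x))) \<partial>lborel)"
    unfolding fourier_integral_def by (simp add: cis_cnj flip: Bochner_Integration.integral_cnj)
  also have "\<dots> = (\<integral>x. cutoff R y (0 + (- 1) *\<^sub>R x) * cis (\<sigma> * (\<xi> \<bullet> (0 + (- 1) *\<^sub>R x))) \<partial>lborel)"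
  proof (rule integral_cong_AE)
    have "AE x in lborel. y (- x) = cnj (y x)"
      using y(2) by (simp add: hermitian_def AE_completion_iff)
    then show "AE x in lborel. cnj (cutoff R y x) * cis (\<sigma> * (\<xi> \<bullet> (- x)))
        = cutoff R y (0 + (- 1) *\<^sub>R x) * cis (\<sigma> * (\<xi> \<bullet> (0 + (- 1) *\<^sub>R x)))"
      by eventually_elim (simp add: cutoff_def indicator_def)
  qed measurable
  also have "\<dots> = (\<integral>x. cutoff R y x * cis (\<sigma> * (\<xi> \<bullet> x)) \<partial>lborel)"
    using lborel_affine_integral(1)[of "\<lambda>x. cutoff R y x * cis (\<sigma> * (\<xi> \<bullet> x))" "-1" 0] by simp
  finally have "cnj (fourier_integral \<sigma> (cutoff R y) \<xi>) = fourier_integral \<sigma> (cutoff R y) \<xi>"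
    by (simp add: fourier_integral_def)
  then show ?thesis by (simp add: fourier_eq_fourier_integral)
qed

text \<open>The truncations of \<open>g\<close> to balls are Hermitian, so their inverse transforms are real. Along a subsequence
  these converge almost everywhere to the inverse transform of \<open>g\<close>, which is therefore real.\<close>

lemma hermitian_is_fourier_of_real:
  fixes g :: "'a::euclidean_space \<Rightarrow> complex"
  assumes g: "g \<in> square_integrable" "hermitian g" and \<sigma>: "\<bar>\<sigma>\<bar> = 1"
  obtains w :: "'a \<Rightarrow> real" where "w \<in> square_integrable"
    "L2_fourier \<sigma> (L2_class (\<lambda>x. complex_of_real (w x))) = L2_class g"
proof -
  let ?y = "L2_fun (L2_class g)"
  have \<sigma>': "\<bar>- \<sigma>\<bar> = 1" using \<sigma> by simp
  have y: "hermitian ?y"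
    using g(2) L2_fun_AE[OF g(1)] AE_lebesgue_uminus[OF L2_fun_AE[OF g(1)]]
    unfolding hermitian_def by eventually_elim simp
  define z where "z = L2_fourier (- \<sigma>) (L2_class g)"
  have "(\<lambda>n. L2_class (fourier (- \<sigma>) (cutoff (real n) ?y))) \<longlonglongrightarrow> L2_class (L2_fun z)"
    using filterlim_compose[OF L2_fourier_tendsto[OF L2_fun_square_integrable \<sigma>', of "L2_class g"]
        filterlim_real_sequentially] by (simp add: z_def)
  moreover have "fourier (- \<sigma>) (cutoff (real n) ?y) \<in> square_integrable" for n
    by (intro fourier_square_integrable cutoff_L1L2 \<sigma>') simp
  ultimately obtain r :: "nat \<Rightarrow> nat" where
    ae: "AE x in lebesgue. (\<lambda>n. fourier (- \<sigma>) (cutoff (real (r n)) ?y) x) \<longlonglongrightarrow> L2_fun z x"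
    using L2_AE_subsequence[of "\<lambda>n. fourier (- \<sigma>) (cutoff (real n) ?y)" "L2_fun z"] by auto
  have real: "AE x in lebesgue. complex_of_real (Re (L2_fun z x)) = L2_fun z x"
    using ae
  proof eventually_elim
    case (elim x)
    have "(\<lambda>n. cnj (fourier (- \<sigma>) (cutoff (real (r n)) ?y) x)) \<longlonglongrightarrow> cnj (L2_fun z x)"
      by (intro tendsto_intros elim)
    then have "cnj (L2_fun z x) = L2_fun z x"
      unfolding fourier_hermitian_real[OF L2_fun_borel y] using elim by (rule LIMSEQ_unique)
    then show ?case by (metis complex_cnj_cancel_iff Reals_cnj_iff of_real_Re)
  qed
  have w: "(\<lambda>x. Re (L2_fun z x)) \<in> square_integrable"
  proof (rule square_integrable_bound)
    show "integrable lebesgue (\<lambda>x. (norm (L2_fun z x))\<^sup>2)" by (intro square_integrableD) simp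
    show "(\<lambda>x. Re (L2_fun z x)) \<in> borel_measurable lebesgue" by (intro measurable_completion) measurable
    show "AE x in lebesgue. (norm (Re (L2_fun z x)))\<^sup>2 \<le> (norm (L2_fun z x))\<^sup>2"
      using abs_Re_le_cmod by (intro AE_I2 power_mono) auto
  qed
  have "L2_class (\<lambda>x. complex_of_real (Re (L2_fun z x))) = z"
    using L2_class_eq_iff[OF of_real_square_integrable[OF w] L2_fun_square_integrable, of z] real by simp
  then have "L2_fourier \<sigma> (L2_class (\<lambda>x. complex_of_real (Re (L2_fun z x)))) = L2_class g"
    using L2_fourier_inverse[OF \<sigma>] by (simp add: z_def)
  with w show ?thesis by (rule that)
qed

section \<open>The fractional Laplacian as a closed operator\<close>

definition real_fourier :: "('a::euclidean_space, real) L2_space \<Rightarrow> ('a, complex) L2_space" where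
  "real_fourier x = L2_fourier (- 1) (L2_class (\<lambda>t. complex_of_real (L2_fun x t)))"

lemma L2_fun_linear_AE:
  "AE t in lebesgue. L2_fun (a *\<^sub>R x + b *\<^sub>R y) t = a *\<^sub>R L2_fun x t + b *\<^sub>R L2_fun y t"
proof -
  have "L2_class (\<lambda>t. a *\<^sub>R L2_fun x t + b *\<^sub>R L2_fun y t) = a *\<^sub>R x + b *\<^sub>R y"
    by (simp add: L2_class_add[OF square_integrable_scaleR square_integrable_scaleR] L2_class_scaleR)
  moreover have "(\<lambda>t. a *\<^sub>R L2_fun x t + b *\<^sub>R L2_fun y t) \<in> square_integrable"
    by (intro square_integrable_add square_integrable_scaleR) simp_all
  ultimately show ?thesis using L2_fun_AE by metis
qed

lemma L2_class_of_real_linear: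
  "L2_class (\<lambda>t. complex_of_real (L2_fun (a *\<^sub>R x + b *\<^sub>R y) t))
    = a *\<^sub>R L2_class (\<lambda>t. complex_of_real (L2_fun x t)) + b *\<^sub>R L2_class (\<lambda>t. complex_of_real (L2_fun y t))"
proof -
  let ?c = "\<lambda>x t. complex_of_real (L2_fun x t)"
  have c: "?c x \<in> square_integrable" for x by (intro of_real_square_integrable) simp
  have "L2_class (?c (a *\<^sub>R x + b *\<^sub>R y)) = L2_class (\<lambda>t. a *\<^sub>R ?c x t + b *\<^sub>R ?c y t)"
  proof (subst L2_class_eq_iff)
    show "AE t in lebesgue. ?c (a *\<^sub>R x + b *\<^sub>R y) t = a *\<^sub>R ?c x t + b *\<^sub>R ?c y t"
      using L2_fun_linear_AE[of a x b y] by eventually_elim (simp add: scaleR_conv_of_real)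
  qed (intro c square_integrable_add square_integrable_scaleR)+
  then show ?thesis
    by (simp add: L2_class_add[OF square_integrable_scaleR[OF c] square_integrable_scaleR[OF c]]
        L2_class_scaleR[OF c])
qed

lemma real_fourier_linear:
  "real_fourier (a *\<^sub>R x + b *\<^sub>R y) = a *\<^sub>R real_fourier x + b *\<^sub>R real_fourier y"
  unfolding real_fourier_def L2_class_of_real_linear by (rule L2_fourier_linear) simp

lemma norm_real_fourier: "norm (real_fourier x) = norm x"
proof -
  have "(norm (real_fourier x))\<^sup>2 = (norm (L2_class (\<lambda>t. complex_of_real (L2_fun x t))))\<^sup>2"
    unfolding real_fourier_def by (subst norm_L2_fourier) simp_all
  also have "\<dots> = (norm (L2_class (L2_fun x)))\<^sup>2"
    by (subst (1 2) norm_L2_class) (simp_all add: of_real_square_integrable)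
  finally show ?thesis by simp
qed

lemma real_fourier_diff: "real_fourier (x - y) = real_fourier x - real_fourier y"
  using real_fourier_linear[of 1 x "-1" y] by simp

lemma real_fourier_tendsto:
  assumes "X \<longlonglongrightarrow> x"
  shows "(\<lambda>n. real_fourier (X n)) \<longlonglongrightarrow> real_fourier x"
proof -
  have "(\<lambda>n. norm (X n - x)) \<longlonglongrightarrow> 0" using assms by (rule tendsto_norm_zero[OF LIM_zero])
  then have "(\<lambda>n. norm (real_fourier (X n) - real_fourier x)) \<longlonglongrightarrow> 0"
    by (simp add: norm_real_fourier flip: real_fourier_diff)
  then show ?thesis by (simp add: tendsto_norm_zero_iff LIM_zero_iff)
qed

lemma real_fourier_class:
  assumes "f \<in> square_integrable"
  shows "real_fourier (L2_class f) = L2_fourier (- 1) (L2_class (\<lambda>t. complex_of_real (f t)))"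
proof -
  have "L2_class (\<lambda>t. complex_of_real (L2_fun (L2_class f) t)) = L2_class (\<lambda>t. complex_of_real (f t))"
    using L2_fun_AE[OF assms] assms
    by (subst L2_class_eq_iff) (auto intro: of_real_square_integrable elim: eventually_mono)
  then show ?thesis by (simp add: real_fourier_def)
qed

lemma hermitian_real_fourier: "hermitian (L2_fun (real_fourier x))"
  by (rule hermitian_fourier_real[of "L2_fun x" "- 1"]) (simp_all add: real_fourier_def)

lemma real_fourier_surj:
  assumes "g \<in> square_integrable" "hermitian g"
  shows "\<exists>w. real_fourier w = L2_class g"
proof -
  obtain w where "w \<in> square_integrable" "L2_fourier (- 1) (L2_class (\<lambda>x. complex_of_real (w x))) = L2_class g"
    by (rule hermitian_is_fourier_of_real[OF assms, of "- 1"]) auto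
  then show ?thesis using real_fourier_class by metis
qed

text \<open>\<open>w = (-\<Delta>)\<^sup>s\<^sup>/\<^sup>2 x\<close>, as a relation because \<open>x\<close> need not lie in the domain.\<close>

definition frac_graph :: "real \<Rightarrow> ('a::euclidean_space, real) L2_space \<Rightarrow> ('a, real) L2_space \<Rightarrow> bool" where
  "frac_graph s x w \<longleftrightarrow> (AE \<xi> in lebesgue.
     L2_fun (real_fourier w) \<xi> = complex_of_real (norm \<xi> powr s) * L2_fun (real_fourier x) \<xi>)"

lemma frac_graph_linear:
  assumes "frac_graph s x w" "frac_graph s x' w'"
  shows "frac_graph s (a *\<^sub>R x + b *\<^sub>R x') (a *\<^sub>R w + b *\<^sub>R w')"
  using assms L2_fun_linear_AE[of a "real_fourier x" b "real_fourier x'"]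
    L2_fun_linear_AE[of a "real_fourier w" b "real_fourier w'"]
  unfolding frac_graph_def real_fourier_linear
  by eventually_elim (simp add: algebra_simps)

lemma frac_graph_unique:
  assumes "frac_graph s x w" "frac_graph s x w'"
  shows "w = w'"
proof -
  have "AE \<xi> in lebesgue. L2_fun (real_fourier w) \<xi> = L2_fun (real_fourier w') \<xi>"
    using assms unfolding frac_graph_def by eventually_elim simp
  then have "L2_class (L2_fun (real_fourier w)) = L2_class (L2_fun (real_fourier w'))"
    by (subst L2_class_eq_iff) simp_all
  then have "norm (real_fourier (w - w')) = 0" by (simp add: real_fourier_diff)
  then show ?thesis by (simp add: norm_real_fourier)
qed

lemma norm_powr_measurable: "(\<lambda>\<xi> :: 'a::euclidean_space. norm \<xi> powr s) \<in> borel_measurable lebesgue"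
  by (rule measurable_completion) measurable

text \<open>The weight \<open>|\<xi>|\<^sup>s\<close> is even and real, so multiplication by it preserves Hermitian symmetry and the result
  is the transform of a real function.\<close>

lemma frac_graph_exists:
  assumes g: "g \<in> square_integrable" "real_fourier x = L2_class g"
    and h: "(\<lambda>\<xi>. complex_of_real (norm \<xi> powr s) * g \<xi>) \<in> square_integrable"
  shows "\<exists>w. frac_graph s x w"
proof -
  let ?h = "\<lambda>\<xi>. complex_of_real (norm \<xi> powr s) * g \<xi>"
  have "hermitian ?h"
    using hermitian_real_fourier[of x] L2_fun_AE[OF g(1)] AE_lebesgue_uminus[OF L2_fun_AE[OF g(1)]]
    unfolding hermitian_def g(2) by eventually_elim simp
  then obtain w where w: "real_fourier w = L2_class ?h" using real_fourier_surj[OF h] by blast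
  have "frac_graph s x w"
    using L2_fun_AE[OF g(1)] L2_fun_AE[OF h] unfolding frac_graph_def g(2) w
    by eventually_elim simp
  then show ?thesis ..
qed

text \<open>A multiplication operator is closed: along a common subsequence both sides of the defining identity
  converge almost everywhere.\<close>

lemma frac_graph_closed:
  assumes "\<And>n. frac_graph s (X n) (W n)" "X \<longlonglongrightarrow> x" "W \<longlonglongrightarrow> w"
  shows "frac_graph s x w"
proof -
  obtain r :: "nat \<Rightarrow> nat" where r: "strict_mono r"
    "AE \<xi> in lebesgue. (\<lambda>n. L2_fun (real_fourier (X (r n))) \<xi>) \<longlonglongrightarrow> L2_fun (real_fourier x) \<xi>"
    using L2_AE_subsequence[of "\<lambda>n. L2_fun (real_fourier (X n))" "L2_fun (real_fourier x)"]
      real_fourier_tendsto[OF assms(2)] by auto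
  have "(\<lambda>n. real_fourier (W (r n))) \<longlonglongrightarrow> real_fourier w"
    using LIMSEQ_subseq_LIMSEQ[OF real_fourier_tendsto[OF assms(3)] r(1)] by (simp add: o_def)
  then obtain q :: "nat \<Rightarrow> nat" where q: "strict_mono q"
    "AE \<xi> in lebesgue. (\<lambda>n. L2_fun (real_fourier (W (r (q n)))) \<xi>) \<longlonglongrightarrow> L2_fun (real_fourier w) \<xi>"
    using L2_AE_subsequence[of "\<lambda>n. L2_fun (real_fourier (W (r n)))" "L2_fun (real_fourier w)"] by auto
  have "AE \<xi> in lebesgue. \<forall>n. L2_fun (real_fourier (W n)) \<xi>
      = complex_of_real (norm \<xi> powr s) * L2_fun (real_fourier (X n)) \<xi>"
    using assms(1) unfolding frac_graph_def by (simp add: AE_all_countable)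
  with r(2) q(2) show ?thesis
    unfolding frac_graph_def
  proof eventually_elim
    case (elim \<xi>)
    have "(\<lambda>n. L2_fun (real_fourier (X (r (q n)))) \<xi>) \<longlonglongrightarrow> L2_fun (real_fourier x) \<xi>"
      using LIMSEQ_subseq_LIMSEQ[OF elim(1) q(1)] by (simp add: o_def)
    then have "(\<lambda>n. complex_of_real (norm \<xi> powr s) * L2_fun (real_fourier (X (r (q n)))) \<xi>)
        \<longlonglongrightarrow> complex_of_real (norm \<xi> powr s) * L2_fun (real_fourier x) \<xi>"
      by (rule tendsto_mult_left)
    then show ?case using elim(2,3) LIMSEQ_unique by simp blast
  qed
qed

definition vanishes_outside :: "'a set \<Rightarrow> ('a::euclidean_space, 'b::euclidean_space) L2_space \<Rightarrow> bool" where
  "vanishes_outside \<Omega> x \<longleftrightarrow> (AE t in lebesgue. t \<notin> \<Omega> \<longrightarrow> L2_fun x t = 0)"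

lemma vanishes_outside_linear:
  assumes "vanishes_outside \<Omega> x" "vanishes_outside \<Omega> y"
  shows "vanishes_outside \<Omega> (a *\<^sub>R x + b *\<^sub>R y)"
  using assms L2_fun_linear_AE[of a x b y] unfolding vanishes_outside_def
  by eventually_elim simp

lemma L2_fun_zero_AE: "AE t in lebesgue. L2_fun (0 :: ('a::euclidean_space, 'b::euclidean_space) L2_space) t = 0"
  using L2_fun_AE[OF square_integrable_zero[where ?'a='a and ?'b='b]] unfolding L2_class_zero .

lemma vanishes_outside_zero: "vanishes_outside \<Omega> (0 :: ('a::euclidean_space, 'b::euclidean_space) L2_space)"
  unfolding vanishes_outside_def by (rule eventually_mono[OF L2_fun_zero_AE[where ?'b='b]]) simp

lemma closed_vanishes_outside: "closed {x. vanishes_outside \<Omega> x}"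
proof (rule closed_sequential_limits[THEN iffD2], intro allI impI)
  fix X and x :: "('a, 'b) L2_space"
  assume X: "(\<forall>n. X n \<in> {x. vanishes_outside \<Omega> x}) \<and> X \<longlonglongrightarrow> x"
  obtain r :: "nat \<Rightarrow> nat" where r: "AE t in lebesgue. (\<lambda>n. L2_fun (X (r n)) t) \<longlonglongrightarrow> L2_fun x t"
    using L2_AE_subsequence[of "\<lambda>n. L2_fun (X n)" "L2_fun x"] X by auto
  have "AE t in lebesgue. \<forall>n. t \<notin> \<Omega> \<longrightarrow> L2_fun (X n) t = 0"
    unfolding AE_all_countable using X by (simp add: vanishes_outside_def)
  with r show "x \<in> {x. vanishes_outside \<Omega> x}"
    unfolding vanishes_outside_def mem_Collect_eq
    by eventually_elim (auto simp: LIMSEQ_const_iff)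
qed

lemma vanishes_outside_class:
  assumes "f \<in> square_integrable"
  shows "vanishes_outside \<Omega> (L2_class f) \<longleftrightarrow> (AE t in lebesgue. t \<notin> \<Omega> \<longrightarrow> f t = 0)"
proof -
  have "AE t in lebesgue. (t \<notin> \<Omega> \<longrightarrow> L2_fun (L2_class f) t = 0) \<longleftrightarrow> (t \<notin> \<Omega> \<longrightarrow> f t = 0)"
    using L2_fun_AE[OF assms] by eventually_elim simp
  then show ?thesis unfolding vanishes_outside_def by (auto elim: eventually_elim2)
qed

text \<open>The classes of the functions in \<open>Hs_tilde s \<Omega>\<close>.\<close>

definition Hs_classes :: "real \<Rightarrow> 'a set \<Rightarrow> ('a::euclidean_space, real) L2_space set" where
  "Hs_classes s \<Omega> = {x. (\<exists>w. frac_graph s x w) \<and> vanishes_outside \<Omega> x}"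

text \<open>This is \<open>(-\<Delta>)\<^sup>s\<^sup>/\<^sup>2\<close>, the operator whose form gives \<open>Hs_form s\<close>; its value is unspecified outside the domain.\<close>

definition half_laplacian :: "real \<Rightarrow> ('a::euclidean_space, real) L2_space \<Rightarrow> ('a, real) L2_space" where
  "half_laplacian s x = (THE w. frac_graph s x w)"

lemma half_laplacian_eqI: "frac_graph s x w \<Longrightarrow> half_laplacian s x = w"
  unfolding half_laplacian_def by (rule the_equality) (auto intro: frac_graph_unique)

lemma frac_graph_half_laplacian: "x \<in> Hs_classes s \<Omega> \<Longrightarrow> frac_graph s x (half_laplacian s x)"
  unfolding Hs_classes_def by (auto simp: half_laplacian_eqI)

lemma frac_graph_zero: "frac_graph s (0 :: ('a::euclidean_space, real) L2_space) 0"
proof -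
  have "real_fourier (0 :: ('a, real) L2_space) = 0" using norm_real_fourier[of 0] by simp
  then show ?thesis
    unfolding frac_graph_def by (simp only:) (rule eventually_mono[OF L2_fun_zero_AE[where ?'b=complex]], simp)
qed

lemma Hs_classes_linear:
  assumes "x \<in> Hs_classes s \<Omega>" "y \<in> Hs_classes s \<Omega>"
  shows "a *\<^sub>R x + b *\<^sub>R y \<in> Hs_classes s \<Omega>"
    and "half_laplacian s (a *\<^sub>R x + b *\<^sub>R y) = a *\<^sub>R half_laplacian s x + b *\<^sub>R half_laplacian s y"
proof -
  have g: "frac_graph s (a *\<^sub>R x + b *\<^sub>R y) (a *\<^sub>R half_laplacian s x + b *\<^sub>R half_laplacian s y)"
    using assms by (intro frac_graph_linear frac_graph_half_laplacian)
  show "half_laplacian s (a *\<^sub>R x + b *\<^sub>R y) = a *\<^sub>R half_laplacian s x + b *\<^sub>R half_laplacian s y"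
    by (rule half_laplacian_eqI[OF g])
  show "a *\<^sub>R x + b *\<^sub>R y \<in> Hs_classes s \<Omega>"
    using g assms unfolding Hs_classes_def by (auto intro: vanishes_outside_linear)
qed

theorem closed_operator_half_laplacian:
  "closed_operator (Hs_classes s \<Omega>) (half_laplacian s :: ('a::euclidean_space, real) L2_space \<Rightarrow> _)"
proof
  have zero: "(0 :: ('a, real) L2_space) \<in> Hs_classes s \<Omega>"
    using frac_graph_zero vanishes_outside_zero by (auto simp: Hs_classes_def)
  show "subspace (Hs_classes s \<Omega> :: ('a, real) L2_space set)"
    unfolding subspace_def
    using zero Hs_classes_linear(1)[of _ s \<Omega> _ 1 1] Hs_classes_linear(1)[of _ s \<Omega> 0 _ 0] by auto
  fix x y :: "('a, real) L2_space" and c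
  show "half_laplacian s (x + y) = half_laplacian s x + half_laplacian s y"
    if "x \<in> Hs_classes s \<Omega>" "y \<in> Hs_classes s \<Omega>"
    using Hs_classes_linear(2)[OF that, of 1 1] by simp
  show "half_laplacian s (c *\<^sub>R x) = c *\<^sub>R half_laplacian s x" if "x \<in> Hs_classes s \<Omega>"
    using Hs_classes_linear(2)[OF that that, of c 0] by simp
  show "closed ((\<lambda>x :: ('a, real) L2_space. (x, half_laplacian s x)) ` Hs_classes s \<Omega>)"
  proof (rule closed_sequential_limits[THEN iffD2], intro allI impI)
    fix Z and z :: "('a, real) L2_space \<times> ('a, real) L2_space"
    assume Z: "(\<forall>n. Z n \<in> (\<lambda>x. (x, half_laplacian s x)) ` Hs_classes s \<Omega>) \<and> Z \<longlonglongrightarrow> z"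
    have in_V: "fst (Z n) \<in> Hs_classes s \<Omega>" "snd (Z n) = half_laplacian s (fst (Z n))" for n
    proof -
      have "Z n \<in> (\<lambda>x. (x, half_laplacian s x)) ` Hs_classes s \<Omega>" using Z by blast
      then obtain x where "x \<in> Hs_classes s \<Omega>" "Z n = (x, half_laplacian s x)" by (elim imageE)
      then show "fst (Z n) \<in> Hs_classes s \<Omega>" "snd (Z n) = half_laplacian s (fst (Z n))" by simp_all
    qed
    have "frac_graph s (fst z) (snd z)"
    proof (rule frac_graph_closed)
      show "frac_graph s (fst (Z n)) (snd (Z n))" for n
        unfolding in_V(2) by (rule frac_graph_half_laplacian[OF in_V(1)])
      show "(\<lambda>n. fst (Z n)) \<longlonglongrightarrow> fst z" "(\<lambda>n. snd (Z n)) \<longlonglongrightarrow> snd z"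
        using Z by (auto intro: tendsto_fst tendsto_snd)
    qed
    moreover have "vanishes_outside \<Omega> (fst z)"
    proof -
      have "\<forall>n. fst (Z n) \<in> {x. vanishes_outside \<Omega> x}" using in_V by (auto simp: Hs_classes_def)
      moreover have "(\<lambda>n. fst (Z n)) \<longlonglongrightarrow> fst z" using Z by (auto intro: tendsto_fst)
      ultimately show ?thesis
        using closed_sequentially[OF closed_vanishes_outside, of "\<lambda>n. fst (Z n)" \<Omega> "fst z"] by simp
    qed
    ultimately have "fst z \<in> Hs_classes s \<Omega>" "snd z = half_laplacian s (fst z)"
      by (auto simp: Hs_classes_def half_laplacian_eqI)
    then show "z \<in> (\<lambda>x. (x, half_laplacian s x)) ` Hs_classes s \<Omega>"
      by (intro image_eqI[of _ _ "fst z"]) (simp_all add: prod_eq_iff)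
  qed
qed


section \<open>Functions and their classes\<close>

lemma L2_UNIV: "L2 UNIV = square_integrable"
  by (simp add: L2_def square_integrable_def lebesgue_on_UNIV_eq)

lemma truncated_fourier_eq:
  fixes f :: "real ^ 'd \<Rightarrow> real"
  shows "truncated_fourier f R \<xi> = fourier (- 1) (cutoff R (\<lambda>x. complex_of_real (f x))) \<xi>"
proof -
  have "(\<integral>x. complex_of_real (f x) * cis (- (\<xi> \<bullet> x)) \<partial>lebesgue_on (cball 0 R))
      = (\<integral>x. indicator (cball 0 R) x *\<^sub>R (complex_of_real (f x) * cis (- (\<xi> \<bullet> x))) \<partial>lebesgue)"
    by (rule integral_restrict_space) simp
  then show ?thesis by (simp add: truncated_fourier_def fourier_def cutoff_def)
qed

text \<open>Convergence in the mean of the truncated integrals is convergence of classes, and the transform of a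
  class is the limit of precisely these truncations.\<close>

lemma is_L2_fourier_iff:
  fixes f :: "real ^ 'd \<Rightarrow> real"
  shows "is_L2_fourier f g \<longleftrightarrow> f \<in> square_integrable \<and> g \<in> square_integrable \<and> real_fourier (L2_class f) = L2_class g"
proof (cases "f \<in> square_integrable \<and> g \<in> square_integrable")
  case True
  then have f: "f \<in> square_integrable" and g: "g \<in> square_integrable" by auto
  let ?f = "\<lambda>x. complex_of_real (f x)"
  let ?t = "\<lambda>R. L2_class (fourier (- 1) (cutoff R ?f))"
  have fs: "?f \<in> square_integrable" by (rule of_real_square_integrable[OF f])
  have tr: "truncated_fourier f R = fourier (- 1) (cutoff R ?f)" for R
    by (intro ext truncated_fourier_eq)
  have ts: "fourier (- 1) (cutoff R ?f) \<in> square_integrable" for R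
    by (intro fourier_square_integrable cutoff_L1L2 fs) simp
  have "(\<integral>\<^sup>+\<xi>. ennreal ((cmod (truncated_fourier f R \<xi> - g \<xi>))\<^sup>2) \<partial>lebesgue) = ennreal ((norm (?t R - L2_class g))\<^sup>2)" for R
    using nn_integral_norm_square[OF square_integrable_diff[OF ts g]]
    by (simp add: tr L2_class_diff[OF ts g])
  then have "((\<lambda>R. \<integral>\<^sup>+\<xi>. ennreal ((cmod (truncated_fourier f R \<xi> - g \<xi>))\<^sup>2) \<partial>lebesgue) \<longlongrightarrow> 0) at_top
      \<longleftrightarrow> ((\<lambda>R. ennreal ((norm (?t R - L2_class g))\<^sup>2)) \<longlongrightarrow> ennreal 0) at_top" by simp
  also have "\<dots> \<longleftrightarrow> ((\<lambda>R. (norm (?t R - L2_class g))\<^sup>2) \<longlongrightarrow> 0) at_top"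
    by (rule tendsto_ennreal_iff) auto
  also have "\<dots> \<longleftrightarrow> (?t \<longlongrightarrow> L2_class g) at_top"
  proof
    assume "((\<lambda>R. (norm (?t R - L2_class g))\<^sup>2) \<longlongrightarrow> 0) at_top"
    from tendsto_real_sqrt[OF this] show "(?t \<longlongrightarrow> L2_class g) at_top"
      by (simp add: tendsto_norm_zero_iff LIM_zero_iff)
  next
    assume "(?t \<longlongrightarrow> L2_class g) at_top"
    from tendsto_power[OF tendsto_norm_zero[OF LIM_zero[OF this]], of 2]
    show "((\<lambda>R. (norm (?t R - L2_class g))\<^sup>2) \<longlongrightarrow> 0) at_top" by simp
  qed
  also have "\<dots> \<longleftrightarrow> real_fourier (L2_class f) = L2_class g"
    using tendsto_unique[of "at_top :: real filter"] L2_fourier_tendsto[OF fs, of "- 1"]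
    unfolding real_fourier_class[OF f] by auto
  finally show ?thesis
    using f g unfolding is_L2_fourier_def L2_UNIV by (simp add: square_integrable_def)
next
  case False
  then show ?thesis unfolding is_L2_fourier_def L2_UNIV by (auto simp: square_integrable_def)
qed

lemma is_frac_laplacian_iff:
  fixes u w :: "real ^ 'd \<Rightarrow> real"
  shows "is_frac_laplacian (s / 2) u w
    \<longleftrightarrow> u \<in> square_integrable \<and> w \<in> square_integrable \<and> frac_graph s (L2_class u) (L2_class w)"
proof
  assume "is_frac_laplacian (s / 2) u w"
  then obtain g where "is_L2_fourier u g"
    "is_L2_fourier w (\<lambda>\<xi>. complex_of_real (norm \<xi> powr s) * g \<xi>)"
    by (auto simp: is_frac_laplacian_def)
  then have g: "u \<in> square_integrable" "w \<in> square_integrable" "g \<in> square_integrable"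
      "real_fourier (L2_class u) = L2_class g"
      "(\<lambda>\<xi>. complex_of_real (norm \<xi> powr s) * g \<xi>) \<in> square_integrable"
      "real_fourier (L2_class w) = L2_class (\<lambda>\<xi>. complex_of_real (norm \<xi> powr s) * g \<xi>)"
    by (auto simp: is_L2_fourier_iff)
  have "frac_graph s (L2_class u) (L2_class w)"
    using L2_fun_AE[OF g(3)] L2_fun_AE[OF g(5)] unfolding frac_graph_def g(4,6)
    by eventually_elim simp
  with g show "u \<in> square_integrable \<and> w \<in> square_integrable \<and> frac_graph s (L2_class u) (L2_class w)"
    by blast
next
  assume a: "u \<in> square_integrable \<and> w \<in> square_integrable \<and> frac_graph s (L2_class u) (L2_class w)"
  let ?g = "L2_fun (real_fourier (L2_class u))"
  let ?h = "\<lambda>\<xi>. complex_of_real (norm \<xi> powr s) * ?g \<xi>"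
  have ae: "AE \<xi> in lebesgue. L2_fun (real_fourier (L2_class w)) \<xi> = ?h \<xi>"
    using a by (simp add: frac_graph_def)
  have "?h \<in> borel_measurable lebesgue" by (intro measurable_completion) measurable
  with L2_fun_square_integrable have h: "?h \<in> square_integrable"
    using ae by (rule square_integrable_cong_AE)
  have "real_fourier (L2_class w) = L2_class ?h"
    using L2_class_eq_iff[OF L2_fun_square_integrable h, of "real_fourier (L2_class w)"] ae by simp
  then have "is_L2_fourier u ?g" "is_L2_fourier w ?h" using a h by (auto simp: is_L2_fourier_iff)
  then show "is_frac_laplacian (s / 2) u w" unfolding is_frac_laplacian_def by auto
qed

text \<open>The weight \<open>(1 + |\<xi>|\<^sup>2)\<^sup>s\<close> that defines the Sobolev space is comparable to \<open>1 + |\<xi>|\<^sup>2\<^sup>s\<close>, the weight of the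
  graph norm of \<open>(-\<Delta>)\<^sup>s\<^sup>/\<^sup>2\<close>.\<close>

lemma powr_weight_bounds:
  assumes "s > 0" "(r::real) \<ge> 0"
  shows "(r powr s)\<^sup>2 \<le> (1 + r\<^sup>2) powr s" "(1 + r\<^sup>2) powr s \<le> 2 powr s * (1 + (r powr s)\<^sup>2)"
proof -
  have e: "(r powr s)\<^sup>2 = (r\<^sup>2) powr s"
    using assms(2) by (simp add: power2_eq_square powr_mult)
  show "(r powr s)\<^sup>2 \<le> (1 + r\<^sup>2) powr s"
    unfolding e using assms by (intro powr_mono2) auto
  show "(1 + r\<^sup>2) powr s \<le> 2 powr s * (1 + (r powr s)\<^sup>2)"
  proof (cases "r\<^sup>2 \<le> 1")
    case True
    then have "(1 + r\<^sup>2) powr s \<le> 2 powr s * 1" using assms by (simp add: powr_mono2)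
    also have "\<dots> \<le> 2 powr s * (1 + (r powr s)\<^sup>2)" by (intro mult_left_mono) auto
    finally show ?thesis .
  next
    case False
    then have "(1 + r\<^sup>2) powr s \<le> (2 * r\<^sup>2) powr s" using assms by (intro powr_mono2) auto
    also have "\<dots> = 2 powr s * (r powr s)\<^sup>2" unfolding e by (simp add: powr_mult)
    also have "\<dots> \<le> 2 powr s * (1 + (r powr s)\<^sup>2)" by (intro mult_left_mono) auto
    finally show ?thesis .
  qed
qed

lemma Hs_iff:
  fixes u :: "real ^ 'd \<Rightarrow> real"
  assumes s: "s > 0"
  shows "u \<in> Hs s \<longleftrightarrow> u \<in> square_integrable \<and> (\<exists>w. frac_graph s (L2_class u) w)"
proof
  assume u: "u \<in> Hs s"
  then obtain g where us: "u \<in> square_integrable" and gu: "is_L2_fourier u g"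
    and int: "integrable lebesgue (\<lambda>\<xi>. (1 + (norm \<xi>)\<^sup>2) powr s * (cmod (g \<xi>))\<^sup>2)"
    by (auto simp: Hs_def L2_UNIV)
  then have g: "g \<in> square_integrable" "real_fourier (L2_class u) = L2_class g"
    by (auto simp: is_L2_fourier_iff)
  let ?h = "\<lambda>\<xi>. complex_of_real (norm \<xi> powr s) * g \<xi>"
  have "?h \<in> square_integrable"
  proof (rule square_integrable_bound[OF int])
    show "?h \<in> borel_measurable lebesgue"
      using square_integrableD(1)[OF g(1)] norm_powr_measurable[of s] by measurable
    show "AE \<xi> in lebesgue. (cmod (?h \<xi>))\<^sup>2 \<le> (1 + (norm \<xi>)\<^sup>2) powr s * (cmod (g \<xi>))\<^sup>2"
      using powr_weight_bounds(1)[OF s] by (simp add: norm_mult power_mult_distrib mult_right_mono)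
  qed
  with us frac_graph_exists[OF g] show "u \<in> square_integrable \<and> (\<exists>w. frac_graph s (L2_class u) w)" by blast
next
  assume "u \<in> square_integrable \<and> (\<exists>w. frac_graph s (L2_class u) w)"
  then obtain w where us: "u \<in> square_integrable" and w: "frac_graph s (L2_class u) w" by blast
  let ?g = "L2_fun (real_fourier (L2_class u))" and ?h = "L2_fun (real_fourier w)"
  have "integrable lebesgue (\<lambda>\<xi>. (1 + (norm \<xi>)\<^sup>2) powr s * (cmod (?g \<xi>))\<^sup>2)"
  proof (rule Bochner_Integration.integrable_bound)
    show "integrable lebesgue (\<lambda>\<xi>. 2 powr s * ((cmod (?g \<xi>))\<^sup>2 + (cmod (?h \<xi>))\<^sup>2))"
      by (intro integrable_mult_right Bochner_Integration.integrable_add square_integrableD) simp_all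
    show "(\<lambda>\<xi>. (1 + (norm \<xi>)\<^sup>2) powr s * (cmod (?g \<xi>))\<^sup>2) \<in> borel_measurable lebesgue"
      by (intro measurable_completion) measurable
    have le: "(1 + (norm \<xi>)\<^sup>2) powr s * (cmod (?g \<xi>))\<^sup>2
        \<le> 2 powr s * (1 + (norm \<xi> powr s)\<^sup>2) * (cmod (?g \<xi>))\<^sup>2" for \<xi>
      by (intro mult_right_mono powr_weight_bounds(2) s) auto
    show "AE \<xi> in lebesgue. norm ((1 + (norm \<xi>)\<^sup>2) powr s * (cmod (?g \<xi>))\<^sup>2)
        \<le> norm (2 powr s * ((cmod (?g \<xi>))\<^sup>2 + (cmod (?h \<xi>))\<^sup>2))"
      using w unfolding frac_graph_def
    proof eventually_elim
      case (elim \<xi>)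
      show ?case using le[of \<xi>] by (simp add: elim norm_mult power_mult_distrib algebra_simps)
    qed
  qed
  then show "u \<in> Hs s"
    using us unfolding Hs_def L2_UNIV is_L2_fourier_iff by (auto intro!: exI[of _ ?g])
qed

lemma Hs_tilde_iff:
  fixes u :: "real ^ 'd \<Rightarrow> real"
  assumes "s > 0"
  shows "u \<in> Hs_tilde s \<Omega> \<longleftrightarrow> u \<in> square_integrable \<and> L2_class u \<in> Hs_classes s \<Omega>"
  using Hs_iff[OF assms, of u] vanishes_outside_class[of u \<Omega>]
  by (auto simp: Hs_tilde_def Hs_classes_def)

text \<open>The function \<open>frac_laplacian\<close> is an arbitrary choice, but all choices have the same class.\<close>

lemma frac_laplacian_class:
  fixes u :: "real ^ 'd \<Rightarrow> real"
  assumes s: "s > 0" and u: "u \<in> Hs_tilde s \<Omega>"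
  shows "frac_laplacian (s / 2) u \<in> square_integrable"
    and "L2_class (frac_laplacian (s / 2) u) = half_laplacian s (L2_class u)"
proof -
  have us: "u \<in> square_integrable" "L2_class u \<in> Hs_classes s \<Omega>" using u by (auto simp: Hs_tilde_iff[OF s])
  have "is_frac_laplacian (s / 2) u (L2_fun (half_laplacian s (L2_class u)))"
    using us frac_graph_half_laplacian by (auto simp: is_frac_laplacian_iff)
  then have "is_frac_laplacian (s / 2) u (frac_laplacian (s / 2) u)"
    unfolding frac_laplacian_def by (rule someI[where P="is_frac_laplacian (s / 2) u"])
  then show "frac_laplacian (s / 2) u \<in> square_integrable"
    "L2_class (frac_laplacian (s / 2) u) = half_laplacian s (L2_class u)"
    by (auto simp: is_frac_laplacian_iff half_laplacian_eqI)
qed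

lemma Hs_form_eq_inner:
  fixes u v :: "real ^ 'd \<Rightarrow> real"
  assumes "s > 0" "u \<in> Hs_tilde s \<Omega>" "v \<in> Hs_tilde s \<Omega>"
  shows "Hs_form s u v = inner (half_laplacian s (L2_class u)) (half_laplacian s (L2_class v))"
  using frac_laplacian_class[OF assms(1,2)] frac_laplacian_class[OF assms(1,3)]
    L2_class_inner[of "frac_laplacian (s / 2) u" "frac_laplacian (s / 2) v"]
  by (simp add: Hs_form_def)

section \<open>Density of the energy space\<close>

text \<open>Mollification by the normalised indicator of the cube \<open>[-1, 1]\<^sup>d\<close> is enough here, and it needs only
  integrals over intervals. The symbol decays like \<open>1 / |\<zeta>|\<close> in every direction, so averaging \<open>m \<ge> s\<close> times
  produces functions on which \<open>(-\<Delta>)\<^sup>s\<^sup>/\<^sup>2\<close> is defined.\<close>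

definition box_kernel :: "'a::euclidean_space \<Rightarrow> real" where
  "box_kernel z = (\<Prod>b\<in>Basis. indicator {- 1..1} (z \<bullet> b) / 2)"

definition box_symbol :: "'a::euclidean_space \<Rightarrow> complex" where
  "box_symbol \<zeta> = (\<integral>z. complex_of_real (box_kernel z) * cis (\<zeta> \<bullet> z) \<partial>lborel)"

lemma box_kernel_measurable [measurable]: "box_kernel \<in> borel_measurable borel"
  unfolding box_kernel_def[abs_def] by measurable

lemma box_kernel_nonneg: "0 \<le> box_kernel z"
  unfolding box_kernel_def by (intro prod_nonneg) auto

lemma box_kernel_support:
  fixes z :: "'a::euclidean_space"
  assumes "box_kernel z \<noteq> 0"
  shows "norm z \<le> real DIM('a)"
proof -
  have "\<bar>z \<bullet> b\<bar> \<le> 1" if "b \<in> Basis" for b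
    using assms that by (auto simp: box_kernel_def indicator_def abs_le_iff split: if_splits)
  then have "(\<Sum>b\<in>Basis. \<bar>z \<bullet> b\<bar>) \<le> (\<Sum>b\<in>(Basis :: 'a set). 1)" by (intro sum_mono)
  then show ?thesis using norm_le_l1[of z] by simp
qed

text \<open>The integral equals \<open>sin a / a\<close>.\<close>

lemma interval_fourier:
  fixes a :: real
  shows "integrable lborel (\<lambda>t. complex_of_real (indicator {- 1..1} t / 2) * cis (a * t))"
    and "norm (\<integral>t. complex_of_real (indicator {- 1..1} t / 2) * cis (a * t) \<partial>lborel) \<le> 1"
    and "\<bar>a\<bar> * norm (\<integral>t. complex_of_real (indicator {- 1..1} t / 2) * cis (a * t) \<partial>lborel) \<le> 1"
proof -
  let ?k = "\<lambda>t :: real. indicator {- 1..1} t / 2 :: real"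
  have k: "integrable lborel ?k" by (intro integrable_divide integrable_real_indicator) auto
  show i: "integrable lborel (\<lambda>t. complex_of_real (?k t) * cis (a * t))"
    by (rule Bochner_Integration.integrable_bound[OF k]) (auto simp: norm_mult)
  have "norm (\<integral>t. complex_of_real (?k t) * cis (a * t) \<partial>lborel)
      \<le> (\<integral>t. norm (complex_of_real (?k t) * cis (a * t)) \<partial>lborel)" by (rule integral_norm_bound)
  also have "\<dots> = (\<integral>t. ?k t \<partial>lborel)" by (simp add: norm_mult)
  also have "\<dots> = 1" by simp
  finally show "norm (\<integral>t. complex_of_real (?k t) * cis (a * t) \<partial>lborel) \<le> 1" .
  show "\<bar>a\<bar> * norm (\<integral>t. complex_of_real (?k t) * cis (a * t) \<partial>lborel) \<le> 1"
  proof (cases "a = 0")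
    case False
    let ?F = "\<lambda>t. cis (a * t) / (2 * \<i> * complex_of_real a)"
    have "(\<integral>t. indicator {- 1..1} t *\<^sub>R (cis (a * t) / 2) \<partial>lborel) = ?F 1 - ?F (- 1)"
    proof (rule integral_FTC_Icc)
      show "continuous_on {- 1..1} (\<lambda>t. cis (a * t) / 2)" by (intro continuous_intros) auto
      fix t :: real
      show "(?F has_vector_derivative cis (a * t) / 2) (at t within {- 1..1})"
      proof -
        let ?G = "\<lambda>z. exp (\<i> * (complex_of_real a * z)) / (2 * \<i> * complex_of_real a)"
        have "(?G has_field_derivative exp (\<i> * (complex_of_real a * complex_of_real t)) / 2) (at (complex_of_real t))"
          using False by (auto intro!: derivative_eq_intros)
        then have "((\<lambda>t. ?G (complex_of_real t)) has_vector_derivative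
            exp (\<i> * (complex_of_real a * complex_of_real t)) / 2) (at t within {- 1..1})"
          by (rule has_vector_derivative_real_field)
        then show ?thesis by (simp add: cis_conv_exp)
      qed
    qed simp
    also have "(\<lambda>t. indicator {- 1..1} t *\<^sub>R (cis (a * t) / 2)) = (\<lambda>t. complex_of_real (?k t) * cis (a * t))"
      by (auto simp: indicator_def)
    finally have "norm (\<integral>t. complex_of_real (?k t) * cis (a * t) \<partial>lborel) \<le> norm (?F 1) + norm (?F (- 1))"
      by (simp only: norm_triangle_ineq4)
    also have "\<dots> = 1 / \<bar>a\<bar>" by (simp add: norm_divide norm_mult)
    finally show ?thesis using False by (simp add: field_simps)
  qed simp
qed

lemma box_symbol_product:
  fixes \<zeta> :: "'a::euclidean_space"
  shows "integrable lborel (\<lambda>z :: 'a. complex_of_real (box_kernel z) * cis (\<zeta> \<bullet> z))"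
    and "box_symbol \<zeta> = (\<Prod>b\<in>Basis. \<integral>t. complex_of_real (indicator {- 1..1} t / 2) * cis ((\<zeta> \<bullet> b) * t) \<partial>lborel)"
proof -
  let ?f = "\<lambda>b t. complex_of_real (indicator {- 1..1} t / 2) * cis ((\<zeta> \<bullet> b) * t)"
  have e: "complex_of_real (box_kernel z) * cis (\<zeta> \<bullet> z) = (\<Prod>b\<in>Basis. ?f b (z \<bullet> b))" for z
    by (simp add: box_kernel_def euclidean_inner[of \<zeta> z] cis_sum prod.distrib prod_dividef)
  show "integrable lborel (\<lambda>z :: 'a. complex_of_real (box_kernel z) * cis (\<zeta> \<bullet> z))"
    unfolding e by (rule lborel_product_integral(1)) (rule interval_fourier(1))
  show "box_symbol \<zeta> = (\<Prod>b\<in>Basis. \<integral>t. ?f b t \<partial>lborel)"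
    unfolding box_symbol_def e by (rule lborel_product_integral(2)) (rule interval_fourier(1))
qed

lemma box_kernel_integral:
  "integrable lborel (box_kernel :: 'a::euclidean_space \<Rightarrow> real)" "(\<integral>z. box_kernel (z :: 'a) \<partial>lborel) = 1"
proof -
  have "integrable lborel (\<lambda>z :: 'a. complex_of_real (box_kernel z))"
    using box_symbol_product(1)[of "0 :: 'a"] by simp
  then show i: "integrable lborel (box_kernel :: 'a \<Rightarrow> real)" unfolding complex_of_real_integrable_eq .
  have "(\<integral>t. complex_of_real (indicator {- 1..1} t / 2) \<partial>(lborel :: real measure)) = 1"
    unfolding integral_complex_of_real by simp
  then have "box_symbol (0 :: 'a) = 1" by (simp add: box_symbol_product(2))
  then have "complex_of_real (\<integral>z. box_kernel (z :: 'a) \<partial>lborel) = 1"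
    by (simp add: box_symbol_def)
  then show "(\<integral>z. box_kernel (z :: 'a) \<partial>lborel) = 1" by simp
qed

lemma norm_box_symbol_le: "norm (box_symbol \<zeta>) \<le> 1"
  unfolding box_symbol_product(2) prod_norm[symmetric]
  by (intro prod_le_1 conjI norm_ge_zero interval_fourier(2))

text \<open>Each coordinate of \<open>\<zeta>\<close> is compensated by its own factor of the symbol.\<close>

lemma box_symbol_decay: "norm \<zeta> * norm (box_symbol (\<zeta> :: 'a::euclidean_space)) \<le> real DIM('a)"
proof -
  let ?h = "\<lambda>b. \<integral>t. complex_of_real (indicator {- 1..1} t / 2) * cis ((\<zeta> \<bullet> b) * t) \<partial>lborel"
  have "\<bar>\<zeta> \<bullet> b\<bar> * norm (box_symbol \<zeta>) \<le> 1" if b: "b \<in> Basis" for b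
  proof -
    have "norm (box_symbol \<zeta>) = norm (?h b) * (\<Prod>c\<in>Basis - {b}. norm (?h c))"
      unfolding box_symbol_product(2) prod_norm[symmetric] using b by (intro prod.remove) auto
    also have "\<dots> \<le> norm (?h b) * 1"
      by (intro mult_left_mono prod_le_1 conjI norm_ge_zero interval_fourier(2))
    finally have "\<bar>\<zeta> \<bullet> b\<bar> * norm (box_symbol \<zeta>) \<le> \<bar>\<zeta> \<bullet> b\<bar> * norm (?h b)"
      by (intro mult_left_mono) auto
    also have "\<dots> \<le> 1" by (rule interval_fourier(3))
    finally show ?thesis .
  qed
  then have "(\<Sum>b\<in>Basis. \<bar>\<zeta> \<bullet> b\<bar> * norm (box_symbol \<zeta>)) \<le> (\<Sum>b\<in>(Basis :: 'a set). 1)"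
    by (intro sum_mono)
  moreover have "norm \<zeta> * norm (box_symbol \<zeta>) \<le> (\<Sum>b\<in>Basis. \<bar>\<zeta> \<bullet> b\<bar>) * norm (box_symbol \<zeta>)"
    by (intro mult_right_mono norm_le_l1) auto
  ultimately show ?thesis by (simp add: sum_distrib_right)
qed

lemma box_symbol_measurable [measurable]: "box_symbol \<in> borel_measurable borel"
  unfolding box_symbol_def[abs_def] by measurable

lemma box_symbol_tendsto:
  fixes \<zeta> :: "'a::euclidean_space"
  assumes e: "e \<longlonglongrightarrow> 0"
  shows "(\<lambda>n. box_symbol (e n *\<^sub>R \<zeta>)) \<longlonglongrightarrow> 1"
proof -
  have "(\<lambda>n. \<integral>z. complex_of_real (box_kernel z) * cis ((e n *\<^sub>R \<zeta>) \<bullet> z) \<partial>lborel)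
      \<longlonglongrightarrow> (\<integral>z. complex_of_real (box_kernel (z :: 'a)) \<partial>lborel)"
  proof (rule integral_dominated_convergence[where w=box_kernel])
    show "AE z in lborel. (\<lambda>n. complex_of_real (box_kernel z) * cis ((e n *\<^sub>R \<zeta>) \<bullet> z))
        \<longlonglongrightarrow> complex_of_real (box_kernel z)"
    proof (rule AE_I2)
      fix z :: 'a
      have "(\<lambda>n. cis ((e n *\<^sub>R \<zeta>) \<bullet> z)) \<longlonglongrightarrow> cis ((0 *\<^sub>R \<zeta>) \<bullet> z)"
        unfolding cis_conv_exp by (intro tendsto_intros e)
      then show "(\<lambda>n. complex_of_real (box_kernel z) * cis ((e n *\<^sub>R \<zeta>) \<bullet> z))
          \<longlonglongrightarrow> complex_of_real (box_kernel z)"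
        using tendsto_mult_left[of _ 1 sequentially "complex_of_real (box_kernel z)"] by simp
    qed
    show "AE z in lborel. norm (complex_of_real (box_kernel z) * cis ((e n *\<^sub>R \<zeta>) \<bullet> z)) \<le> box_kernel z" for n
      by (simp add: norm_mult box_kernel_nonneg)
  qed (simp_all add: box_kernel_integral)
  then show ?thesis by (simp add: box_symbol_def box_kernel_integral)
qed

definition box_average :: "real \<Rightarrow> ('a::euclidean_space \<Rightarrow> real) \<Rightarrow> 'a \<Rightarrow> real" where
  "box_average e v x = (\<integral>z. v (x + e *\<^sub>R z) * box_kernel z \<partial>lborel)"

definition bounded_supported :: "real \<Rightarrow> 'a set \<Rightarrow> ('a::euclidean_space \<Rightarrow> real) \<Rightarrow> bool" where
  "bounded_supported M K v \<longleftrightarrow> v \<in> borel_measurable borel \<and> (\<forall>x. \<bar>v x\<bar> \<le> M) \<and> (\<forall>x. x \<notin> K \<longrightarrow> v x = 0)"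

lemma bounded_supported_integrable:
  assumes v: "bounded_supported M K v" and K: "bounded K"
  shows "integrable lborel v" "integrable lborel (\<lambda>x. (norm (v x))\<^sup>2)"
proof -
  obtain R where "\<forall>x\<in>K. norm x \<le> R" using K unfolding bounded_pos by blast
    then have R: "K \<subseteq> cball 0 R" by auto
  have vm: "v \<in> borel_measurable borel" using v by (simp add: bounded_supported_def)
  have le: "norm (v x) \<le> M * indicator (cball 0 R) x" for x
    using v R by (cases "x \<in> cball 0 R") (auto simp: bounded_supported_def)
  show "integrable lborel v" "integrable lborel (\<lambda>x. (norm (v x))\<^sup>2)"
    using bounded_support_integrable[OF vm le] by auto
qed

lemma bounded_supported_square_integrable:
  assumes v: "bounded_supported M K v" and K: "bounded K"
  shows "v \<in> square_integrable" "(\<lambda>x. complex_of_real (v x)) \<in> L1L2"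
proof -
  have vm [measurable]: "v \<in> borel_measurable borel" using v by (simp add: bounded_supported_def)
  have vl: "v \<in> borel_measurable lebesgue" by (rule measurable_completion) simp
  have i: "integrable lebesgue v \<longleftrightarrow> integrable lborel v" by (rule integrable_completion) simp
  have i2: "integrable lebesgue (\<lambda>x. (norm (v x))\<^sup>2) \<longleftrightarrow> integrable lborel (\<lambda>x. (norm (v x))\<^sup>2)"
    by (rule integrable_completion) simp
  show vs: "v \<in> square_integrable"
    using bounded_supported_integrable[OF v K] vl i2 by (simp add: square_integrable_def)
  then show "(\<lambda>x. complex_of_real (v x)) \<in> L1L2"
    using bounded_supported_integrable[OF v K] i
    by (simp add: L1L2_def of_real_square_integrable complex_of_real_integrable_eq)
qed

text \<open>The points of the cube have norm at most \<open>DIM('a)\<close>, so an average of width \<open>e\<close> involves only points at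
  distance at most \<open>e DIM('a)\<close>.\<close>

lemma bounded_supported_box_average:
  fixes v :: "'a::euclidean_space \<Rightarrow> real"
  assumes v: "bounded_supported M K v" and e: "e > 0"
    and K': "\<And>x y. x \<in> K \<Longrightarrow> dist x y \<le> e * real DIM('a) \<Longrightarrow> y \<in> K'"
  shows "bounded_supported M K' (box_average e v)"
proof -
  have [measurable]: "v \<in> borel_measurable borel" using v by (simp add: bounded_supported_def)
  have vM: "\<bar>v x\<bar> \<le> M" for x using v by (simp add: bounded_supported_def)
  have "box_average e v \<in> borel_measurable borel"
    unfolding box_average_def[abs_def] by measurable
  moreover have "\<bar>box_average e v x\<bar> \<le> M" for x
  proof -
    have le: "norm (v (x + e *\<^sub>R z) * box_kernel z) \<le> M * box_kernel z" for z
      using vM[of "x + e *\<^sub>R z"] box_kernel_nonneg[of z] by (simp add: abs_mult mult_right_mono)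
    have kM: "integrable lborel (\<lambda>z :: 'a. M * box_kernel z)"
      by (rule integrable_mult_right[OF box_kernel_integral(1)])
    have "integrable lborel (\<lambda>z. v (x + e *\<^sub>R z) * box_kernel z)"
      by (rule Bochner_Integration.integrable_bound[OF kM])
        (measurable, use order_trans[OF le abs_ge_self] in simp)
    then have "norm (box_average e v x) \<le> (\<integral>z. M * box_kernel (z :: 'a) \<partial>lborel)"
      unfolding box_average_def using kM le by (rule Bochner_Integration.integral_norm_bound_integral)
    then show ?thesis by (simp add: box_kernel_integral)
  qed
  moreover have "box_average e v x = 0" if "x \<notin> K'" for x
  proof -
    have "v (x + e *\<^sub>R z) * box_kernel z = 0" for z
    proof (rule ccontr)
      assume "v (x + e *\<^sub>R z) * box_kernel z \<noteq> 0"
      then have "x + e *\<^sub>R z \<in> K" "norm z \<le> real DIM('a)"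
        using v box_kernel_support[of z] by (auto simp: bounded_supported_def)
      then have "x \<in> K'" using e by (intro K'[of "x + e *\<^sub>R z"]) (auto simp: dist_norm)
      then show False using that by simp
    qed
    then show ?thesis unfolding box_average_def by (simp only: Bochner_Integration.integral_zero)
  qed
  ultimately show ?thesis by (simp add: bounded_supported_def)
qed

text \<open>By Fubini, since a translation by \<open>e z\<close> becomes multiplication by \<open>cis (e \<xi> \<bullet> z)\<close>.\<close>

lemma fourier_integral_box_average:
  fixes v :: "'a::euclidean_space \<Rightarrow> real"
  assumes v: "v \<in> borel_measurable borel" "integrable lborel v"
  shows "fourier_integral (- 1) (\<lambda>x. complex_of_real (box_average e v x)) \<xi>
    = box_symbol (e *\<^sub>R \<xi>) * fourier_integral (- 1) (\<lambda>x. complex_of_real (v x)) \<xi>"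
proof -
  note v(1) [measurable]
  let ?k = "\<lambda>(z, x). complex_of_real (v (x + e *\<^sub>R z) * box_kernel z) * cis (- (\<xi> \<bullet> x))"
  have shift: "integrable lborel (\<lambda>x. v (x + e *\<^sub>R z))" for z
    using lborel_affine_integral(2)[of v 1 "e *\<^sub>R z"] v by (simp add: add.commute)
  have shift_norm: "(\<integral>x. \<bar>v (x + e *\<^sub>R z)\<bar> \<partial>lborel) = (\<integral>x. \<bar>v x\<bar> \<partial>lborel)" for z
    using lborel_affine_integral(1)[of "\<lambda>x. \<bar>v x\<bar>" 1 "e *\<^sub>R z"] by (simp add: add.commute)
  have k: "integrable (lborel \<Otimes>\<^sub>M lborel) ?k"
  proof (rule lborel_pair.Fubini_integrable)
    show "?k \<in> borel_measurable (lborel \<Otimes>\<^sub>M lborel)" by measurable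
    have "integrable lborel (\<lambda>x. complex_of_real (v (x + e *\<^sub>R z) * box_kernel z) * cis (- (\<xi> \<bullet> x)))" for z
      using shift[of z] by (intro integrable_times_cis) (auto simp: complex_of_real_integrable_eq simp del: of_real_mult)
    then show "AE z in lborel. integrable lborel (\<lambda>x. ?k (z, x))" by simp
    have "(\<integral>x. norm (?k (z, x)) \<partial>lborel) = (\<integral>x. \<bar>v x\<bar> \<partial>lborel) * box_kernel z" for z
      using box_kernel_nonneg[of z] by (simp add: norm_mult abs_mult shift_norm)
    then show "integrable lborel (\<lambda>z. \<integral>x. norm (?k (z, x)) \<partial>lborel)"
      by (simp add: box_kernel_integral)
  qed
  have inner_z: "(\<integral>z. ?k (z, x) \<partial>lborel) = complex_of_real (box_average e v x) * cis (- 1 * (\<xi> \<bullet> x))" for x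
    unfolding box_average_def
    by (simp only: split integral_mult_left_zero integral_complex_of_real) simp
  have inner_x: "(\<integral>x. ?k (z, x) \<partial>lborel) = (complex_of_real (box_kernel z) * cis ((e *\<^sub>R \<xi>) \<bullet> z))
      * fourier_integral (- 1) (\<lambda>x. complex_of_real (v x)) \<xi>" for z
  proof -
    have "fourier_integral (- 1) (\<lambda>x. complex_of_real (v x)) \<xi>
        = (\<integral>x. complex_of_real (v (e *\<^sub>R z + x)) * cis (- (\<xi> \<bullet> (e *\<^sub>R z + x))) \<partial>lborel)"
      unfolding fourier_integral_def
      using lborel_affine_integral(1)[of "\<lambda>x. complex_of_real (v x) * cis (- (\<xi> \<bullet> x))" 1 "e *\<^sub>R z"] by simp
    then have "(complex_of_real (box_kernel z) * cis ((e *\<^sub>R \<xi>) \<bullet> z)) * fourier_integral (- 1) (\<lambda>x. complex_of_real (v x)) \<xi>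
        = (\<integral>x. (complex_of_real (box_kernel z) * cis ((e *\<^sub>R \<xi>) \<bullet> z))
            * (complex_of_real (v (e *\<^sub>R z + x)) * cis (- (\<xi> \<bullet> (e *\<^sub>R z + x)))) \<partial>lborel)"
      by (simp only: integral_mult_right_zero)
    also have "\<dots> = (\<integral>x. ?k (z, x) \<partial>lborel)"
    proof (intro Bochner_Integration.integral_cong refl)
      fix x
      have "cis ((e *\<^sub>R \<xi>) \<bullet> z) * cis (- (\<xi> \<bullet> (e *\<^sub>R z + x))) = cis (- (\<xi> \<bullet> x))"
        by (simp add: cis_mult inner_add_right)
      then show "(complex_of_real (box_kernel z) * cis ((e *\<^sub>R \<xi>) \<bullet> z))
            * (complex_of_real (v (e *\<^sub>R z + x)) * cis (- (\<xi> \<bullet> (e *\<^sub>R z + x)))) = ?k (z, x)"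
        by (simp add: add.commute mult_ac flip: \<open>cis ((e *\<^sub>R \<xi>) \<bullet> z) * cis (- (\<xi> \<bullet> (e *\<^sub>R z + x))) = cis (- (\<xi> \<bullet> x))\<close>)
    qed
    finally show ?thesis by simp
  qed
  have "fourier_integral (- 1) (\<lambda>x. complex_of_real (box_average e v x)) \<xi> = (\<integral>x. \<integral>z. ?k (z, x) \<partial>lborel \<partial>lborel)"
    unfolding fourier_integral_def inner_z ..
  also have "\<dots> = (\<integral>z. \<integral>x. ?k (z, x) \<partial>lborel \<partial>lborel)"
    using lborel_pair.Fubini_integral[of "\<lambda>z x. ?k (z, x)"] k by simp
  also have "\<dots> = box_symbol (e *\<^sub>R \<xi>) * fourier_integral (- 1) (\<lambda>x. complex_of_real (v x)) \<xi>"
    unfolding inner_x box_symbol_def by (rule integral_mult_left_zero)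
  finally show ?thesis .
qed

lemma fourier_box_average_power:
  fixes v :: "'a::euclidean_space \<Rightarrow> real"
  assumes v: "bounded_supported M K v" and K: "bounded K" and e: "e > 0"
    and K': "bounded K'" "\<And>x y. x \<in> K \<Longrightarrow> dist x y \<le> real m * e * real DIM('a) \<Longrightarrow> y \<in> K'"
  shows "bounded_supported M K' ((box_average e ^^ m) v)"
    and "fourier (- 1) (\<lambda>x. complex_of_real ((box_average e ^^ m) v x)) \<xi>
      = box_symbol (e *\<^sub>R \<xi>) ^ m * fourier (- 1) (\<lambda>x. complex_of_real (v x)) \<xi>"
proof -
  (* After j averagings the support lies in this neighbourhood of K. *)
  define N where "N j = {y. \<exists>x\<in>K. dist x y \<le> real j * e * real DIM('a)}" for j :: nat
  have N_bounded: "bounded (N j)" for j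
  proof -
    obtain R where "\<forall>x\<in>K. norm x \<le> R" using K unfolding bounded_pos by blast
    then have R: "K \<subseteq> cball 0 R" by auto
    have "N j \<subseteq> cball 0 (R + real j * e * real DIM('a))"
    proof
      fix y assume "y \<in> N j"
      then obtain x where "x \<in> K" "dist x y \<le> real j * e * real DIM('a)" by (auto simp: N_def)
      then show "y \<in> cball 0 (R + real j * e * real DIM('a))"
        using R dist_triangle[of 0 y x] by force
    qed
    then show ?thesis by (rule bounded_subset[OF bounded_cball])
  qed
  have it: "bounded_supported M (N j) ((box_average e ^^ j) v)
      \<and> (\<forall>\<xi>. fourier_integral (- 1) (\<lambda>x. complex_of_real ((box_average e ^^ j) v x)) \<xi>
        = box_symbol (e *\<^sub>R \<xi>) ^ j * fourier_integral (- 1) (\<lambda>x. complex_of_real (v x)) \<xi>)" for j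
  proof (induction j)
    case 0
    have "K \<subseteq> N 0" by (auto simp: N_def)
    then show ?case using v by (auto simp: bounded_supported_def)
  next
    case (Suc j)
    let ?w = "(box_average e ^^ j) v"
    have w: "bounded_supported M (N j) ?w" using Suc by simp
    have "bounded_supported M (N (Suc j)) (box_average e ?w)"
    proof (rule bounded_supported_box_average[OF w e])
      fix x y assume "x \<in> N j" and xy: "dist x y \<le> e * real DIM('a)"
      then obtain a where a: "a \<in> K" "dist a x \<le> real j * e * real DIM('a)" by (auto simp: N_def)
      have "dist a y \<le> real j * e * real DIM('a) + e * real DIM('a)"
        using dist_triangle[of a y x] a(2) xy by linarith
      then show "y \<in> N (Suc j)" using a(1) by (auto simp: N_def algebra_simps)
    qed
    moreover have "?w \<in> borel_measurable borel" using w by (simp add: bounded_supported_def)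
    ultimately show ?case
      using Suc fourier_integral_box_average[OF _ bounded_supported_integrable(1)[OF w N_bounded]]
      by (simp add: mult.assoc)
  qed
  have "N m \<subseteq> K'" using K'(2) by (auto simp: N_def)
  then show bs: "bounded_supported M K' ((box_average e ^^ m) v)"
    using it[of m] by (auto simp: bounded_supported_def)
  have "(\<lambda>x. complex_of_real ((box_average e ^^ m) v x)) \<in> borel_measurable borel"
    "(\<lambda>x. complex_of_real (v x)) \<in> borel_measurable borel"
    using bs v by (auto simp: bounded_supported_def)
  then show "fourier (- 1) (\<lambda>x. complex_of_real ((box_average e ^^ m) v x)) \<xi>
      = box_symbol (e *\<^sub>R \<xi>) ^ m * fourier (- 1) (\<lambda>x. complex_of_real (v x)) \<xi>"
    using it[of m] by (simp add: fourier_eq_fourier_integral)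
qed

text \<open>The \<open>m\<close>-fold averages with \<open>m \<ge> s\<close> lie in the domain because \<open>|\<xi>|\<^sup>s\<close> times the \<open>m\<close>-th power of the symbol is
  bounded. They stay supported in \<open>\<Omega>\<close> for small \<open>e\<close>, and they converge as \<open>e \<rightarrow> 0\<close> because their symbols are
  bounded by \<open>1\<close> and tend to \<open>1\<close>.\<close>

lemma bounded_supported_approximable:
  fixes v :: "'a::euclidean_space \<Rightarrow> real"
  assumes s: "s > 0" and v: "bounded_supported M K v" and \<Omega>: "bounded \<Omega>" and \<delta>: "\<delta> > 0"
    and K: "\<And>x y. x \<in> K \<Longrightarrow> dist x y \<le> \<delta> \<Longrightarrow> y \<in> \<Omega>"
  shows "L2_class v \<in> closure (Hs_classes s \<Omega>)"
proof -
  have "K \<subseteq> \<Omega>"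
  proof
    fix x assume "x \<in> K"
    then show "x \<in> \<Omega>" using K[of x x] \<delta> by simp
  qed
  then have Kb: "bounded K" using \<Omega> bounded_subset by blast
  (* Since m >= s, the m-th power of the symbol absorbs the weight; m > 0 keeps D positive. *)
  define m where "m = Suc (nat \<lceil>s\<rceil>)"
  have m: "s \<le> real m" by (simp add: m_def) linarith
  define D where "D = real m * real DIM('a)"
  have D: "D > 0" by (simp add: D_def m_def)
  (* m averagings of width e n enlarge the support by at most D e n <= \<delta>. *)
  define e where "e n = \<delta> / D * inverse (real (Suc n))" for n
  have e_pos: "e n > 0" for n using \<delta> D by (simp add: e_def)
  have e_le: "e n * D \<le> \<delta>" for n
  proof -
    have "e n * D = \<delta> * inverse (real (Suc n))" using D by (simp add: e_def)
    also have "\<dots> \<le> \<delta> * 1" using \<delta> by (intro mult_left_mono) (auto simp: inverse_le_1_iff)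
    finally show ?thesis by simp
  qed
  have "e \<longlonglongrightarrow> \<delta> / D * 0" unfolding e_def[abs_def] by (intro tendsto_intros LIMSEQ_inverse_real_of_nat)
  then have e_lim: "e \<longlonglongrightarrow> 0" by simp
  define w where "w n = (box_average (e n) ^^ m) v" for n
  let ?c = "\<lambda>w x. complex_of_real (w x)"
  define g where "g = fourier (- 1) (?c v)"
  have w: "bounded_supported M \<Omega> (w n)" and gw: "fourier (- 1) (?c (w n)) = (\<lambda>\<xi>. box_symbol (e n *\<^sub>R \<xi>) ^ m * g \<xi>)" for n
  proof -
    have K': "y \<in> \<Omega>" if "x \<in> K" "dist x y \<le> real m * e n * real DIM('a)" for x y
      using K[OF that(1)] that(2) e_le[of n] by (simp add: D_def mult_ac)
    show "bounded_supported M \<Omega> (w n)"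
      unfolding w_def using v Kb e_pos \<Omega> K' by (rule fourier_box_average_power(1))
    show "fourier (- 1) (?c (w n)) = (\<lambda>\<xi>. box_symbol (e n *\<^sub>R \<xi>) ^ m * g \<xi>)"
      unfolding w_def g_def using v Kb e_pos \<Omega> K' by (intro ext fourier_box_average_power(2))
  qed
  have vs: "v \<in> square_integrable" "?c v \<in> L1L2" using bounded_supported_square_integrable[OF v Kb] by auto
  have ws: "w n \<in> square_integrable" "?c (w n) \<in> L1L2" for n
    using bounded_supported_square_integrable[OF w \<Omega>] by auto
  have gs: "g \<in> square_integrable" unfolding g_def by (intro fourier_square_integrable vs) simp
  have gws: "(\<lambda>\<xi>. box_symbol (e n *\<^sub>R \<xi>) ^ m * g \<xi>) \<in> square_integrable" for n
    unfolding gw[symmetric] by (intro fourier_square_integrable ws) simp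
  have Fv: "real_fourier (L2_class v) = L2_class g"
    unfolding real_fourier_class[OF vs(1)] g_def by (intro L2_fourier_L1L2 vs) simp
  have Fw: "real_fourier (L2_class (w n)) = L2_class (\<lambda>\<xi>. box_symbol (e n *\<^sub>R \<xi>) ^ m * g \<xi>)" for n
    unfolding real_fourier_class[OF ws(1)] gw[symmetric] by (intro L2_fourier_L1L2 ws) simp
  have gm: "g \<in> borel_measurable lebesgue" using gs by (rule square_integrableD)
  have bm: "(\<lambda>\<xi>. box_symbol (c *\<^sub>R \<xi>) ^ m) \<in> borel_measurable lebesgue" for c :: real
    by (rule measurable_completion) measurable
  have in_V: "L2_class (w n) \<in> Hs_classes s \<Omega>" for n
  proof -
    let ?C = "max 1 ((real DIM('a) / e n) ^ m)"
    have bound: "norm \<xi> powr s * norm (box_symbol (e n *\<^sub>R \<xi>) ^ m) \<le> ?C" for \<xi> :: 'a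
    proof (cases "norm \<xi> \<le> 1")
      case True
      have "norm \<xi> powr s \<le> 1" using True s by (intro powr_le1) auto
      moreover have "norm (box_symbol (e n *\<^sub>R \<xi>) ^ m) \<le> 1"
        unfolding norm_power by (intro power_le_one norm_box_symbol_le) auto
      ultimately have "norm \<xi> powr s * norm (box_symbol (e n *\<^sub>R \<xi>) ^ m) \<le> 1 * 1" by (intro mult_mono) auto
      then show ?thesis by simp
    next
      case False
      then have "norm \<xi> powr s \<le> norm \<xi> powr real m" using m by (intro powr_mono) auto
      also have "\<dots> = norm \<xi> ^ m" using False by (intro powr_realpow) auto
      finally have "norm \<xi> powr s * norm (box_symbol (e n *\<^sub>R \<xi>) ^ m)
          \<le> norm \<xi> ^ m * norm (box_symbol (e n *\<^sub>R \<xi>) ^ m)" by (intro mult_right_mono) auto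
      also have "\<dots> = (norm \<xi> * norm (box_symbol (e n *\<^sub>R \<xi>))) ^ m"
        by (simp add: norm_power power_mult_distrib)
      also have "\<dots> \<le> (real DIM('a) / e n) ^ m"
        using box_symbol_decay[of "e n *\<^sub>R \<xi>"] e_pos[of n]
        by (intro power_mono) (auto simp: pos_le_divide_eq mult_ac)
      finally show ?thesis by simp
    qed
    have "(\<lambda>\<xi>. complex_of_real (norm \<xi> powr s) * (box_symbol (e n *\<^sub>R \<xi>) ^ m * g \<xi>)) \<in> square_integrable"
    proof (rule square_integrable_bound)
      show "integrable lebesgue (\<lambda>\<xi>. ?C\<^sup>2 * (norm (g \<xi>))\<^sup>2)"
        using square_integrableD(2)[OF gs] by (rule integrable_mult_right)
      show "(\<lambda>\<xi>. complex_of_real (norm \<xi> powr s) * (box_symbol (e n *\<^sub>R \<xi>) ^ m * g \<xi>)) \<in> borel_measurable lebesgue"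
        using gm bm[of "e n"] norm_powr_measurable[of s] by measurable
      show "AE \<xi> in lebesgue. (norm (complex_of_real (norm \<xi> powr s) * (box_symbol (e n *\<^sub>R \<xi>) ^ m * g \<xi>)))\<^sup>2
          \<le> ?C\<^sup>2 * (norm (g \<xi>))\<^sup>2"
      proof (rule AE_I2)
        fix \<xi> :: 'a
        have "norm (complex_of_real (norm \<xi> powr s) * (box_symbol (e n *\<^sub>R \<xi>) ^ m * g \<xi>))
            = (norm \<xi> powr s * norm (box_symbol (e n *\<^sub>R \<xi>) ^ m)) * norm (g \<xi>)" by (simp add: norm_mult)
        also have "\<dots> \<le> ?C * norm (g \<xi>)" by (intro mult_right_mono bound) auto
        finally show "(norm (complex_of_real (norm \<xi> powr s) * (box_symbol (e n *\<^sub>R \<xi>) ^ m * g \<xi>)))\<^sup>2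
          \<le> ?C\<^sup>2 * (norm (g \<xi>))\<^sup>2"
          unfolding power_mult_distrib[symmetric] by (intro power_mono) auto
      qed
    qed
    from frac_graph_exists[OF gws Fw this] show ?thesis
      using w[of n] vanishes_outside_class[OF ws(1), of \<Omega> n]
      by (auto simp: Hs_classes_def bounded_supported_def)
  qed
  have "(\<lambda>n. L2_class (w n)) \<longlonglongrightarrow> L2_class v"
  proof -
    have "(\<lambda>n. \<integral>\<xi>. (norm (box_symbol (e n *\<^sub>R \<xi>) ^ m * g \<xi> - g \<xi>))\<^sup>2 \<partial>lebesgue) \<longlonglongrightarrow> (\<integral>\<xi>. 0 \<partial>(lebesgue :: 'a measure))"
    proof (rule integral_dominated_convergence)
      show "integrable lebesgue (\<lambda>\<xi>. 4 * (norm (g \<xi>))\<^sup>2)"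
        using square_integrableD(2)[OF gs] by (rule integrable_mult_right)
      show "(\<lambda>\<xi>. (norm (box_symbol (e n *\<^sub>R \<xi>) ^ m * g \<xi> - g \<xi>))\<^sup>2) \<in> borel_measurable lebesgue" for n
        using gm bm[of "e n"] by measurable
      show "AE \<xi> in lebesgue. (\<lambda>n. (norm (box_symbol (e n *\<^sub>R \<xi>) ^ m * g \<xi> - g \<xi>))\<^sup>2) \<longlonglongrightarrow> 0"
      proof (rule AE_I2)
        fix \<xi> :: 'a
        have "(\<lambda>n. (norm (box_symbol (e n *\<^sub>R \<xi>) ^ m * g \<xi> - g \<xi>))\<^sup>2) \<longlonglongrightarrow> (norm (1 ^ m * g \<xi> - g \<xi>))\<^sup>2"
          by (intro tendsto_intros box_symbol_tendsto e_lim)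
        then show "(\<lambda>n. (norm (box_symbol (e n *\<^sub>R \<xi>) ^ m * g \<xi> - g \<xi>))\<^sup>2) \<longlonglongrightarrow> 0" by simp
      qed
      show "AE \<xi> in lebesgue. norm ((norm (box_symbol (e n *\<^sub>R \<xi>) ^ m * g \<xi> - g \<xi>))\<^sup>2) \<le> 4 * (norm (g \<xi>))\<^sup>2" for n
      proof (rule AE_I2)
        fix \<xi> :: 'a
        have "norm (box_symbol (e n *\<^sub>R \<xi>) ^ m) \<le> 1"
          unfolding norm_power by (intro power_le_one norm_box_symbol_le) auto
        then have "norm (box_symbol (e n *\<^sub>R \<xi>) ^ m * g \<xi>) \<le> norm (g \<xi>)"
          using mult_right_mono[of "norm (box_symbol (e n *\<^sub>R \<xi>) ^ m)" 1 "norm (g \<xi>)"] by (simp add: norm_mult)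
        then have "norm (box_symbol (e n *\<^sub>R \<xi>) ^ m * g \<xi> - g \<xi>) \<le> 2 * norm (g \<xi>)"
          using norm_triangle_ineq4[of "box_symbol (e n *\<^sub>R \<xi>) ^ m * g \<xi>" "g \<xi>"] by simp
        from power_mono[OF this norm_ge_zero, of 2]
        show "norm ((norm (box_symbol (e n *\<^sub>R \<xi>) ^ m * g \<xi> - g \<xi>))\<^sup>2) \<le> 4 * (norm (g \<xi>))\<^sup>2"
          by (simp add: power_mult_distrib)
      qed
    qed simp
    moreover have "(\<integral>\<xi>. (norm (box_symbol (e n *\<^sub>R \<xi>) ^ m * g \<xi> - g \<xi>))\<^sup>2 \<partial>lebesgue)
        = (norm (L2_class (w n) - L2_class v))\<^sup>2" for n
      using norm_L2_class[OF square_integrable_diff[OF gws[of n] gs]]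
      by (simp add: L2_class_diff[OF gws gs] norm_real_fourier flip: Fw Fv real_fourier_diff)
    ultimately have "(\<lambda>n. sqrt ((norm (L2_class (w n) - L2_class v))\<^sup>2)) \<longlonglongrightarrow> sqrt 0"
      by (intro tendsto_real_sqrt) simp
    then show ?thesis by (simp add: tendsto_norm_zero_iff LIM_zero_iff)
  qed
  with in_V show ?thesis
    unfolding closure_sequential by (intro exI[of _ "\<lambda>n. L2_class (w n)"]) simp
qed

text \<open>A function vanishing outside \<open>\<Omega>\<close> is the limit of its truncations to the points at distance \<open>\<ge> 1 / n\<close> from
  the complement where its values are at most \<open>n\<close>; these leave room for mollification inside \<open>\<Omega>\<close>.\<close>

theorem Hs_classes_dense:
  fixes x :: "('a::euclidean_space, real) L2_space"
  assumes s: "s > 0" and \<Omega>: "open \<Omega>" "bounded \<Omega>" and x: "vanishes_outside \<Omega> x"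
  shows "x \<in> closure (Hs_classes s \<Omega>)"
proof -
  have ne: "- \<Omega> \<noteq> {}"
  proof
    assume "- \<Omega> = {}"
    then have "\<Omega> = UNIV" by auto
    then show False using \<Omega>(2) not_bounded_UNIV by simp
  qed
  define K where "K n = {t. infdist t (- \<Omega>) \<ge> inverse (real (Suc n))}" for n
  have K_closed: "closed (K n)" for n
    unfolding K_def by (intro closed_Collect_le continuous_intros)
  have K_sub: "y \<in> \<Omega>" if "t \<in> K n" "dist t y \<le> inverse (real (Suc n)) / 2" for t y n
  proof (rule ccontr)
    assume "y \<notin> \<Omega>"
    then have "infdist t (- \<Omega>) \<le> dist t y" by (intro infdist_le) auto
    moreover have "inverse (real (Suc n)) > 0" by simp
    ultimately show False using that unfolding K_def mem_Collect_eq by linarith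
  qed
  define v where "v = L2_fun x"
  have vm [measurable]: "v \<in> borel_measurable borel" and vs: "v \<in> square_integrable" by (simp_all add: v_def)
  define w where "w n t = (if t \<in> K n \<and> \<bar>v t\<bar> \<le> real n then v t else 0)" for n t
  have Km [measurable]: "K n \<in> sets borel" for n using K_closed by (rule borel_closed)
  have wm [measurable]: "w n \<in> borel_measurable borel" for n unfolding w_def[abs_def] by measurable
  have w: "bounded_supported (real n) (K n) (w n)" for n by (auto simp: bounded_supported_def w_def)
  have K_sub': "K n \<subseteq> \<Omega>" for n
  proof
    fix t assume "t \<in> K n"
    then show "t \<in> \<Omega>" using K_sub[of t n t] by simp
  qed
  have Kb: "bounded (K n)" for n using K_sub' \<Omega>(2) bounded_subset by blast
  have ws: "w n \<in> square_integrable" for n by (rule bounded_supported_square_integrable(1)[OF w Kb])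
  have cl: "L2_class (w n) \<in> closure (Hs_classes s \<Omega>)" for n
    using s w \<Omega>(2) by (rule bounded_supported_approximable[where \<delta>="inverse (real (Suc n)) / 2"])
      (use K_sub in auto)
  have vml: "v \<in> borel_measurable lebesgue" "w n \<in> borel_measurable lebesgue" for n
    using vs ws by (auto dest: square_integrableD)
  have "(\<lambda>n. \<integral>t. (norm (w n t - v t))\<^sup>2 \<partial>lebesgue) \<longlonglongrightarrow> (\<integral>t. 0 \<partial>(lebesgue :: 'a measure))"
  proof (rule integral_dominated_convergence)
    show "integrable lebesgue (\<lambda>t. (norm (v t))\<^sup>2)" using vs by (rule square_integrableD)
    show "(\<lambda>t. (norm (w n t - v t))\<^sup>2) \<in> borel_measurable lebesgue" for n using vml by measurable
    show "AE t in lebesgue. norm ((norm (w n t - v t))\<^sup>2) \<le> (norm (v t))\<^sup>2" for n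
      by (intro AE_I2) (simp add: w_def)
    show "AE t in lebesgue. (\<lambda>n. (norm (w n t - v t))\<^sup>2) \<longlonglongrightarrow> 0"
      using x unfolding vanishes_outside_def v_def[symmetric]
    proof eventually_elim
      case (elim t)
      show ?case
      proof (cases "t \<in> \<Omega>")
        case False
        then have v0: "v t = 0" using elim by simp
        then have "w n t = 0" for n by (simp add: w_def)
        then show ?thesis using v0 by simp
      next
        case True
        have "infdist t (- \<Omega>) > 0"
          using True \<Omega>(1) ne by (simp add: infdist_pos_not_in_closed closed_Compl)
        then obtain j where j: "inverse (real (Suc j)) < infdist t (- \<Omega>)" using reals_Archimedean by blast
        show ?thesis
        proof (rule tendsto_eventually, rule eventually_sequentiallyI)
          fix n assume n: "max j (nat \<lceil>\<bar>v t\<bar>\<rceil>) \<le> n"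
          have "inverse (real (Suc n)) \<le> inverse (real (Suc j))" using n by (intro le_imp_inverse_le) auto
          then have "t \<in> K n" using j unfolding K_def mem_Collect_eq by linarith
          moreover have "\<bar>v t\<bar> \<le> real n" using n by linarith
          ultimately show "(norm (w n t - v t))\<^sup>2 = 0" by (simp add: w_def)
        qed
      qed
    qed
  qed simp
  moreover have "(\<integral>t. (norm (w n t - v t))\<^sup>2 \<partial>lebesgue) = (norm (L2_class (w n) - x))\<^sup>2" for n
    using norm_L2_class[OF square_integrable_diff[OF ws vs], of n] L2_class_diff[OF ws vs, of n]
    by (simp add: v_def)
  ultimately have "(\<lambda>n. sqrt ((norm (L2_class (w n) - x))\<^sup>2)) \<longlonglongrightarrow> sqrt 0"
    by (intro tendsto_real_sqrt) simp
  then have "(\<lambda>n. L2_class (w n)) \<longlonglongrightarrow> x" by (simp add: tendsto_norm_zero_iff LIM_zero_iff)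
  with cl show ?thesis using closed_sequentially[OF closed_closure, of "\<lambda>n. L2_class (w n)"] by blast
qed

section \<open>Continuous curves as Bochner functions\<close>

text \<open>The interval is cut into \<open>n\<close> cells. Curves are sampled at the centres because these lie in the open
  interval, whereas the end points do not.\<close>

definition cell_centre :: "real \<Rightarrow> nat \<Rightarrow> nat \<Rightarrow> real" where
  "cell_centre T n j = (real j + 1 / 2) * (T / real n)"

definition cell :: "real \<Rightarrow> nat \<Rightarrow> real \<Rightarrow> nat" where
  "cell T n t = nat \<lfloor>t / (T / real n)\<rfloor>"

lemma cell_eq_iff:
  assumes "T > 0" "n > 0" "t > 0"
  shows "cell T n t = j \<longleftrightarrow> real j * (T / real n) \<le> t \<and> t < real (Suc j) * (T / real n)"
proof -
  have h: "T / real n > 0" using assms by simp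
  have "0 \<le> t / (T / real n)" using assms by simp
  then have "cell T n t = j \<longleftrightarrow> \<lfloor>t / (T / real n)\<rfloor> = int j" unfolding cell_def by linarith
  also have "\<dots> \<longleftrightarrow> real j \<le> t / (T / real n) \<and> t / (T / real n) < real j + 1"
    by (simp add: floor_eq_iff)
  also have "\<dots> \<longleftrightarrow> real j * (T / real n) \<le> t \<and> t < (real j + 1) * (T / real n)"
    using h by (simp only: pos_le_divide_eq pos_divide_less_eq)
  finally show ?thesis by (simp add: add.commute)
qed

lemma cell_less:
  assumes "T > 0" "n > 0" "t \<in> {0<..<T}"
  shows "cell T n t < n"
proof -
  have "real (cell T n t) * (T / real n) \<le> t"
    using cell_eq_iff[of T n t "cell T n t"] assms by simp
  also have "t < T" using assms by simp
  finally have "real (cell T n t) < real n" using assms by (simp add: field_simps)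
  then show ?thesis by simp
qed

lemma cell_centre_in:
  assumes "T > 0" "j < n"
  shows "cell_centre T n j \<in> {0<..<T}"
proof -
  define h where "h = T / real n"
  have h: "h > 0" using assms by (simp add: h_def)
  have "real j + 1 / 2 < real n" using assms(2) by linarith
  then have "(real j + 1 / 2) * h < real n * h" using h by (intro mult_strict_right_mono)
  moreover have "real n * h = T" using assms(2) by (simp add: h_def)
  moreover have "0 < (real j + 1 / 2) * h" using h by (intro mult_pos_pos) auto
  ultimately show ?thesis by (simp add: cell_centre_def h_def)
qed

lemma cell_centre_close:
  assumes "T > 0" "n > 0" "real j * (T / real n) \<le> t" "t \<le> real (Suc j) * (T / real n)"
  shows "\<bar>t - cell_centre T n j\<bar> \<le> T / real n"
proof -
  define h where "h = T / real n"
  have "h > 0" using assms by (simp add: h_def)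
  moreover have "real (Suc j) * h = real j * h + h" "(real j + 1 / 2) * h = real j * h + h / 2"
    by (simp_all add: algebra_simps)
  ultimately show ?thesis
    using assms(3,4) unfolding cell_centre_def h_def[symmetric] by linarith
qed

lemma cell_cell_centre:
  assumes "T > 0" "j < n"
  shows "cell T n (cell_centre T n j) = j"
proof -
  define h where "h = T / real n"
  have h: "h > 0" using assms by (simp add: h_def)
  have n: "n > 0" using assms by simp
  have pos: "cell_centre T n j > 0" using cell_centre_in[OF assms] by simp
  have "real j * h \<le> (real j + 1 / 2) * h" "(real j + 1 / 2) * h < real (Suc j) * h"
    using h by (intro mult_right_mono mult_strict_right_mono; simp)+
  then show ?thesis
    unfolding cell_eq_iff[OF assms(1) n pos] by (simp only: cell_centre_def h_def)
qed

lemma cell_measurable: "cell T n \<in> measurable (lebesgue_on S) (count_space UNIV)"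
proof -
  have "cell T n \<in> measurable borel (count_space UNIV)" unfolding cell_def[abs_def] by measurable
  then have "cell T n \<in> measurable lborel (count_space UNIV)" by simp
  then show ?thesis by (intro measurable_restrict_space1 measurable_completion)
qed

lemma simple_function_cell:
  assumes "T > 0" "n > 0"
  shows "simple_function (lebesgue_on {0<..<T}) (cell T n)"
  unfolding simple_function_def
proof (intro conjI ballI)
  have "cell T n ` {0<..<T} \<subseteq> {..<n}" using cell_less[OF assms] by auto
  then show "finite (cell T n ` space (lebesgue_on {0<..<T}))"
    by (simp, rule finite_subset) simp
  show "cell T n -` {j} \<inter> space (lebesgue_on {0<..<T}) \<in> sets (lebesgue_on {0<..<T})" for j
    by (rule measurable_sets[OF cell_measurable]) simp
qed

lemma cell_set:
  assumes T: "T > 0" "j < n"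
  shows "{t \<in> {0<..<T}. cell T n t = j} \<in> lmeasurable"
    and "measure lebesgue {t \<in> {0<..<T}. cell T n t = j} = T / real n"
proof -
  have n: "n > 0" using T by simp
  define h where "h = T / real n"
  have h: "h > 0" using T n by (simp add: h_def)
  let ?A = "{t \<in> {0<..<T}. cell T n t = j}"
  have "?A = cell T n -` {j} \<inter> space (lebesgue_on {0<..<T})" by auto
  also have "\<dots> \<in> sets (lebesgue_on {0<..<T})" by (rule measurable_sets[OF cell_measurable]) simp
  finally have A: "?A \<in> sets lebesgue" by (simp add: sets_restrict_space_iff)
  have sub: "?A \<subseteq> {real j * h..real (Suc j) * h}"
  proof
    fix t assume t: "t \<in> ?A"
    then have "t > 0" by simp
    from cell_eq_iff[OF T(1) n this, of j, folded h_def] t show "t \<in> {real j * h..real (Suc j) * h}"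
      unfolding atLeastAtMost_iff by simp
  qed
  show lm: "?A \<in> lmeasurable"
    by (rule fmeasurableI2[of "{0..T}"]) (use A in auto)
  have "real (Suc j) * h \<le> real n * h" using T(2) h by (intro mult_right_mono) auto
  also have "real n * h = T" using n by (simp add: h_def)
  finally have le_T: "real (Suc j) * h \<le> T" .
  have "{real j * h<..<real (Suc j) * h} \<subseteq> ?A"
  proof
    fix t assume t: "t \<in> {real j * h<..<real (Suc j) * h}"
    have "0 \<le> real j * h" using h by simp
    then have "0 < t" using t unfolding greaterThanLessThan_iff by linarith
    moreover have "t < T" using t le_T by simp
    ultimately show "t \<in> ?A" using cell_eq_iff[OF T(1) n, of t j, folded h_def] t by simp
  qed
  then have "measure lebesgue {real j * h<..<real (Suc j) * h} \<le> measure lebesgue ?A"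
    by (rule measure_mono_fmeasurable) (use lm in auto)
  moreover have "measure lebesgue ?A \<le> measure lebesgue {real j * h..real (Suc j) * h}"
    by (rule measure_mono_fmeasurable[OF sub]) (use A in auto)
  moreover have "measure lebesgue {real j * h<..<real (Suc j) * h} = h"
    "measure lebesgue {real j * h..real (Suc j) * h} = h"
    using h by (simp_all add: algebra_simps)
  ultimately show "measure lebesgue ?A = T / real n" unfolding h_def by linarith
qed

text \<open>The integral is defined by grouping the times according to the value of the step function, whereas the
  Riemann sum runs over the cells; cells that share a value have to be merged.\<close>

lemma X_simple_integral_cell:
  assumes T: "T > 0" "n > 0"
  shows "X_simple_integral T (\<lambda>t. f (cell_centre T n (cell T n t))) x
    = (\<Sum>j<n. T / real n * f (cell_centre T n j) x)"
proof -
  define g where "g j = f (cell_centre T n j)" for j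
  have img: "(\<lambda>t. g (cell T n t)) ` {0<..<T} = g ` {..<n}"
  proof
    show "(\<lambda>t. g (cell T n t)) ` {0<..<T} \<subseteq> g ` {..<n}" using cell_less[OF T] by auto
    show "g ` {..<n} \<subseteq> (\<lambda>t. g (cell T n t)) ` {0<..<T}"
    proof
      fix y assume "y \<in> g ` {..<n}"
      then obtain j where "j < n" "y = g j" by auto
      then show "y \<in> (\<lambda>t. g (cell T n t)) ` {0<..<T}"
        using cell_centre_in[OF T(1)] cell_cell_centre[OF T(1)] by (intro image_eqI[of _ _ "cell_centre T n j"]) auto
    qed
  qed
  have meas: "measure lebesgue {t \<in> {0<..<T}. g (cell T n t) = y} = (\<Sum>j | j \<in> {..<n} \<and> g j = y. T / real n)" for y
  proof -
    have "{t \<in> {0<..<T}. g (cell T n t) = y} = (\<Union>j\<in>{j \<in> {..<n}. g j = y}. {t \<in> {0<..<T}. cell T n t = j})"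
      using cell_less[OF T] by auto
    also have "measure lebesgue \<dots> = (\<Sum>j\<in>{j \<in> {..<n}. g j = y}. measure lebesgue {t \<in> {0<..<T}. cell T n t = j})"
    proof (rule measure_finite_Union)
      show "(\<lambda>j. {t \<in> {0<..<T}. cell T n t = j}) ` {j \<in> {..<n}. g j = y} \<subseteq> sets lebesgue"
        using fmeasurableD[OF cell_set(1)[OF T(1)]] by blast
      show "emeasure lebesgue {t \<in> {0<..<T}. cell T n t = j} \<noteq> \<infinity>" if "j \<in> {j \<in> {..<n}. g j = y}" for j
      proof -
        have "j < n" using that by simp
        from fmeasurableD2[OF cell_set(1)[OF T(1) this]] show ?thesis by simp
      qed
    qed (auto simp: disjoint_family_on_def)
    also have "\<dots> = (\<Sum>j | j \<in> {..<n} \<and> g j = y. T / real n)"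
      by (intro sum.cong refl cell_set(2)[OF T(1)]) simp
    finally show ?thesis .
  qed
  have "X_simple_integral T (\<lambda>t. g (cell T n t)) x
      = (\<Sum>y\<in>g ` {..<n}. (\<Sum>j | j \<in> {..<n} \<and> g j = y. T / real n) * y x)"
    unfolding X_simple_integral_def img meas ..
  also have "\<dots> = (\<Sum>y\<in>g ` {..<n}. \<Sum>j | j \<in> {..<n} \<and> g j = y. T / real n * g j x)"
    by (intro sum.cong refl) (simp add: sum_distrib_right)
  also have "\<dots> = (\<Sum>j<n. T / real n * g j x)"
    by (rule sum.group) auto
  finally show ?thesis by (simp add: g_def)
qed

lemma uniform_cell_approximation:
  fixes a :: "real \<Rightarrow> 'b::metric_space"
  assumes T: "T > 0" and cont: "continuous_on {0..T} a" and e: "e > 0"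
  shows "\<forall>\<^sub>F n in sequentially. \<forall>j<Suc n. \<forall>t. real j * (T / real (Suc n)) \<le> t \<longrightarrow>
    t \<le> real (Suc j) * (T / real (Suc n)) \<longrightarrow> dist (a t) (a (cell_centre T (Suc n) j)) \<le> e"
proof -
  have "uniformly_continuous_on {0..T} a"
    by (rule compact_uniformly_continuous[OF cont]) simp
  then obtain d where d: "d > 0"
    "\<And>t t'. t \<in> {0..T} \<Longrightarrow> t' \<in> {0..T} \<Longrightarrow> dist t' t < d \<Longrightarrow> dist (a t') (a t) < e"
    using e unfolding uniformly_continuous_on_def by metis
  have "(\<lambda>n. T * inverse (real (Suc n))) \<longlonglongrightarrow> T * 0"
    by (intro tendsto_intros LIMSEQ_inverse_real_of_nat)
  then have "\<forall>\<^sub>F n in sequentially. T * inverse (real (Suc n)) < d"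
    using d(1) by (intro order_tendstoD(2)) auto
  then show ?thesis
  proof eventually_elim
    case (elim n)
    show ?case
    proof (intro allI impI)
      fix j t assume j: "j < Suc n" and t: "real j * (T / real (Suc n)) \<le> t" "t \<le> real (Suc j) * (T / real (Suc n))"
      have h: "T / real (Suc n) > 0" using T by simp
      have "0 \<le> real j * (T / real (Suc n))" using h by (intro mult_nonneg_nonneg) auto
      moreover have "real (Suc j) * (T / real (Suc n)) \<le> real (Suc n) * (T / real (Suc n))"
        using j h by (intro mult_right_mono) auto
      moreover have "real (Suc n) * (T / real (Suc n)) = T" by simp
      ultimately have "t \<in> {0..T}" using t unfolding atLeastAtMost_iff by linarith
      moreover have "cell_centre T (Suc n) j \<in> {0..T}" using cell_centre_in[OF T j] by simp
      moreover have "dist t (cell_centre T (Suc n) j) < d"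
        using cell_centre_close[OF T _ t] elim by (simp add: dist_real_def divide_inverse)
      ultimately show "dist (a t) (a (cell_centre T (Suc n) j)) \<le> e" using d(2) less_imp_le by blast
    qed
  qed
qed

text \<open>The function spaces of the problem are carriers \<open>X\<close> with a seminorm \<open>N\<close>, whereas continuity and integration
  of curves are used in Banach spaces. The relation \<open>represents f k\<close> expresses that the vector \<open>k\<close> stands
  for \<open>f\<close>; it is compatible with linear combinations and dominates the seminorm. In general neither side
  determines the other: functions may differ on null sets, and a functional may be represented by several vectors.\<close>

locale vector_representation =
  fixes X :: "('x \<Rightarrow> real) set" and N :: "('x \<Rightarrow> real) \<Rightarrow> real"
    and represents :: "('x \<Rightarrow> real) \<Rightarrow> 'k::banach \<Rightarrow> bool"
  assumes represents_in: "represents f k \<Longrightarrow> f \<in> X"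
    and represents_linear: "represents f k \<Longrightarrow> represents g l \<Longrightarrow>
      represents (\<lambda>x. a * f x + b * g x) (a *\<^sub>R k + b *\<^sub>R l)"
    and represents_bound: "represents f k \<Longrightarrow> \<bar>N f\<bar> \<le> norm k"
begin

lemma represents_diff: "represents f k \<Longrightarrow> represents g l \<Longrightarrow> represents (\<lambda>x. f x - g x) (k - l)"
  using represents_linear[of f k g l 1 "-1"] by simp

lemma represents_sum:
  assumes "\<And>j. j < Suc n \<Longrightarrow> represents (f j) (k j)"
  shows "represents (\<lambda>x. \<Sum>j<Suc n. c * f j x) (\<Sum>j<Suc n. c *\<^sub>R k j)"
  using assms
proof (induction n)
  case 0
  then have "represents (f 0) (k 0)" by simp
  from represents_linear[OF this this, of c 0] show ?case by simp
next
  case (Suc n)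
  have last: "represents (f (Suc n)) (k (Suc n))" using Suc.prems by simp
  have "represents (\<lambda>x. \<Sum>j<Suc n. c * f j x) (\<Sum>j<Suc n. c *\<^sub>R k j)"
    by (rule Suc.IH, rule Suc.prems) simp
  from represents_linear[OF this last, of 1 c] show ?case by simp
qed

context
  fixes T :: real and f :: "real \<Rightarrow> 'x \<Rightarrow> real" and a :: "real \<Rightarrow> 'k"
  assumes T: "T > 0" and rep: "\<And>t. t \<in> {0<..<T} \<Longrightarrow> represents (f t) (a t)"
    and cont: "continuous_on {0..T} a"
begin

definition sampled :: "nat \<Rightarrow> real \<Rightarrow> 'x \<Rightarrow> real" where
  "sampled n t = f (cell_centre T (Suc n) (cell T (Suc n) t))"

lemma X_simple_sampled: "X_simple T X (sampled n)"
  unfolding X_simple_def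
proof
  show "simple_function (lebesgue_on {0<..<T}) (sampled n)"
    unfolding sampled_def[abs_def]
    by (rule simple_function_compose1[OF simple_function_cell[OF T]]) simp
  show "sampled n ` {0<..<T} \<subseteq> X"
  proof
    fix g assume "g \<in> sampled n ` {0<..<T}"
    then obtain t where t: "t \<in> {0<..<T}" "g = sampled n t" by auto
    have "cell T (Suc n) t < Suc n" using T t(1) by (intro cell_less) auto
    then show "g \<in> X"
      unfolding t(2) sampled_def by (intro represents_in[OF rep] cell_centre_in T)
  qed
qed

lemma sampled_close:
  assumes e: "e > 0"
  shows "\<forall>\<^sub>F n in sequentially. \<forall>t\<in>{0<..<T}. \<bar>N (\<lambda>x. sampled n t x - f t x)\<bar> \<le> e"
  using uniform_cell_approximation[OF T cont e]
proof eventually_elim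
  case (elim n)
  show ?case
  proof
    fix t assume t: "t \<in> {0<..<T}"
    let ?j = "cell T (Suc n) t"
    have j: "?j < Suc n" using T t by (intro cell_less) auto
    have "real ?j * (T / real (Suc n)) \<le> t" "t < real (Suc ?j) * (T / real (Suc n))"
      using cell_eq_iff[OF T, of "Suc n" t ?j] t by simp_all
    then have "dist (a t) (a (cell_centre T (Suc n) ?j)) \<le> e" using elim j by simp
    moreover have "\<bar>N (\<lambda>x. sampled n t x - f t x)\<bar> \<le> norm (a (cell_centre T (Suc n) ?j) - a t)"
      unfolding sampled_def by (intro represents_bound represents_diff rep cell_centre_in T j t)
    ultimately show "\<bar>N (\<lambda>x. sampled n t x - f t x)\<bar> \<le> e" by (simp add: dist_norm norm_minus_commute)
  qed
qed

lemma sampled_integral_close: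
  assumes e: "e > 0" and I: "represents I (integral {0..T} a)"
  shows "\<forall>\<^sub>F n in sequentially. \<bar>N (\<lambda>x. X_simple_integral T (sampled n) x - I x)\<bar> \<le> T * e"
  using uniform_cell_approximation[OF T cont e]
proof eventually_elim
  case (elim n)
  let ?h = "T / real (Suc n)"
  have nT: "real (Suc n) * ?h = T" by simp
  have "norm (integral {0..real (Suc n) * ?h} a - (\<Sum>j<Suc n. ?h *\<^sub>R a (cell_centre T (Suc n) j))) \<le> real (Suc n) * ?h * e"
    using elim T cont unfolding nT dist_norm by (intro riemann_sum_error[where h="?h" and n="Suc n", unfolded nT]) auto
  then have le: "norm ((\<Sum>j<Suc n. ?h *\<^sub>R a (cell_centre T (Suc n) j)) - integral {0..T} a) \<le> T * e"
    unfolding nT by (simp add: norm_minus_commute)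
  have "X_simple_integral T (sampled n) = (\<lambda>x. \<Sum>j<Suc n. ?h * f (cell_centre T (Suc n) j) x)"
    unfolding sampled_def[abs_def] by (intro ext X_simple_integral_cell T) simp
  moreover have "represents (\<lambda>x. \<Sum>j<Suc n. ?h * f (cell_centre T (Suc n) j) x) (\<Sum>j<Suc n. ?h *\<^sub>R a (cell_centre T (Suc n) j))"
    by (intro represents_sum rep cell_centre_in T) auto
  ultimately have "\<bar>N (\<lambda>x. X_simple_integral T (sampled n) x - I x)\<bar>
      \<le> norm ((\<Sum>j<Suc n. ?h *\<^sub>R a (cell_centre T (Suc n) j)) - integral {0..T} a)"
    by (simp only:) (intro represents_bound represents_diff I)
  with le show ?case by linarith
qed

lemma strongly_measurable_curve: "strongly_measurable T X N f"
  unfolding strongly_measurable_def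
proof (intro conjI exI allI)
  show "AE t in lebesgue_on {0<..<T}. f t \<in> X"
    using represents_in[OF rep] by (intro AE_I2) simp
  show "X_simple T X (sampled n)" for n by (rule X_simple_sampled)
  show "AE t in lebesgue_on {0<..<T}. (\<lambda>n. N (\<lambda>x. sampled n t x - f t x)) \<longlonglongrightarrow> 0"
  proof (rule AE_I2, rule tendstoI)
    fix t e :: real assume t: "t \<in> space (lebesgue_on {0<..<T})" and e: "e > 0"
    from sampled_close[of "e / 2"] e
    have "\<forall>\<^sub>F n in sequentially. \<forall>t\<in>{0<..<T}. \<bar>N (\<lambda>x. sampled n t x - f t x)\<bar> \<le> e / 2" by simp
    then show "\<forall>\<^sub>F n in sequentially. dist (N (\<lambda>x. sampled n t x - f t x)) 0 < e"
    proof eventually_elim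
      case (elim n)
      then have "\<bar>N (\<lambda>x. sampled n t x - f t x)\<bar> \<le> e / 2" using t by simp
      then show ?case using e unfolding dist_real_def diff_0_right by linarith
    qed
  qed
qed

lemma Linfty_curve: "f \<in> Linfty_time T X N"
proof -
  have "bounded (a ` {0..T})" using cont by (intro compact_imp_bounded compact_continuous_image) auto
  then obtain B where B: "\<forall>y\<in>a ` {0..T}. norm y \<le> B" unfolding bounded_pos by blast
  have "N (f t) \<le> B" if "t \<in> {0<..<T}" for t
  proof -
    have "norm (a t) \<le> B" using B that by simp
    then show ?thesis using represents_bound[OF rep[OF that]] by linarith
  qed
  then have "AE t in lebesgue_on {0<..<T}. N (f t) \<le> B" by (intro AE_I2) simp
  then show ?thesis using strongly_measurable_curve by (auto simp: Linfty_time_def)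
qed

text \<open>A curve represented by a continuous curve in a Banach space is uniformly approximated by its samples,
  whose integrals are Riemann sums for the integral in the Banach space.\<close>

lemma has_X_integral_curve:
  assumes I: "represents I (integral {0..T} a)"
  shows "has_X_integral T X N f I"
  unfolding has_X_integral_def
proof (intro conjI exI allI)
  show "strongly_measurable T X N f" by (rule strongly_measurable_curve)
  show "I \<in> X" by (rule represents_in[OF I])
  show "X_simple T X (sampled n)" for n by (rule X_simple_sampled)
  show "(\<lambda>n. \<integral>\<^sup>+t. ennreal (N (\<lambda>x. sampled n t x - f t x)) \<partial>lebesgue_on {0<..<T}) \<longlonglongrightarrow> 0"
  proof (rule order_tendstoI)
    fix y :: ennreal assume "y < 0"
    then show "\<forall>\<^sub>F n in sequentially. y < (\<integral>\<^sup>+t. ennreal (N (\<lambda>x. sampled n t x - f t x)) \<partial>lebesgue_on {0<..<T})" by simp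
  next
    fix y :: ennreal assume y: "0 < y"
    obtain c where c: "c > 0" "ennreal (c * T) < y"
    proof (cases y)
      case (real r)
      then have "r > 0" using y by (simp add: ennreal_less_zero_iff)
      then show ?thesis using that[of "r / (2 * T)"] T real by (simp add: ennreal_less_iff)
    next
      case top
      then show ?thesis using that[of 1] by simp
    qed
    from sampled_close[OF c(1)]
    show "\<forall>\<^sub>F n in sequentially. (\<integral>\<^sup>+t. ennreal (N (\<lambda>x. sampled n t x - f t x)) \<partial>lebesgue_on {0<..<T}) < y"
    proof eventually_elim
      case (elim n)
      have "(\<integral>\<^sup>+t. ennreal (N (\<lambda>x. sampled n t x - f t x)) \<partial>lebesgue_on {0<..<T})
          \<le> (\<integral>\<^sup>+t. ennreal c \<partial>lebesgue_on {0<..<T})"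
      proof (rule nn_integral_mono, rule ennreal_leI)
        fix t assume "t \<in> space (lebesgue_on {0<..<T})"
        then have "\<bar>N (\<lambda>x. sampled n t x - f t x)\<bar> \<le> c" using elim by simp
        then show "N (\<lambda>x. sampled n t x - f t x) \<le> c" by linarith
      qed
      also have "\<dots> = ennreal (c * T)"
        using T c(1) by (simp add: emeasure_restrict_space ennreal_mult)
      finally show ?case using c(2) by simp
    qed
  qed
  show "(\<lambda>n. N (\<lambda>x. X_simple_integral T (sampled n) x - I x)) \<longlonglongrightarrow> 0"
  proof (rule tendstoI)
    fix e :: real assume e: "e > 0"
    then have "e / (2 * T) > 0" using T by simp
    from sampled_integral_close[OF this I]
    show "\<forall>\<^sub>F n in sequentially. dist (N (\<lambda>x. X_simple_integral T (sampled n) x - I x)) 0 < e"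
      by eventually_elim (use e T in \<open>simp add: dist_real_def\<close>)
  qed
qed

end

end


section \<open>Integration by parts and weak derivatives\<close>

lemma integral_inner_left:
  fixes f :: "real \<Rightarrow> 'k::{real_inner, banach}"
  assumes "continuous_on {0..T} f"
  shows "inner (integral {0..T} f) c = integral {0..T} (\<lambda>t. inner (f t) c)"
  using integral_linear[OF integrable_continuous_real[OF assms] bounded_linear_inner_left, of c]
  by (simp add: o_def)

lemma test_function_facts:
  assumes "test_function T \<phi>"
  shows "(\<phi> has_field_derivative deriv \<phi> t) (at t)" "continuous_on A \<phi>" "continuous_on A (deriv \<phi>)"
    "\<phi> 0 = 0" "\<phi> T = 0"
proof -
  have d: "(deriv ^^ k) \<phi> field_differentiable at t" for k t using assms by (simp add: test_function_def)
  have d0: "\<phi> field_differentiable at t" for t using d[of 0 t] by simp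
  have d1: "deriv \<phi> field_differentiable at t" for t using d[of 1 t] by simp
  show "(\<phi> has_field_derivative deriv \<phi> t) (at t)"
    using d0 by (simp add: DERIV_deriv_iff_field_differentiable)
  show "continuous_on A \<phi>" "continuous_on A (deriv \<phi>)"
    using d0 d1 by (auto intro!: continuous_at_imp_continuous_on field_differentiable_imp_continuous_at)
  have "closure {t. \<phi> t \<noteq> 0} \<subseteq> {0<..<T}" using assms by (simp add: test_function_def)
  then have "{t. \<phi> t \<noteq> 0} \<subseteq> {0<..<T}" by (rule subset_trans[OF closure_subset])
  then show "\<phi> 0 = 0" "\<phi> T = 0" by auto
qed

text \<open>The fundamental theorem of calculus for \<open>\<phi> W\<close>, which vanishes at both end points.\<close>

lemma integral_by_parts_test_function:
  fixes w :: "real \<Rightarrow> 'k::banach"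
  assumes \<phi>: "test_function T \<phi>" and T: "T > 0" and w: "continuous_on {0..T} w"
    and W: "\<And>t. t \<in> {0..T} \<Longrightarrow> W t = c + integral {0..t} w"
  shows "integral {0..T} (\<lambda>t. \<phi> t *\<^sub>R w t) = - integral {0..T} (\<lambda>t. deriv \<phi> t *\<^sub>R W t)"
proof -
  note tf = test_function_facts[OF \<phi>]
  have dW: "(W has_vector_derivative w t) (at t within {0..T})" if t: "t \<in> {0..T}" for t
  proof -
    have "((\<lambda>t. c + integral {0..t} w) has_vector_derivative 0 + w t) (at t within {0..T})"
      by (rule has_vector_derivative_add[OF has_vector_derivative_const integral_has_vector_derivative[OF w t]])
    then show ?thesis
      using has_vector_derivative_transform[OF t, of W "\<lambda>t. c + integral {0..t} w"] W by simp
  qed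
  have Wc: "continuous_on {0..T} W"
    unfolding continuous_on_eq_continuous_within using has_vector_derivative_continuous[OF dW] by simp
  have "((\<lambda>t. \<phi> t *\<^sub>R w t + deriv \<phi> t *\<^sub>R W t) has_integral \<phi> T *\<^sub>R W T - \<phi> 0 *\<^sub>R W 0) {0..T}"
  proof (rule fundamental_theorem_of_calculus)
    fix t assume t: "t \<in> {0..T}"
    have "(\<phi> has_field_derivative deriv \<phi> t) (at t within {0..T})"
      using tf(1) by (rule has_field_derivative_at_within)
    then show "((\<lambda>t. \<phi> t *\<^sub>R W t) has_vector_derivative \<phi> t *\<^sub>R w t + deriv \<phi> t *\<^sub>R W t) (at t within {0..T})"
      using dW[OF t] by (rule has_vector_derivative_scaleR)
  qed (use T in simp)
  then have "integral {0..T} (\<lambda>t. \<phi> t *\<^sub>R w t + deriv \<phi> t *\<^sub>R W t) = 0"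
    using tf(4,5) by (simp add: integral_unique)
  moreover have "integral {0..T} (\<lambda>t. \<phi> t *\<^sub>R w t + deriv \<phi> t *\<^sub>R W t)
      = integral {0..T} (\<lambda>t. \<phi> t *\<^sub>R w t) + integral {0..T} (\<lambda>t. deriv \<phi> t *\<^sub>R W t)"
    by (intro Henstock_Kurzweil_Integration.integral_add integrable_continuous_real continuous_intros tf w Wc)
  ultimately show ?thesis by (simp add: eq_neg_iff_add_eq_0)
qed


lemma (in vector_representation) represents_scale: "represents f k \<Longrightarrow> represents (\<lambda>x. c * f x) (c *\<^sub>R k)"
  using represents_linear[of f k f k c 0] by simp

text \<open>Integration by parts is assumed at the level of the represented elements, not of the vectors: the
  integrals of \<open>\<phi>' a\<close> and \<open>\<phi> b\<close> need not be negatives of each other, only represent elements that are. This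
  is the situation for the second time derivative of the solution.\<close>

lemma (in vector_representation) has_weak_time_derivative_curve:
  assumes T: "T > 0"
    and f: "\<And>t. t \<in> {0<..<T} \<Longrightarrow> represents (f t) (a t)" "continuous_on {0..T} a"
    and g: "\<And>t. t \<in> {0<..<T} \<Longrightarrow> represents (g t) (b t)" "continuous_on {0..T} b"
    and parts: "\<And>\<phi>. test_function T \<phi> \<Longrightarrow>
      \<exists>I. represents I (integral {0..T} (\<lambda>t. deriv \<phi> t *\<^sub>R a t)) \<and>
        represents (\<lambda>x. - I x) (integral {0..T} (\<lambda>t. \<phi> t *\<^sub>R b t))"
  shows "has_weak_time_derivative T X N f g"
  unfolding has_weak_time_derivative_def
proof (intro allI impI)
  fix \<phi> assume \<phi>: "test_function T \<phi>"
  obtain I where I: "represents I (integral {0..T} (\<lambda>t. deriv \<phi> t *\<^sub>R a t))"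
      "represents (\<lambda>x. - I x) (integral {0..T} (\<lambda>t. \<phi> t *\<^sub>R b t))"
    using parts[OF \<phi>] by auto
  note tf = test_function_facts[OF \<phi>]
  have "has_X_integral T X N (\<lambda>t x. deriv \<phi> t * f t x) I"
    by (rule has_X_integral_curve[OF T _ _ I(1)]) (intro represents_scale f continuous_intros tf | assumption)+
  moreover have "has_X_integral T X N (\<lambda>t x. \<phi> t * g t x) (\<lambda>x. - I x)"
    by (rule has_X_integral_curve[OF T _ _ I(2)]) (intro represents_scale g continuous_intros tf | assumption)+
  ultimately show "\<exists>I. has_X_integral T X N (\<lambda>t x. deriv \<phi> t * f t x) I \<and>
      has_X_integral T X N (\<lambda>t x. \<phi> t * g t x) (\<lambda>x. - I x)" by blast
qed

section \<open>Averages near the initial time\<close>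

lemma average_at_initial_time:
  fixes f g :: "real \<Rightarrow> real"
  assumes T: "T > 0" and g: "continuous_on {0..T} g" and fg: "\<And>t. t \<in> {0<..<T} \<Longrightarrow> f t = g t"
    and g0: "g 0 = 0"
  shows "integrable (lebesgue_on {0<..<T}) f"
    and "((\<lambda>h. 1 / h * (\<integral>t. f t \<partial>lebesgue_on {0<..<h})) \<longlongrightarrow> 0) (at_right 0)"
proof -
  have fin: "finite_measure (lebesgue_on {0<..<h})" for h :: real
    by (rule finite_measure_lebesgue_on) simp
  have int: "integrable (lebesgue_on {0<..<h}) f" if h: "h \<le> T" for h
  proof -
    have "bounded (g ` {0..T})" using g by (intro compact_imp_bounded compact_continuous_image) auto
    then obtain B where B: "\<forall>y\<in>g ` {0..T}. norm y \<le> B" unfolding bounded_pos by blast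
    have "continuous_on {0<..<h} g" using h by (intro continuous_on_subset[OF g]) auto
    then have "g \<in> borel_measurable (lebesgue_on {0<..<h})"
      by (rule continuous_imp_measurable_on_sets_lebesgue) simp
    moreover have "AE t in lebesgue_on {0<..<h}. norm (g t) \<le> B" using B h by (intro AE_I2) auto
    ultimately have "integrable (lebesgue_on {0<..<h}) g"
      by (intro finite_measure.integrable_const_bound[OF fin])
    moreover have "integrable (lebesgue_on {0<..<h}) f \<longleftrightarrow> integrable (lebesgue_on {0<..<h}) g"
      using fg h by (intro Bochner_Integration.integrable_cong) auto
    ultimately show ?thesis by simp
  qed
  show "integrable (lebesgue_on {0<..<T}) f" by (rule int) simp
  show "((\<lambda>h. 1 / h * (\<integral>t. f t \<partial>lebesgue_on {0<..<h})) \<longlongrightarrow> 0) (at_right 0)"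
  proof (rule tendstoI)
    fix e :: real assume e: "e > 0"
    obtain d where d: "d > 0" "\<And>t. t \<in> {0..T} \<Longrightarrow> dist t 0 < d \<Longrightarrow> dist (g t) (g 0) < e / 2"
      using g e T unfolding continuous_on_iff by (metis atLeastAtMost_iff half_gt_zero less_imp_le order_refl)
    have "\<forall>\<^sub>F h in at_right 0. 0 < h \<and> h < min d T"
      using d(1) T by (intro eventually_conj eventually_at_right_less eventually_at_right_real[THEN eventually_mono, of 0 "min d T"]) auto
    then show "\<forall>\<^sub>F h in at_right 0. dist (1 / h * (\<integral>t. f t \<partial>lebesgue_on {0<..<h})) 0 < e"
    proof eventually_elim
      case (elim h)
      have "norm (\<integral>t. f t \<partial>lebesgue_on {0<..<h}) \<le> (\<integral>t. norm (f t) \<partial>lebesgue_on {0<..<h})"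
        by (rule integral_norm_bound)
      also have "\<dots> \<le> (\<integral>t. e / 2 \<partial>lebesgue_on {0<..<h})"
      proof (rule integral_mono)
        show "integrable (lebesgue_on {0<..<h}) (\<lambda>t. norm (f t))" using int elim by (intro integrable_norm) auto
        show "integrable (lebesgue_on {0<..<h}) (\<lambda>t. e / 2)"
          by (rule finite_measure.integrable_const[OF fin])
        fix t assume "t \<in> space (lebesgue_on {0<..<h})"
        then have "t \<in> {0<..<T}" "t \<in> {0..T}" "dist t 0 < d" using elim by (auto simp: dist_real_def)
        then have "\<bar>g t\<bar> < e / 2" using d(2)[of t] by (simp add: g0 dist_real_def)
        then show "norm (f t) \<le> e / 2" using fg[OF \<open>t \<in> {0<..<T}\<close>] by simp
      qed
      also have "\<dots> = h * (e / 2)" using elim by (simp add: measure_restrict_space)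
      finally have "\<bar>1 / h * (\<integral>t. f t \<partial>lebesgue_on {0<..<h})\<bar> \<le> e / 2"
        using elim by (simp add: abs_mult field_simps)
      then show ?case using e unfolding dist_real_def diff_0_right by linarith
    qed
  qed
qed

section \<open>The function spaces of the problem\<close>

lemma L2_class_linear:
  fixes f g :: "'a::euclidean_space \<Rightarrow> real"
  assumes "f \<in> square_integrable" "g \<in> square_integrable"
  shows "(\<lambda>x. a * f x + b * g x) \<in> square_integrable"
    and "L2_class (\<lambda>x. a * f x + b * g x) = a *\<^sub>R L2_class f + b *\<^sub>R L2_class g"
proof -
  have s: "(\<lambda>x. a * f x) \<in> square_integrable" "(\<lambda>x. b * g x) \<in> square_integrable"
    using square_integrable_scaleR[OF assms(1), of a] square_integrable_scaleR[OF assms(2), of b] by simp_all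
  show "(\<lambda>x. a * f x + b * g x) \<in> square_integrable" by (rule square_integrable_add[OF s])
  show "L2_class (\<lambda>x. a * f x + b * g x) = a *\<^sub>R L2_class f + b *\<^sub>R L2_class g"
    using L2_class_add[OF s] L2_class_scaleR[OF assms(1), of a] L2_class_scaleR[OF assms(2), of b] by simp
qed

lemma L2_on_subset:
  fixes f :: "real ^ 'd \<Rightarrow> real"
  assumes f: "f \<in> square_integrable" and \<Omega>: "\<Omega> \<in> sets lebesgue"
  shows "f \<in> L2 \<Omega>" and "\<bar>L2_norm \<Omega> f\<bar> \<le> norm (L2_class f)"
proof -
  have m: "f \<in> borel_measurable lebesgue" and i: "integrable lebesgue (\<lambda>x. (f x)\<^sup>2)"
    using square_integrableD[OF f] by simp_all
  have i': "integrable lebesgue (\<lambda>x. indicator \<Omega> x *\<^sub>R (f x)\<^sup>2)"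
    using \<Omega> i by (rule integrable_mult_indicator)
  have "integrable (lebesgue_on \<Omega>) (\<lambda>x. (f x)\<^sup>2)"
    using i' \<Omega> by (subst integrable_restrict_space) auto
  then show "f \<in> L2 \<Omega>" using measurable_restrict_space1[OF m] by (simp add: L2_def)
  have "(\<integral>x. (f x)\<^sup>2 \<partial>lebesgue_on \<Omega>) = (\<integral>x. indicator \<Omega> x *\<^sub>R (f x)\<^sup>2 \<partial>lebesgue)"
    using \<Omega> by (subst integral_restrict_space) auto
  also have "\<dots> \<le> (\<integral>x. (f x)\<^sup>2 \<partial>lebesgue)"
    by (rule integral_mono[OF i' i]) (simp add: indicator_def)
  also have "\<dots> = (norm (L2_class f))\<^sup>2" using norm_L2_class[OF f] by simp
  finally have "L2_norm \<Omega> f \<le> norm (L2_class f)" unfolding L2_norm_def by (rule real_le_lsqrt[OF norm_ge_zero])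
  then show "\<bar>L2_norm \<Omega> f\<bar> \<le> norm (L2_class f)" by (simp add: L2_norm_def)
qed

lemma L2_norm_vanishing_outside:
  fixes f :: "real ^ 'd \<Rightarrow> real"
  assumes f: "f \<in> square_integrable" and \<Omega>: "\<Omega> \<in> sets lebesgue"
    and zero: "AE x in lebesgue. x \<notin> \<Omega> \<longrightarrow> f x = 0"
  shows "L2_norm \<Omega> f = norm (L2_class f)"
proof -
  have m: "f \<in> borel_measurable lebesgue" using square_integrableD[OF f] by simp
  have "(\<integral>x. (f x)\<^sup>2 \<partial>lebesgue_on \<Omega>) = (\<integral>x. indicator \<Omega> x *\<^sub>R (f x)\<^sup>2 \<partial>lebesgue)"
    using \<Omega> by (subst integral_restrict_space) auto
  also have "\<dots> = (\<integral>x. (f x)\<^sup>2 \<partial>lebesgue)"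
  proof (rule integral_cong_AE)
    show "AE x in lebesgue. indicator \<Omega> x *\<^sub>R (f x)\<^sup>2 = (f x)\<^sup>2"
      using zero by eventually_elim (auto simp: indicator_def)
  qed (use m \<Omega> in measurable)
  also have "\<dots> = (norm (L2_class f))\<^sup>2" using norm_L2_class[OF f] by simp
  finally show ?thesis by (simp add: L2_norm_def)
qed

lemma vector_representation_L2:
  fixes \<Omega> :: "(real ^ 'd) set"
  assumes "\<Omega> \<in> sets lebesgue"
  shows "vector_representation (L2 \<Omega>) (L2_norm \<Omega>) (\<lambda>f k. f \<in> square_integrable \<and> L2_class f = k)"
  by unfold_locales (use L2_on_subset[OF _ assms] L2_class_linear in auto)

text \<open>The graph norm of \<open>(-\<Delta>)\<^sup>s\<^sup>/\<^sup>2\<close> is the norm of \<open>Hs_tilde s \<Omega>\<close>, so the pair is an isometric copy of \<open>f\<close> in a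
  Hilbert space.\<close>

definition Hs_graph :: "real \<Rightarrow> (real ^ 'd \<Rightarrow> real) \<Rightarrow> (real ^ 'd, real) L2_space \<times> (real ^ 'd, real) L2_space" where
  "Hs_graph s f = (L2_class f, half_laplacian s (L2_class f))"

lemma Hs_graph_linear:
  assumes s: "s > 0" and f: "f \<in> Hs_tilde s \<Omega>" and g: "g \<in> Hs_tilde s \<Omega>"
  shows "(\<lambda>x. a * f x + b * g x) \<in> Hs_tilde s \<Omega>"
    and "Hs_graph s (\<lambda>x. a * f x + b * g x) = a *\<^sub>R Hs_graph s f + b *\<^sub>R Hs_graph s g"
  using f g L2_class_linear[of f g a b] Hs_classes_linear[of "L2_class f" s \<Omega> "L2_class g" a b]
  by (simp_all add: Hs_tilde_iff[OF s] Hs_graph_def)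

lemma zero_in_Hs_tilde:
  fixes \<Omega> :: "(real ^ 'd) set"
  assumes s: "s > 0"
  shows "(\<lambda>x. 0) \<in> Hs_tilde s \<Omega>" and "Hs_graph s (\<lambda>x :: real ^ 'd. 0) = 0"
proof -
  interpret closed_operator "Hs_classes s \<Omega>" "half_laplacian s" by (rule closed_operator_half_laplacian)
  show "(\<lambda>x. 0) \<in> Hs_tilde s \<Omega>" by (simp add: Hs_tilde_iff[OF s] square_integrable_zero L2_class_zero)
  from Hs_graph_linear(2)[OF s this this, of 0 0] show "Hs_graph s (\<lambda>x :: real ^ 'd. 0) = 0" by simp
qed

lemma Hs_norm_eq_norm_graph:
  assumes s: "s > 0" and f: "f \<in> Hs_tilde s \<Omega>"
  shows "Hs_seminorm s f = norm (half_laplacian s (L2_class f))" and "Hs_norm s f = norm (Hs_graph s f)"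
proof -
  show semi: "Hs_seminorm s f = norm (half_laplacian s (L2_class f))"
    by (simp add: Hs_seminorm_def Hs_form_eq_inner[OF s f f] norm_eq_sqrt_inner)
  have "f \<in> square_integrable" using f by (simp add: Hs_tilde_iff[OF s])
  then have "L2_norm UNIV f = norm (L2_class f)" by (rule L2_norm_vanishing_outside) simp_all
  then show "Hs_norm s f = norm (Hs_graph s f)"
    by (simp add: Hs_norm_def semi Hs_graph_def norm_prod_def)
qed

lemma vector_representation_Hs:
  assumes s: "s > 0"
  shows "vector_representation (Hs_tilde s \<Omega>) (Hs_norm s) (\<lambda>f k. f \<in> Hs_tilde s \<Omega> \<and> Hs_graph s f = k)"
proof
  fix f g k l and a b :: real
  assume f: "f \<in> Hs_tilde s \<Omega> \<and> Hs_graph s f = k"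
  then show "f \<in> Hs_tilde s \<Omega>" "\<bar>Hs_norm s f\<bar> \<le> norm k" using Hs_norm_eq_norm_graph(2)[OF s, of f] by auto
  assume "g \<in> Hs_tilde s \<Omega> \<and> Hs_graph s g = l"
  then show "(\<lambda>x. a * f x + b * g x) \<in> Hs_tilde s \<Omega> \<and> Hs_graph s (\<lambda>x. a * f x + b * g x) = a *\<^sub>R k + b *\<^sub>R l"
    using f Hs_graph_linear[OF s, of f \<Omega> g] by auto
qed

text \<open>A pair \<open>k = (p, q)\<close> represents the functional \<open>\<psi> \<mapsto> p \<bullet> \<psi> + q \<bullet> (-\<Delta>)\<^sup>s\<^sup>/\<^sup>2 \<psi>\<close>, which by the Cauchy--Schwarz
  inequality is bounded by \<open>norm k\<close>. Functions acting by the \<open>L\<^sup>2\<close> inner product are pairs \<open>(p, 0)\<close>, and the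
  fractional Laplacian of \<open>u\<close> is the pair \<open>(0, (-\<Delta>)\<^sup>s\<^sup>/\<^sup>2 u)\<close>.\<close>

lemma vector_representation_dual:
  assumes s: "s > 0"
  shows "vector_representation (Hs_dual s \<Omega>) (Hs_dual_norm s \<Omega>) (\<lambda>l k. \<forall>\<psi>\<in>Hs_tilde s \<Omega>. l \<psi> = inner k (Hs_graph s \<psi>))"
proof
  fix l l' k k' and a b :: real
  assume l: "\<forall>\<psi>\<in>Hs_tilde s \<Omega>. l \<psi> = inner k (Hs_graph s \<psi>)"
  have bound: "\<bar>l \<psi>\<bar> \<le> norm k * Hs_norm s \<psi>" if "\<psi> \<in> Hs_tilde s \<Omega>" for \<psi>
    using l that Cauchy_Schwarz_ineq2[of k "Hs_graph s \<psi>"] by (simp add: Hs_norm_eq_norm_graph(2)[OF s that])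
  show "l \<in> Hs_dual s \<Omega>"
    unfolding Hs_dual_def dual_space_def mem_Collect_eq
  proof (intro conjI ballI allI exI)
    show "\<bar>l \<psi>\<bar> \<le> norm k * Hs_norm s \<psi>" if "\<psi> \<in> Hs_tilde s \<Omega>" for \<psi> by (rule bound[OF that])
    fix v w and a b :: real assume v: "v \<in> Hs_tilde s \<Omega>" and w: "w \<in> Hs_tilde s \<Omega>"
    show "l (\<lambda>x. a * v x + b * w x) = a * l v + b * l w"
      using l v w Hs_graph_linear[OF s v w, of a b] by (simp add: inner_add_right)
  qed
  let ?B = "{\<psi> \<in> Hs_tilde s \<Omega>. Hs_norm s \<psi> \<le> 1}"
  have zero: "(\<lambda>x. 0) \<in> ?B"
    using zero_in_Hs_tilde(1)[OF s, of \<Omega>] Hs_norm_eq_norm_graph(2)[OF s, of "\<lambda>x. 0" \<Omega>]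
    by (simp add: zero_in_Hs_tilde(2)[OF s])
  have le: "\<bar>l \<psi>\<bar> \<le> norm k" if "\<psi> \<in> ?B" for \<psi>
  proof -
    have "norm k * Hs_norm s \<psi> \<le> norm k * 1" using that by (intro mult_left_mono) auto
    then show ?thesis using bound[of \<psi>] that by simp
  qed
  have "\<bar>l (\<lambda>x. 0)\<bar> \<le> Hs_dual_norm s \<Omega> l"
    unfolding Hs_dual_norm_def dual_norm_def by (rule cSUP_upper[OF zero]) (use le in \<open>auto intro!: bdd_aboveI2\<close>)
  moreover have "Hs_dual_norm s \<Omega> l \<le> norm k"
    unfolding Hs_dual_norm_def dual_norm_def by (rule cSUP_least) (use zero le in auto)
  ultimately show "\<bar>Hs_dual_norm s \<Omega> l\<bar> \<le> norm k" by linarith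
  assume "\<forall>\<psi>\<in>Hs_tilde s \<Omega>. l' \<psi> = inner k' (Hs_graph s \<psi>)"
  with l show "\<forall>\<psi>\<in>Hs_tilde s \<Omega>. a * l \<psi> + b * l' \<psi> = inner (a *\<^sub>R k + b *\<^sub>R k') (Hs_graph s \<psi>)"
    by (simp add: inner_add_left)
qed

lemma L2_functional_eq_inner:
  fixes f g :: "real ^ 'd \<Rightarrow> real"
  assumes f: "f \<in> square_integrable" and g: "g \<in> square_integrable" and \<Omega>: "\<Omega> \<in> sets lebesgue"
    and zero: "AE x in lebesgue. x \<notin> \<Omega> \<longrightarrow> g x = 0"
  shows "L2_functional \<Omega> f g = inner (L2_class f) (L2_class g)"
proof -
  have m: "f \<in> borel_measurable lebesgue" "g \<in> borel_measurable lebesgue"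
    using square_integrableD[OF f] square_integrableD[OF g] by simp_all
  have "L2_functional \<Omega> f g = (\<integral>x. indicator \<Omega> x *\<^sub>R (f x * g x) \<partial>lebesgue)"
    unfolding L2_functional_def using \<Omega> by (subst integral_restrict_space) auto
  also have "\<dots> = (\<integral>x. f x \<bullet> g x \<partial>lebesgue)"
  proof (rule integral_cong_AE)
    show "AE x in lebesgue. indicator \<Omega> x *\<^sub>R (f x * g x) = f x \<bullet> g x"
      using zero by eventually_elim (auto simp: indicator_def)
  qed (use m \<Omega> in measurable)
  also have "\<dots> = inner (L2_class f) (L2_class g)" by (rule L2_class_inner[OF f g, symmetric])
  finally show ?thesis .
qed

text \<open>For a step function \<open>S n\<close> in place of \<open>\<phi>\<close> the pairing is continuous in \<open>t\<close> on each of the finitely many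
  measurable sets where \<open>S n\<close> is constant. Measurability for \<open>\<phi>\<close> follows by passing to the limit almost everywhere, and \<open>Hs_norm s (\<phi> t)\<close>
  up to a constant is an integrable bound. The pairing is stated for any \<open>h\<close> that agrees with it where \<open>\<phi> t\<close> lies in
  the space, because elsewhere the value of the form is unspecified.\<close>

lemma integrable_inner_L1_time:
  assumes s: "s > 0" and T: "T > 0" and w: "continuous_on {0..T} w"
    and \<phi>: "\<phi> \<in> L1_time T (Hs_tilde s \<Omega>) (Hs_norm s)"
    and h: "\<And>t. t \<in> {0<..<T} \<Longrightarrow> \<phi> t \<in> Hs_tilde s \<Omega> \<Longrightarrow> h t = inner (w t) (Hs_graph s (\<phi> t))"
  shows "integrable (lebesgue_on {0<..<T}) h"
proof -
  let ?M = "lebesgue_on {0<..<T}"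
  obtain S where in_X: "AE t in ?M. \<phi> t \<in> Hs_tilde s \<Omega>"
      and S: "\<And>n. X_simple T (Hs_tilde s \<Omega>) (S n)"
      and lim: "AE t in ?M. (\<lambda>n. Hs_norm s (\<lambda>x. S n t x - \<phi> t x)) \<longlonglongrightarrow> 0"
      and int: "integrable ?M (\<lambda>t. Hs_norm s (\<phi> t))"
    using \<phi> unfolding L1_time_def strongly_measurable_def by auto
  have "bounded (w ` {0..T})" using w by (intro compact_imp_bounded compact_continuous_image) auto
  then obtain B where "\<forall>y\<in>w ` {0..T}. norm y \<le> B" unfolding bounded_pos by blast
  then have B: "norm (w t) \<le> B" if "t \<in> {0<..<T}" for t using that by simp
  define g where "g n t = inner (w t) (Hs_graph s (S n t))" for n t
  have meas_g: "g n \<in> borel_measurable ?M" for n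
    unfolding g_def
  proof (rule measurable_compose_countable'[where g="S n" and I="S n ` {0<..<T}"])
    have fin: "finite (S n ` {0<..<T})" and sets: "S n -` {y} \<inter> space ?M \<in> sets ?M" if "y \<in> S n ` {0<..<T}" for y
      using S[of n] that by (auto simp: X_simple_def simple_function_def)
    have fin: "finite (S n ` {0<..<T})" using S[of n] by (auto simp: X_simple_def simple_function_def)
    then show "countable (S n ` {0<..<T})" by (rule countable_finite)
    show "S n \<in> measurable ?M (count_space (S n ` {0<..<T}))"
      unfolding measurable_count_space_eq2[OF fin] using sets by auto
    fix y
    have "continuous_on {0<..<T} w" by (rule continuous_on_subset[OF w]) auto
    then have "continuous_on {0<..<T} (\<lambda>t. inner (w t) (Hs_graph s y))" by (intro continuous_intros)
    then show "(\<lambda>t. inner (w t) (Hs_graph s y)) \<in> borel_measurable ?M"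
      by (rule continuous_imp_measurable_on_sets_lebesgue) simp
  qed
  have conv: "AE t in ?M. (\<lambda>n. g n t) \<longlonglongrightarrow> h t"
    using in_X lim AE_space
  proof eventually_elim
    case (elim t)
    then have t: "t \<in> {0<..<T}" by simp
    have "norm (g n t - h t) \<le> B * Hs_norm s (\<lambda>x. S n t x - \<phi> t x)" for n
    proof -
      have "S n t \<in> Hs_tilde s \<Omega>" using S[of n] t by (auto simp: X_simple_def)
      note lin = Hs_graph_linear[OF s this elim(1), of 1 "-1", simplified]
      have "g n t - h t = inner (w t) (Hs_graph s (\<lambda>x. S n t x - \<phi> t x))"
        by (simp add: g_def h[OF t elim(1)] lin(2) inner_diff_right)
      also have "norm \<dots> \<le> norm (w t) * Hs_norm s (\<lambda>x. S n t x - \<phi> t x)"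
        unfolding Hs_norm_eq_norm_graph(2)[OF s lin(1)] real_norm_def by (rule Cauchy_Schwarz_ineq2)
      also have "\<dots> \<le> B * Hs_norm s (\<lambda>x. S n t x - \<phi> t x)"
        using B[OF t] by (intro mult_right_mono) (simp_all add: Hs_norm_eq_norm_graph(2)[OF s lin(1)])
      finally show ?thesis .
    qed
    moreover have "(\<lambda>n. B * Hs_norm s (\<lambda>x. S n t x - \<phi> t x)) \<longlonglongrightarrow> 0"
      using tendsto_mult_left[OF elim(2), of B] by simp
    ultimately have "(\<lambda>n. g n t - h t) \<longlonglongrightarrow> 0"
      using Lim_null_comparison[of "\<lambda>n. g n t - h t" "\<lambda>n. B * Hs_norm s (\<lambda>x. S n t x - \<phi> t x)" sequentially]
      by (simp add: always_eventually)
    then show "(\<lambda>n. g n t) \<longlonglongrightarrow> h t" by (rule LIM_zero_cancel)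
  qed
  have "AE t in lebesgue. t \<in> {0<..<T} \<longrightarrow> (\<lambda>n. g n t) \<longlonglongrightarrow> h t"
    using conv by (subst (asm) AE_restrict_space_iff) auto
  then obtain Z where Z: "{t \<in> space lebesgue. \<not> (t \<in> {0<..<T} \<longrightarrow> (\<lambda>n. g n t) \<longlonglongrightarrow> h t)} \<subseteq> Z"
      "Z \<in> null_sets lebesgue"
    unfolding eventually_ae_filter by auto
  have meas_h: "h measurable_on {0<..<T}"
  proof (rule measurable_on_limit)
    show "g n measurable_on {0<..<T}" for n using meas_g by (simp add: measurable_on_iff_borel_measurable)
    show "negligible Z" using Z(2) by (simp add: negligible_iff_null_sets)
    show "(\<lambda>n. g n t) \<longlonglongrightarrow> h t" if "t \<in> {0<..<T} - Z" for t using that Z(1) by auto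
  qed
  show ?thesis
  proof (rule Bochner_Integration.integrable_bound)
    show "integrable ?M (\<lambda>t. B * Hs_norm s (\<phi> t))" using int by simp
    show "h \<in> borel_measurable ?M" using meas_h by (simp add: measurable_on_iff_borel_measurable)
    show "AE t in ?M. norm (h t) \<le> norm (B * Hs_norm s (\<phi> t))"
      using in_X AE_space
    proof eventually_elim
      case (elim t)
      then have t: "t \<in> {0<..<T}" by simp
      have "norm (h t) \<le> norm (w t) * Hs_norm s (\<phi> t)"
        unfolding h[OF t elim(1)] Hs_norm_eq_norm_graph(2)[OF s elim(1)] real_norm_def by (rule Cauchy_Schwarz_ineq2)
      also have "\<dots> \<le> B * Hs_norm s (\<phi> t)"
        using B[OF t] by (intro mult_right_mono) (simp_all add: Hs_norm_eq_norm_graph(2)[OF s elim(1)])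
      finally show ?case by simp
    qed
  qed
qed

lemma L2_extension_by_zero:
  fixes f :: "real ^ 'd \<Rightarrow> real"
  assumes \<Omega>: "\<Omega> \<in> sets lebesgue" and f: "f \<in> L2 \<Omega>"
  shows "(\<lambda>x. indicator \<Omega> x *\<^sub>R f x) \<in> square_integrable"
proof -
  have "(\<lambda>x. indicator \<Omega> x *\<^sub>R f x) \<in> borel_measurable lebesgue"
    using f \<Omega> by (simp add: L2_def borel_measurable_restrict_space_iff mult.commute)
  moreover have "integrable lebesgue (\<lambda>x. indicator \<Omega> x *\<^sub>R (f x)\<^sup>2)"
    using f \<Omega> by (simp add: L2_def integrable_restrict_space)
  then have "integrable lebesgue (\<lambda>x. (norm (indicator \<Omega> x *\<^sub>R f x))\<^sup>2)"
    by (rule Bochner_Integration.integrable_cong[OF refl, THEN iffD1, rotated]) (simp add: indicator_def)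
  ultimately show ?thesis by (simp add: square_integrable_def)
qed

theorem theorem3:
  fixes s T :: real and \<Omega> :: "(real ^ 'd) set" and u0 v0 :: "real ^ 'd \<Rightarrow> real"
  assumes "s > 0" and "T > 0"
    and "open \<Omega>" and "bounded \<Omega>" and "lipschitz_boundary \<Omega>"
    and "u0 \<in> Hs_tilde s \<Omega>" and "v0 \<in> L2 \<Omega>"
  shows "\<exists>(u :: real \<Rightarrow> real ^ 'd \<Rightarrow> real) u\<^sub>t u\<^sub>t\<^sub>t.
    u \<in> Linfty_time T (Hs_tilde s \<Omega>) (Hs_norm s) \<and>
    W1infty_time T (L2 \<Omega>) (L2_norm \<Omega>) u u\<^sub>t \<and>
    u\<^sub>t\<^sub>t \<in> Linfty_time T (Hs_dual s \<Omega>) (Hs_dual_norm s \<Omega>) \<and>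
    has_weak_time_derivative T (Hs_dual s \<Omega>) (Hs_dual_norm s \<Omega>)
      (\<lambda>t. L2_functional \<Omega> (u\<^sub>t t)) u\<^sub>t\<^sub>t \<and>
    (\<forall>\<phi> \<in> L1_time T (Hs_tilde s \<Omega>) (Hs_norm s).
       integrable (lebesgue_on {0<..<T}) (\<lambda>t. u\<^sub>t\<^sub>t t (\<phi> t)) \<and>
       integrable (lebesgue_on {0<..<T}) (\<lambda>t. Hs_form s (u t) (\<phi> t)) \<and>
       (\<integral>t. u\<^sub>t\<^sub>t t (\<phi> t) \<partial>lebesgue_on {0<..<T}) +
       (\<integral>t. Hs_form s (u t) (\<phi> t) \<partial>lebesgue_on {0<..<T}) = 0) \<and>
    integrable (lebesgue_on {0<..<T})
      (\<lambda>t. (L2_norm \<Omega> (\<lambda>x. u t x - u0 x))\<^sup>2 + (Hs_seminorm s (\<lambda>x. u t x - u0 x))\<^sup>2) \<and>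
    ((\<lambda>h. 1 / h * (\<integral>t. ((L2_norm \<Omega> (\<lambda>x. u t x - u0 x))\<^sup>2 + (Hs_seminorm s (\<lambda>x. u t x - u0 x))\<^sup>2)
        \<partial>lebesgue_on {0<..<h})) \<longlongrightarrow> 0) (at_right 0) \<and>
    integrable (lebesgue_on {0<..<T}) (\<lambda>t. (L2_norm \<Omega> (\<lambda>x. u\<^sub>t t x - v0 x))\<^sup>2) \<and>
    ((\<lambda>h. 1 / h * (\<integral>t. (L2_norm \<Omega> (\<lambda>x. u\<^sub>t t x - v0 x))\<^sup>2 \<partial>lebesgue_on {0<..<h})) \<longlongrightarrow> 0)
      (at_right 0)"
proof -
  have s: "s > 0" and T: "T > 0" and open_\<Omega>: "open \<Omega>" and bounded_\<Omega>: "bounded \<Omega>" by fact+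
  have \<Omega>: "\<Omega> \<in> sets lebesgue" using open_\<Omega> by simp
  let ?V = "Hs_classes s \<Omega>" and ?L = "half_laplacian s"
  interpret closed_operator ?V ?L by (rule closed_operator_half_laplacian)

  have u0: "u0 \<in> Hs_tilde s \<Omega>" "u0 \<in> square_integrable" "L2_class u0 \<in> ?V"
    using assms(6) by (auto simp: Hs_tilde_iff[OF s])
  (* Outside \<Omega> the values of v0 are arbitrary, whereas classes live on the whole space. *)
  define v0' where "v0' x = indicator \<Omega> x *\<^sub>R v0 x" for x
  have v0': "v0' \<in> square_integrable" "AE x in lebesgue. x \<notin> \<Omega> \<longrightarrow> v0' x = 0"
    unfolding v0'_def[abs_def] using L2_extension_by_zero[OF \<Omega> assms(7)] by simp_all
  then have "vanishes_outside \<Omega> (L2_class v0')" by (simp add: vanishes_outside_class)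
  then have v0_closure: "L2_class v0' \<in> closure ?V" by (rule Hs_classes_dense[OF s open_\<Omega> bounded_\<Omega>])

  obtain u v where v_cont: "continuous_on {0..T} v" and Lu_cont: "continuous_on {0..T} (\<lambda>t. ?L (u t))"
    and init: "u 0 = L2_class u0" "v 0 = L2_class v0'"
    and u_V: "\<And>t. t \<in> {0..T} \<Longrightarrow> u t \<in> ?V" and v_V: "\<And>t. t \<in> {0..T} \<Longrightarrow> v t \<in> closure ?V"
    and u_eq: "\<And>t. t \<in> {0..T} \<Longrightarrow> u t = L2_class u0 + integral {0..t} v"
    and v_eq: "\<And>t \<phi>. t \<in> {0..T} \<Longrightarrow> \<phi> \<in> ?V \<Longrightarrow>
      v t \<bullet> \<phi> = L2_class v0' \<bullet> \<phi> - integral {0..t} (\<lambda>\<tau>. ?L (u \<tau>)) \<bullet> ?L \<phi>"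
    using wave_solution[OF u0(3) v0_closure T] by metis
  have "continuous_on {0..T} (\<lambda>t. L2_class u0 + integral {0..t} v)"
    by (intro continuous_intros indefinite_integral_continuous_1 integrable_continuous_real v_cont)
  then have u_cont: "continuous_on {0..T} u" by (rule continuous_on_eq) (simp add: u_eq)
  have closure_vanishes: "x \<in> closure ?V \<Longrightarrow> vanishes_outside \<Omega> x" for x
    using closure_minimal[OF _ closed_vanishes_outside[of \<Omega>], of ?V] by (auto simp: Hs_classes_def)

  define U where "U t = L2_fun (u t)" for t
  define U\<^sub>t where "U\<^sub>t t = L2_fun (v t)" for t
  define U\<^sub>t\<^sub>t where "U\<^sub>t\<^sub>t t \<psi> = - Hs_form s (U t) \<psi>" for t \<psi>
  define graph where "graph t = (u t, ?L (u t))" for t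
  (* The two components act on \<psi> and on (-\<Delta>)^(s/2) \<psi>, so this represents - [u t, \<psi>]_s. *)
  define accel where "accel t = (0 :: (real ^ 'd, real) L2_space, - ?L (u t))" for t
  have graph_cont: "continuous_on {0..T} graph" and accel_cont: "continuous_on {0..T} accel"
    unfolding graph_def[abs_def] accel_def[abs_def] by (intro continuous_intros u_cont Lu_cont)+
  have U: "U t \<in> Hs_tilde s \<Omega>" "Hs_graph s (U t) = graph t" if "t \<in> {0..T}" for t
    using u_V[OF that] by (simp_all add: U_def Hs_tilde_iff[OF s] Hs_graph_def graph_def)
  have form: "Hs_form s (U t) \<psi> = inner (?L (u t)) (?L (L2_class \<psi>))" if "t \<in> {0..T}" "\<psi> \<in> Hs_tilde s \<Omega>" for t \<psi>
    using Hs_form_eq_inner[OF s U(1)[OF that(1)] that(2)] by (simp add: U_def)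

  interpret L2: vector_representation "L2 \<Omega>" "L2_norm \<Omega>" "\<lambda>f k. f \<in> square_integrable \<and> L2_class f = k"
    by (rule vector_representation_L2[OF \<Omega>])
  interpret Hs: vector_representation "Hs_tilde s \<Omega>" "Hs_norm s" "\<lambda>f k. f \<in> Hs_tilde s \<Omega> \<and> Hs_graph s f = k"
    by (rule vector_representation_Hs[OF s])
  interpret dual: vector_representation "Hs_dual s \<Omega>" "Hs_dual_norm s \<Omega>"
    "\<lambda>l k. \<forall>\<psi>\<in>Hs_tilde s \<Omega>. l \<psi> = inner k (Hs_graph s \<psi>)"
    by (rule vector_representation_dual[OF s])

  have U_rep: "U t \<in> square_integrable \<and> L2_class (U t) = u t" for t by (simp add: U_def)
  have Ut_rep: "U\<^sub>t t \<in> square_integrable \<and> L2_class (U\<^sub>t t) = v t" for t by (simp add: U\<^sub>t_def)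
  have Utt_rep: "\<forall>\<psi>\<in>Hs_tilde s \<Omega>. U\<^sub>t\<^sub>t t \<psi> = inner (accel t) (Hs_graph s \<psi>)" if "t \<in> {0<..<T}" for t
    using form[of t] that by (simp add: U\<^sub>t\<^sub>t_def accel_def Hs_graph_def)
  have L2_rep: "\<forall>\<psi>\<in>Hs_tilde s \<Omega>. L2_functional \<Omega> (U\<^sub>t t) \<psi> = inner (v t, 0) (Hs_graph s \<psi>)" for t
  proof
    fix \<psi> assume "\<psi> \<in> Hs_tilde s \<Omega>"
    then have "\<psi> \<in> square_integrable" "AE x in lebesgue. x \<notin> \<Omega> \<longrightarrow> \<psi> x = 0"
      unfolding Hs_tilde_iff[OF s] by (auto simp: Hs_classes_def vanishes_outside_class)
    then show "L2_functional \<Omega> (U\<^sub>t t) \<psi> = inner (v t, 0) (Hs_graph s \<psi>)"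
      using L2_functional_eq_inner[of "U\<^sub>t t" \<psi> \<Omega>] Ut_rep[of t] \<Omega> by (simp add: Hs_graph_def)
  qed

  have "U \<in> Linfty_time T (Hs_tilde s \<Omega>) (Hs_norm s)"
    by (rule Hs.Linfty_curve[OF T _ graph_cont]) (simp add: U)
  moreover have "W1infty_time T (L2 \<Omega>) (L2_norm \<Omega>) U U\<^sub>t"
    unfolding W1infty_time_def
  proof (intro conjI)
    show "U \<in> Linfty_time T (L2 \<Omega>) (L2_norm \<Omega>)" by (rule L2.Linfty_curve[OF T U_rep u_cont])
    show "U\<^sub>t \<in> Linfty_time T (L2 \<Omega>) (L2_norm \<Omega>)" by (rule L2.Linfty_curve[OF T Ut_rep v_cont])
    show "has_weak_time_derivative T (L2 \<Omega>) (L2_norm \<Omega>) U U\<^sub>t"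
    proof (rule L2.has_weak_time_derivative_curve[OF T U_rep u_cont Ut_rep v_cont])
      fix \<phi> assume \<phi>: "test_function T \<phi>"
      let ?I = "L2_fun (integral {0..T} (\<lambda>t. deriv \<phi> t *\<^sub>R u t))"
      have "integral {0..T} (\<lambda>t. \<phi> t *\<^sub>R v t) = - integral {0..T} (\<lambda>t. deriv \<phi> t *\<^sub>R u t)"
        by (rule integral_by_parts_test_function[OF \<phi> T v_cont u_eq])
      moreover have "L2_class (\<lambda>x. - ?I x) = - L2_class ?I"
        using L2_class_scaleR[of ?I "-1"] by simp
      ultimately show "\<exists>I. (I \<in> square_integrable \<and> L2_class I = integral {0..T} (\<lambda>t. deriv \<phi> t *\<^sub>R u t)) \<and>
          ((\<lambda>x. - I x) \<in> square_integrable \<and> L2_class (\<lambda>x. - I x) = integral {0..T} (\<lambda>t. \<phi> t *\<^sub>R v t))"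
        by (intro exI[of _ ?I]) (simp add: square_integrable_uminus)
    qed
  qed
  moreover have "U\<^sub>t\<^sub>t \<in> Linfty_time T (Hs_dual s \<Omega>) (Hs_dual_norm s \<Omega>)"
    by (rule dual.Linfty_curve[OF T Utt_rep accel_cont])
  moreover have "has_weak_time_derivative T (Hs_dual s \<Omega>) (Hs_dual_norm s \<Omega>)
      (\<lambda>t. L2_functional \<Omega> (U\<^sub>t t)) U\<^sub>t\<^sub>t"
  proof (rule dual.has_weak_time_derivative_curve[OF T L2_rep _ Utt_rep accel_cont])
    have v0_cont: "continuous_on {0..T} (\<lambda>t. (v t, 0 :: (real ^ 'd, real) L2_space))"
      by (intro continuous_intros v_cont)
    then show "continuous_on {0..T} (\<lambda>t. (v t, 0 :: (real ^ 'd, real) L2_space))" .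
    fix \<phi> assume \<phi>: "test_function T \<phi>"
    note tf = test_function_facts[OF \<phi>]
    let ?J = "integral {0..T} (\<lambda>t. deriv \<phi> t *\<^sub>R (v t, 0 :: (real ^ 'd, real) L2_space))"
    have "- inner ?J (Hs_graph s \<psi>) = inner (integral {0..T} (\<lambda>t. \<phi> t *\<^sub>R accel t)) (Hs_graph s \<psi>)"
      if \<psi>: "\<psi> \<in> Hs_tilde s \<Omega>" for \<psi>
    proof -
      let ?p = "L2_class \<psi>"
      have p: "?p \<in> ?V" using \<psi> by (simp add: Hs_tilde_iff[OF s])
      have w_cont: "continuous_on {0..T} (\<lambda>t. - inner (?L (u t)) (?L ?p))"
        by (intro continuous_intros Lu_cont)
      (* The weak equation, integrated in time and tested with \<psi>. *)
      have v_scalar: "inner (v t) ?p = inner (L2_class v0') ?p + integral {0..t} (\<lambda>\<tau>. - inner (?L (u \<tau>)) (?L ?p))"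
        if t: "t \<in> {0..T}" for t
      proof -
        have "continuous_on {0..t} (\<lambda>\<tau>. ?L (u \<tau>))" using t by (intro continuous_on_subset[OF Lu_cont]) auto
        from integral_inner_left[OF this, of "?L ?p"] v_eq[OF t p] show ?thesis by simp
      qed
      have "inner (integral {0..T} (\<lambda>t. \<phi> t *\<^sub>R accel t)) (Hs_graph s \<psi>)
          = integral {0..T} (\<lambda>t. inner (\<phi> t *\<^sub>R accel t) (Hs_graph s \<psi>))"
        by (intro integral_inner_left continuous_intros tf accel_cont)
      also have "\<dots> = integral {0..T} (\<lambda>t. \<phi> t *\<^sub>R (- inner (?L (u t)) (?L ?p)))"
        by (simp add: accel_def Hs_graph_def)
      also have "\<dots> = - integral {0..T} (\<lambda>t. deriv \<phi> t *\<^sub>R inner (v t) ?p)"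
        by (rule integral_by_parts_test_function[OF \<phi> T w_cont v_scalar])
      also have "integral {0..T} (\<lambda>t. deriv \<phi> t *\<^sub>R inner (v t) ?p)
          = integral {0..T} (\<lambda>t. inner (deriv \<phi> t *\<^sub>R (v t, 0)) (Hs_graph s \<psi>))"
        by (simp add: Hs_graph_def)
      also have "\<dots> = inner ?J (Hs_graph s \<psi>)"
        by (intro integral_inner_left[symmetric] continuous_intros tf v_cont)
      finally show ?thesis by simp
    qed
    then show "\<exists>I. (\<forall>\<psi>\<in>Hs_tilde s \<Omega>. I \<psi> = inner ?J (Hs_graph s \<psi>)) \<and>
        (\<forall>\<psi>\<in>Hs_tilde s \<Omega>. - I \<psi> = inner (integral {0..T} (\<lambda>t. \<phi> t *\<^sub>R accel t)) (Hs_graph s \<psi>))"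
      by (intro exI[of _ "\<lambda>\<psi>. inner ?J (Hs_graph s \<psi>)"]) simp
  qed
  moreover have "integrable (lebesgue_on {0<..<T}) (\<lambda>t. U\<^sub>t\<^sub>t t (\<phi> t)) \<and>
      integrable (lebesgue_on {0<..<T}) (\<lambda>t. Hs_form s (U t) (\<phi> t)) \<and>
      (\<integral>t. U\<^sub>t\<^sub>t t (\<phi> t) \<partial>lebesgue_on {0<..<T}) + (\<integral>t. Hs_form s (U t) (\<phi> t) \<partial>lebesgue_on {0<..<T}) = 0"
    if \<phi>: "\<phi> \<in> L1_time T (Hs_tilde s \<Omega>) (Hs_norm s)" for \<phi>
  proof -
    have "continuous_on {0..T} (\<lambda>t. - accel t)" by (intro continuous_intros accel_cont)
    then have "integrable (lebesgue_on {0<..<T}) (\<lambda>t. Hs_form s (U t) (\<phi> t))"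
      by (rule integrable_inner_L1_time[OF s T _ \<phi>]) (simp add: form accel_def Hs_graph_def)
    then show ?thesis by (simp add: U\<^sub>t\<^sub>t_def)
  qed
  moreover have "integrable (lebesgue_on {0<..<T})
      (\<lambda>t. (L2_norm \<Omega> (\<lambda>x. U t x - u0 x))\<^sup>2 + (Hs_seminorm s (\<lambda>x. U t x - u0 x))\<^sup>2)"
    "((\<lambda>h. 1 / h * (\<integral>t. ((L2_norm \<Omega> (\<lambda>x. U t x - u0 x))\<^sup>2 + (Hs_seminorm s (\<lambda>x. U t x - u0 x))\<^sup>2)
        \<partial>lebesgue_on {0<..<h})) \<longlongrightarrow> 0) (at_right 0)"
  proof -
    let ?g = "\<lambda>t. (norm (u t - u 0))\<^sup>2 + (norm (?L (u t) - ?L (u 0)))\<^sup>2"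
    have eq: "(L2_norm \<Omega> (\<lambda>x. U t x - u0 x))\<^sup>2 + (Hs_seminorm s (\<lambda>x. U t x - u0 x))\<^sup>2 = ?g t"
      if "t \<in> {0<..<T}" for t
    proof -
      have t: "t \<in> {0..T}" using that by simp
      have diff: "(\<lambda>x. U t x - u0 x) \<in> Hs_tilde s \<Omega>" "Hs_graph s (\<lambda>x. U t x - u0 x) = graph t - Hs_graph s u0"
        using Hs_graph_linear[OF s U(1)[OF t] u0(1), of 1 "-1"] U(2)[OF t] by simp_all
      have cl: "L2_class (\<lambda>x. U t x - u0 x) = u t - u 0" "?L (u t - u 0) = ?L (u t) - ?L (u 0)"
        using diff(2) L_diff[OF u_V[OF t] u0(3)] by (simp_all add: Hs_graph_def graph_def init)
      have "(\<lambda>x. U t x - u0 x) \<in> square_integrable" "AE x in lebesgue. x \<notin> \<Omega> \<longrightarrow> U t x - u0 x = 0"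
        using diff(1) unfolding Hs_tilde_iff[OF s] by (auto simp: Hs_classes_def vanishes_outside_class)
      then show ?thesis
        using Hs_norm_eq_norm_graph(1)[OF s diff(1)] L2_norm_vanishing_outside[OF _ \<Omega>, of "\<lambda>x. U t x - u0 x"]
        by (simp add: cl)
    qed
    have cont: "continuous_on {0..T} ?g" by (intro continuous_intros u_cont Lu_cont)
    show "integrable (lebesgue_on {0<..<T})
        (\<lambda>t. (L2_norm \<Omega> (\<lambda>x. U t x - u0 x))\<^sup>2 + (Hs_seminorm s (\<lambda>x. U t x - u0 x))\<^sup>2)"
      by (rule average_at_initial_time(1)[OF T cont eq]) simp_all
    show "((\<lambda>h. 1 / h * (\<integral>t. ((L2_norm \<Omega> (\<lambda>x. U t x - u0 x))\<^sup>2 + (Hs_seminorm s (\<lambda>x. U t x - u0 x))\<^sup>2)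
        \<partial>lebesgue_on {0<..<h})) \<longlongrightarrow> 0) (at_right 0)"
      by (rule average_at_initial_time(2)[OF T cont eq]) simp_all
  qed
  moreover have "integrable (lebesgue_on {0<..<T}) (\<lambda>t. (L2_norm \<Omega> (\<lambda>x. U\<^sub>t t x - v0 x))\<^sup>2)"
    "((\<lambda>h. 1 / h * (\<integral>t. (L2_norm \<Omega> (\<lambda>x. U\<^sub>t t x - v0 x))\<^sup>2 \<partial>lebesgue_on {0<..<h})) \<longlongrightarrow> 0) (at_right 0)"
  proof -
    let ?g = "\<lambda>t. (norm (v t - v 0))\<^sup>2"
    have eq: "(L2_norm \<Omega> (\<lambda>x. U\<^sub>t t x - v0 x))\<^sup>2 = ?g t" if "t \<in> {0<..<T}" for t
    proof -
      have t: "t \<in> {0..T}" using that by simp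
      have "L2_norm \<Omega> (\<lambda>x. U\<^sub>t t x - v0 x) = L2_norm \<Omega> (\<lambda>x. U\<^sub>t t x - v0' x)"
        unfolding L2_norm_def
        by (intro arg_cong[where f=sqrt] Bochner_Integration.integral_cong refl) (simp add: v0'_def)
      also have "\<dots> = norm (L2_class (\<lambda>x. U\<^sub>t t x - v0' x))"
      proof (rule L2_norm_vanishing_outside[OF _ \<Omega>])
        show "(\<lambda>x. U\<^sub>t t x - v0' x) \<in> square_integrable"
          using Ut_rep[of t] v0'(1) by (intro square_integrable_diff) auto
        have "AE x in lebesgue. x \<notin> \<Omega> \<longrightarrow> U\<^sub>t t x = 0"
          using closure_vanishes[OF v_V[OF t]] by (simp add: vanishes_outside_def U\<^sub>t_def)
        with v0'(2) show "AE x in lebesgue. x \<notin> \<Omega> \<longrightarrow> U\<^sub>t t x - v0' x = 0" by eventually_elim simp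
      qed
      also have "L2_class (\<lambda>x. U\<^sub>t t x - v0' x) = v t - v 0"
        using L2_class_diff[of "U\<^sub>t t" v0'] Ut_rep[of t] v0'(1) by (simp add: init)
      finally show ?thesis by simp
    qed
    have cont: "continuous_on {0..T} ?g" by (intro continuous_intros v_cont)
    show "integrable (lebesgue_on {0<..<T}) (\<lambda>t. (L2_norm \<Omega> (\<lambda>x. U\<^sub>t t x - v0 x))\<^sup>2)"
      by (rule average_at_initial_time(1)[OF T cont eq]) simp_all
    show "((\<lambda>h. 1 / h * (\<integral>t. (L2_norm \<Omega> (\<lambda>x. U\<^sub>t t x - v0 x))\<^sup>2 \<partial>lebesgue_on {0<..<h})) \<longlongrightarrow> 0) (at_right 0)"
      by (rule average_at_initial_time(2)[OF T cont eq]) simp_all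
  qed
  ultimately show ?thesis by (intro exI[of _ U] exI[of _ U\<^sub>t] exI[of _ U\<^sub>t\<^sub>t] conjI ballI) simp_all
qed

end
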